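(* Let $K$ be a field, $R=K[[t_1,\ldots,t_m]]$, let $>$ be a $\underline{t}$-local monomial ordering on $\mathrm{Mon}^s(\underline{t},\underline{x})$, $J\leq R[\underline{x}]_>^s$ an $R[\underline{x}]_>$-submodule and $g_1,\ldots,g_k\in J$. The following statements are equivalent: (a) $G=(g_1,\ldots,g_k)$ is a standard basis of $J$. (b) Every normal form with respect to $G$ of any element of $J$ is zero. (c) Every element of $J$ has a standard representation with respect to $G$. (d) $J=\langle G\rangle$ and $\mathrm{spoly}(g_i,g_j)$ has a standard representation with respect to $G$ for all $i<j$.
   Context: $R[\underline{x}]=K[[t_1,\ldots,t_m]][x_1,\ldots,x_n]$ is the polynomial ring in $\underline{x}=(x_1,\ldots,x_n)$ over the formal power series ring $R$ in $\underline{t}=(t_1,\ldots,t_m)$. $\mathrm{Mon}(\underline{t},\underline{x})=\{\underline{t}^\alpha\underline{x}^\beta\mid\alpha\in\mathbb{N}^m,\beta\in\mathbb{N}^n\}$ and $\mathrm{Mon}^s(\underline{t},\underline{x})=\{\underline{t}^\alpha\underline{x}^\beta e_i\mid \alpha\in\mathbb{N}^m,\beta\in\mathbb{N}^n,1\le i\le s\}$, with $e_i$ the $i$-th unit vector. A module monomial $p$ divides $p'$ if $p'=\underline{t}^\alpha\underline{x}^\beta p$ for some $\alpha,\beta$; $\mathrm{lcm}(p,p')$ is the usual least common multiple if $p,p'$ involve the same $e_i$, and $0$ otherwise. A monomial ordering on $\mathrm{Mon}(\underline{t},\underline{x})$ is a total ordering compatible with multiplication. A monomial ordering on $\mathrm{Mon}^s(\underline{t},\underline{x})$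 is a total ordering $>$ such that $p>p'$ implies $\underline{t}^\alpha\underline{x}^\beta p>\underline{t}^\alpha\underline{x}^\beta p'$ for all $\alpha,\beta$, and for which there is a monomial ordering on $\mathrm{Mon}(\underline{t},\underline{x})$ (the induced one, also denoted $>$) such that $\underline{t}^\alpha\underline{x}^\beta>\underline{t}^{\alpha'}\underline{x}^{\beta'}\Leftrightarrow\underline{t}^\alpha\underline{x}^\beta e_i>\underline{t}^{\alpha'}\underline{x}^{\beta'}e_i$ for each $i$. It is $\underline{t}$-local if $t_i<1$ for all $i=1,\ldots,m$ in the induced ordering. For $0\ne f\in R[\underline{x}]^s$, $\mathrm{lm}_>(f)$ is the largest monomial occurring in $f$ with non-zero coefficient and $\mathrm{lt}_>(f)$ the corresponding term including its coefficient; $\mathrm{lm}_>(0)=\mathrm{lt}_>(0)=0$, and $0$ is regarded as smaller than every monomial and as dividing no monomial. $S_>=\{u\in R[\underline{x}]\mid\mathrm{lt}_>(u)=1\}$ and $R[\underline{x}]_>=S_>^{-1}R[\underline{x}]$. For $f/u\in R[\underline{x}]_>^s$ with $u\in S_>$ set $\mathrm{lm}_>(f/u)=\mathrm{lm}_>(f)$, $\mathrm{lt}_>(f/u)=\mathrm{lt}_>(f)$ (well defined). For $G\subseteq R[\underline{x}]_>^s$ let $L_>(G)=\langle\mathrm{lm}_>(g)\mid g\in G\rangle\leq K[\underline{t},\underline{x}]^s$ (a $K[\underline{t},\underline{x}]$-module). A standard basis of $J$ is a finite $G\subset J$ with $L_>(G)=L_>(J)$. A division with remainder of $f\in R[\underline{x}]_>^s$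 with respect to $(g_1,\ldots,g_k)$ is a representation $f=q_1g_1+\ldots+q_kg_k+r$ with $q_i\in R[\underline{x}]_>$, $r\in R[\underline{x}]_>^s$ such that $\mathrm{lm}_>(f)\ge\mathrm{lm}_>(q_ig_i)$ for all $i$, and, unless $r=0$, $\mathrm{lm}_>(g_i)\nmid\mathrm{lm}_>(r)$ for all $i$. Then $r$ is called a normal form of $f$; if $r=0$ the representation is called a standard representation of $f$. For non-zero $f,g$: $\mathrm{spoly}(f,g)=\frac{\mathrm{lcm}(\mathrm{lm}_>(f),\mathrm{lm}_>(g))}{\mathrm{lt}_>(f)}f-\frac{\mathrm{lcm}(\mathrm{lm}_>(f),\mathrm{lm}_>(g))}{\mathrm{lt}_>(g)}g$; put $\mathrm{spoly}(f,g)=0$ if $f=0$ or $g=0$. *)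

theory Defs
  imports
    "HOL-Library.Poly_Mapping"
    "HOL-Library.Product_Plus"
    "HOL-Computational_Algebra.Fraction_Field"
    "HOL-Analysis.Finite_Cartesian_Product"
begin

section \<open>Formal power series in several variables\<close>

text \<open>
  Exponent vectors are finitely supported functions on the variables \<open>0, 1, 2, \<dots>\<close>.  The number of
  variables is fixed later by restricting to the exponent vectors supported in \<open>{..<m}\<close>, so that
  \<open>m = 0\<close> is included.
\<close>

type_synonym expo = "nat \<Rightarrow>\<^sub>0 nat"

lemma finite_bounded_expo:
  "finite {a :: expo. \<forall>i. Poly_Mapping.lookup a i \<le> Poly_Mapping.lookup c i}" (is "finite ?A")
proof -
  let ?E = "PiE (Poly_Mapping.keys c) (\<lambda>i. {..Poly_Mapping.lookup c i})"
  let ?h = "\<lambda>a. restrict (Poly_Mapping.lookup a) (Poly_Mapping.keys c)"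
  have zero: "Poly_Mapping.lookup a i = 0" if "a \<in> ?A" "i \<notin> Poly_Mapping.keys c" for a i
    using that by (metis (mono_tags, lifting) in_keys_iff le_zero_eq mem_Collect_eq)
  have "inj_on ?h ?A"
  proof (rule inj_onI, rule poly_mapping_eqI)
    fix a b i
    assume ab: "a \<in> ?A" "b \<in> ?A" and eq: "?h a = ?h b"
    show "Poly_Mapping.lookup a i = Poly_Mapping.lookup b i"
    proof (cases "i \<in> Poly_Mapping.keys c")
      case True
      then show ?thesis using fun_cong[OF eq, of i] by simp
    next
      case False
      then show ?thesis using zero[OF ab(1)] zero[OF ab(2)] by simp
    qed
  qed
  moreover have "?h ` ?A \<subseteq> ?E"
    by (auto simp: PiE_iff)
  moreover have "finite ?E" by (intro finite_PiE) auto
  ultimately show ?thesis using finite_subset inj_on_finite by blast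
qed

lemma finite_expo_sum_eq [simp]: "finite {(a, b). a + b = (c :: expo)}"
proof (rule finite_subset)
  let ?A = "{a. \<forall>i. Poly_Mapping.lookup a i \<le> Poly_Mapping.lookup c i}"
  show "{(a, b). a + b = c} \<subseteq> ?A \<times> ?A"
    by (auto simp: lookup_add)
qed (intro finite_cartesian_product finite_bounded_expo)

typedef 'a mpfs = "UNIV :: (expo \<Rightarrow> 'a) set"
  morphisms mpfs_nth Abs_mpfs ..

setup_lifting type_definition_mpfs

lemma mpfs_eqI: "(\<And>a. mpfs_nth f a = mpfs_nth g a) \<Longrightarrow> f = g"
  by (simp add: mpfs_nth_inject[symmetric] fun_eq_iff)

instantiation mpfs :: (comm_ring_1) comm_ring_1
begin

lift_definition zero_mpfs :: "'a mpfs" is "\<lambda>_. 0" .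
lift_definition one_mpfs :: "'a mpfs" is "\<lambda>a. if a = 0 then 1 else 0" .
lift_definition plus_mpfs :: "'a mpfs \<Rightarrow> 'a mpfs \<Rightarrow> 'a mpfs" is "\<lambda>f g a. f a + g a" .
lift_definition minus_mpfs :: "'a mpfs \<Rightarrow> 'a mpfs \<Rightarrow> 'a mpfs" is "\<lambda>f g a. f a - g a" .
lift_definition uminus_mpfs :: "'a mpfs \<Rightarrow> 'a mpfs" is "\<lambda>f a. - f a" .
lift_definition times_mpfs :: "'a mpfs \<Rightarrow> 'a mpfs \<Rightarrow> 'a mpfs"
  is "\<lambda>f g c. \<Sum>(a, b) | a + b = c. f a * g b" .

instance
proof
  fix f g h :: "'a mpfs"
  show "f * g * h = f * (g * h)"
  proof transfer
    fix f g h :: "expo \<Rightarrow> 'a"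
    have "(\<Sum>(x, z) | x + z = d. (\<Sum>(a, b) | a + b = x. f a * g b) * h z) =
          (\<Sum>(a, y) | a + y = d. f a * (\<Sum>(b, z) | b + z = y. g b * h z))" for d
    proof -
      have "(\<Sum>(x, z) | x + z = d. (\<Sum>(a, b) | a + b = x. f a * g b) * h z) =
            (\<Sum>p\<in>{(x, z). x + z = d}. \<Sum>q\<in>{(a, b). a + b = fst p}. f (fst q) * g (snd q) * h (snd p))"
        by (intro sum.cong) (auto simp: sum_distrib_right case_prod_unfold)
      also have "\<dots> = (\<Sum>(p, q)\<in>Sigma {(x, z). x + z = d} (\<lambda>p. {(a, b). a + b = fst p}).
                        f (fst q) * g (snd q) * h (snd p))"
        by (rule sum.Sigma) (auto simp: finite_expo_sum_eq)
      also have "\<dots> = (\<Sum>(p, q)\<in>Sigma {(a, y). a + y = d} (\<lambda>p. {(b, z). b + z = snd p}).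
                        f (fst p) * (g (fst q) * h (snd q)))"
        by (rule sum.reindex_bij_witness[where
              i = "\<lambda>((a, y), (b, z)). ((a + b, z), (a, b))" and
              j = "\<lambda>((x, z), (a, b)). ((a, b + z), (b, z))"])
           (auto simp: ac_simps)
      also have "\<dots> = (\<Sum>p\<in>{(a, y). a + y = d}. \<Sum>q\<in>{(b, z). b + z = snd p}.
                        f (fst p) * (g (fst q) * h (snd q)))"
        by (rule sum.Sigma[symmetric]) (auto simp: finite_expo_sum_eq)
      also have "\<dots> = (\<Sum>(a, y) | a + y = d. f a * (\<Sum>(b, z) | b + z = y. g b * h z))"
        by (intro sum.cong) (auto simp: sum_distrib_left case_prod_unfold)
      finally show ?thesis .
    qed
    then show "(\<lambda>d. \<Sum>(x, z) | x + z = d. (\<Sum>(a, b) | a + b = x. f a * g b) * h z) =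
               (\<lambda>d. \<Sum>(a, y) | a + y = d. f a * (\<Sum>(b, z) | b + z = y. g b * h z))"
      by blast
  qed
  show "f * g = g * f"
  proof transfer
    fix f g :: "expo \<Rightarrow> 'a"
    show "(\<lambda>c. \<Sum>(a, b) | a + b = c. f a * g b) = (\<lambda>c. \<Sum>(a, b) | a + b = c. g a * f b)"
      by (rule ext, rule sum.reindex_bij_witness[where i = prod.swap and j = prod.swap])
         (auto simp: ac_simps)
  qed
  show "1 * f = f"
  proof transfer
    fix f :: "expo \<Rightarrow> 'a"
    have "(\<Sum>(a, b) | a + b = c. (if a = 0 then 1 else 0) * f b) = f c" for c
    proof -
      have "(\<Sum>(a, b) | a + b = c. (if a = 0 then 1 else 0) * f b) =
            (\<Sum>(a, b)\<in>{(0 :: expo, c)}. (if a = 0 then 1 else 0) * f b)"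
        by (rule sum.mono_neutral_right[OF finite_expo_sum_eq]) (auto split: if_splits)
      then show ?thesis by simp
    qed
    then show "(\<lambda>c. \<Sum>(a, b) | a + b = c. (if a = 0 then 1 else 0) * f b) = f" by blast
  qed
  show "(f + g) * h = f * h + g * h"
    by transfer (auto simp: fun_eq_iff case_prod_unfold distrib_right sum.distrib)
qed (transfer; auto simp: fun_eq_iff)+

end

lemma mpfs_nth_zero [simp]: "mpfs_nth 0 a = 0"
  by (simp add: zero_mpfs.rep_eq)

lemma mpfs_nth_mult: "mpfs_nth (f * g) c = (\<Sum>(a, b) | a + b = c. mpfs_nth f a * mpfs_nth g b)"
  by (rule times_mpfs.rep_eq[THEN fun_cong])

lemma mpfs_nonzero_leading:
  fixes f :: "'a :: comm_ring_1 mpfs"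
  assumes "mpfs_nth f a1 \<noteq> 0" "Poly_Mapping.keys a1 \<subseteq> {..<N}"
  obtains a0 where "mpfs_nth f a0 \<noteq> 0" "Poly_Mapping.keys a0 \<subseteq> {..<N}"
    "\<And>a. mpfs_nth f a \<noteq> 0 \<Longrightarrow> Poly_Mapping.keys a \<subseteq> {..<N} \<Longrightarrow>
       (\<Sum>i<N. Poly_Mapping.lookup a0 i) < (\<Sum>i<N. Poly_Mapping.lookup a i) \<or>
       (\<Sum>i<N. Poly_Mapping.lookup a0 i) = (\<Sum>i<N. Poly_Mapping.lookup a i) \<and> a \<le> a0"
proof -
  define P where "P a \<longleftrightarrow> mpfs_nth f a \<noteq> 0 \<and> Poly_Mapping.keys a \<subseteq> {..<N}" for a
  define w where "w a = (\<Sum>i<N. Poly_Mapping.lookup a i)" for a :: expo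
  define d where "d = (LEAST e. \<exists>a. P a \<and> w a = e)"
  have ex: "\<exists>e a. P a \<and> w a = e" using assms P_def by blast
  define F where "F = {a. P a \<and> w a = d}"
  have "F \<noteq> {}" using LeastI_ex[OF ex] unfolding F_def d_def by blast
  moreover have "finite F"
  proof -
    define c :: expo where "c = (\<Sum>i<N. Poly_Mapping.single i d)"
    have c: "Poly_Mapping.lookup c i = (if i < N then d else 0)" for i
      by (simp add: c_def lookup_sum lookup_single when_def)
    have "F \<subseteq> {a. \<forall>i. Poly_Mapping.lookup a i \<le> Poly_Mapping.lookup c i}"
    proof safe
      fix a i assume "a \<in> F"
      then have k: "Poly_Mapping.keys a \<subseteq> {..<N}" and w: "w a = d" by (auto simp: F_def P_def)
      show "Poly_Mapping.lookup a i \<le> Poly_Mapping.lookup c i"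
      proof (cases "i < N")
        case True
        then have "Poly_Mapping.lookup a i \<le> w a" unfolding w_def by (intro member_le_sum) auto
        then show ?thesis using True w c by simp
      next
        case False
        then have "Poly_Mapping.lookup a i = 0" using k by (auto simp: in_keys_iff subset_iff)
        then show ?thesis by simp
      qed
    qed
    then show ?thesis using finite_bounded_expo finite_subset by blast
  qed
  ultimately have M: "Max F \<in> F" "\<And>a. a \<in> F \<Longrightarrow> a \<le> Max F" by auto
  have "w (Max F) < w a \<or> w (Max F) = w a \<and> a \<le> Max F" if "P a" for a
  proof -
    have "d \<le> w a" unfolding d_def using that by (intro Least_le) blast
    moreover have "w (Max F) = d" using M(1) by (simp add: F_def)
    ultimately show ?thesis using that M(2) by (auto simp: F_def le_less)
  qed
  then show ?thesis using that[of "Max F"] M(1) unfolding P_def w_def F_def by auto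
qed

instance mpfs :: (idom) idom
proof
  fix f g :: "'a mpfs"
  assume "f \<noteq> 0" "g \<noteq> 0"
  then obtain a1 b1 where ab1: "mpfs_nth f a1 \<noteq> 0" "mpfs_nth g b1 \<noteq> 0"
    by (metis mpfs_eqI mpfs_nth_zero)
  obtain N where "\<forall>i \<in> Poly_Mapping.keys a1 \<union> Poly_Mapping.keys b1. i < N"
    using finite_nat_set_iff_bounded[of "Poly_Mapping.keys a1 \<union> Poly_Mapping.keys b1"] by auto
  then have N: "Poly_Mapping.keys a1 \<subseteq> {..<N}" "Poly_Mapping.keys b1 \<subseteq> {..<N}" by auto
  define w where "w a = (\<Sum>i<N. Poly_Mapping.lookup a i)" for a :: expo
  obtain a0 where a0: "mpfs_nth f a0 \<noteq> 0" "Poly_Mapping.keys a0 \<subseteq> {..<N}"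
    "\<And>a. mpfs_nth f a \<noteq> 0 \<Longrightarrow> Poly_Mapping.keys a \<subseteq> {..<N} \<Longrightarrow> w a0 < w a \<or> w a0 = w a \<and> a \<le> a0"
    using mpfs_nonzero_leading[OF ab1(1) N(1)] unfolding w_def by blast
  obtain b0 where b0: "mpfs_nth g b0 \<noteq> 0" "Poly_Mapping.keys b0 \<subseteq> {..<N}"
    "\<And>b. mpfs_nth g b \<noteq> 0 \<Longrightarrow> Poly_Mapping.keys b \<subseteq> {..<N} \<Longrightarrow> w b0 < w b \<or> w b0 = w b \<and> b \<le> b0"
    using mpfs_nonzero_leading[OF ab1(2) N(2)] unfolding w_def by blast
  have only: "(a, b) = (a0, b0)"
    if eq: "a + b = a0 + b0" and nz: "mpfs_nth f a \<noteq> 0" "mpfs_nth g b \<noteq> 0" for a b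
  proof -
    have "Poly_Mapping.lookup a i = 0 \<and> Poly_Mapping.lookup b i = 0" if "i \<notin> {..<N}" for i
    proof -
      have "Poly_Mapping.lookup a0 i = 0" "Poly_Mapping.lookup b0 i = 0" using a0(2) b0(2) that by (auto simp: in_keys_iff subset_iff)
      then show ?thesis using arg_cong[OF eq, of "\<lambda>x. Poly_Mapping.lookup x i"] by (simp add: lookup_add)
    qed
    then have "Poly_Mapping.keys a \<subseteq> {..<N}" "Poly_Mapping.keys b \<subseteq> {..<N}" by (auto simp: in_keys_iff)
    then have le: "w a0 < w a \<or> w a0 = w a \<and> a \<le> a0" "w b0 < w b \<or> w b0 = w b \<and> b \<le> b0"
      using a0(3) b0(3) nz by auto
    have "w a + w b = w a0 + w b0"
      using arg_cong[OF eq, of w] by (simp add: w_def lookup_add sum.distrib)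
    with le have "a \<le> a0" "b \<le> b0" by auto
    then show ?thesis using eq
      by (metis add_le_cancel_right add_left_cancel add_left_mono order_antisym)
  qed
  have "mpfs_nth (f * g) (a0 + b0) = mpfs_nth f a0 * mpfs_nth g b0"
  proof -
    have "mpfs_nth (f * g) (a0 + b0) = (\<Sum>p\<in>{(a0, b0)}. case p of (a, b) \<Rightarrow> mpfs_nth f a * mpfs_nth g b)"
      unfolding mpfs_nth_mult by (rule sum.mono_neutral_right) (use only in auto)
    then show ?thesis by simp
  qed
  then show "f * g \<noteq> 0" using a0(1) b0(1) by auto
qed

definition mpfs_term :: "'a::zero \<Rightarrow> expo \<Rightarrow> 'a mpfs" where
  "mpfs_term c a = Abs_mpfs (\<lambda>a'. if a' = a then c else 0)"


section \<open>The rings $R[x] = K[[t]][x]$ and $K[t,x]$\<close>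

text \<open>The pair \<open>(a, b)\<close> stands for the monomial $t^a x^b$; multiplying monomials is adding pairs.\<close>

type_synonym mon = "expo \<times> expo"

definition mons :: "nat \<Rightarrow> nat \<Rightarrow> mon set" where
  "mons m n = {(a, b). Poly_Mapping.keys a \<subseteq> {..<m} \<and> Poly_Mapping.keys b \<subseteq> {..<n}}"

text \<open>The outer exponent is that of $x$, the coefficients are power series in $t$.\<close>

type_synonym 'k rx = "expo \<Rightarrow>\<^sub>0 'k mpfs"

definition rx_coeff :: "'k::field rx \<Rightarrow> mon \<Rightarrow> 'k" where
  "rx_coeff f = (\<lambda>(a, b). mpfs_nth (Poly_Mapping.lookup f b) a)"

definition rx_term :: "'k::field \<Rightarrow> mon \<Rightarrow> 'k rx" where
  "rx_term c = (\<lambda>(a, b). Poly_Mapping.single b (mpfs_term c a))"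

definition Rx :: "nat \<Rightarrow> nat \<Rightarrow> 'k::field rx set" where
  "Rx m n = {f. \<forall>p. rx_coeff f p \<noteq> 0 \<longrightarrow> p \<in> mons m n}"

type_synonym 'k ktx = "mon \<Rightarrow>\<^sub>0 'k"

definition Ktx :: "nat \<Rightarrow> nat \<Rightarrow> 'k::field ktx set" where
  "Ktx m n = {f. Poly_Mapping.keys f \<subseteq> mons m n}"


section \<open>Monomial orderings\<close>

text \<open>
  The pair \<open>(p, i)\<close> stands for the module monomial $p\,e_i$; the index \<open>i\<close> ranges over a finite
  type with $s$ elements.  Orderings are given by their strict part, \<open>gt p q\<close> meaning $p > q$, and
  only their values on monomials in the given variables matter.
\<close>

type_synonym 's mmon = "mon \<times> 's"

definition mmons :: "nat \<Rightarrow> nat \<Rightarrow> 's mmon set" where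
  "mmons m n = mons m n \<times> UNIV"

definition strict_total_on :: "'a set \<Rightarrow> ('a \<Rightarrow> 'a \<Rightarrow> bool) \<Rightarrow> bool" where
  "strict_total_on A gt \<longleftrightarrow> irreflp_on A gt \<and> transp_on A gt \<and> totalp_on A gt"

definition mon_ordering :: "nat \<Rightarrow> nat \<Rightarrow> (mon \<Rightarrow> mon \<Rightarrow> bool) \<Rightarrow> bool" where
  "mon_ordering m n gt \<longleftrightarrow> strict_total_on (mons m n) gt \<and>
     (\<forall>p\<in>mons m n. \<forall>p'\<in>mons m n. \<forall>q\<in>mons m n. gt p p' \<longrightarrow> gt (q + p) (q + p'))"

definition mmon_ordering ::
    "nat \<Rightarrow> nat \<Rightarrow> ('s::finite mmon \<Rightarrow> 's mmon \<Rightarrow> bool) \<Rightarrow> bool" where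
  "mmon_ordering m n gt \<longleftrightarrow> strict_total_on (mmons m n) gt \<and>
     (\<forall>p\<in>mons m n. \<forall>p'\<in>mons m n. \<forall>i j. \<forall>q\<in>mons m n.
        gt (p, i) (p', j) \<longrightarrow> gt (q + p, i) (q + p', j)) \<and>
     (\<exists>gt'. mon_ordering m n gt' \<and>
        (\<forall>i. \<forall>p\<in>mons m n. \<forall>p'\<in>mons m n. gt' p p' \<longleftrightarrow> gt (p, i) (p', i)))"

definition induced :: "('s::finite mmon \<Rightarrow> 's mmon \<Rightarrow> bool) \<Rightarrow> mon \<Rightarrow> mon \<Rightarrow> bool" where
  "induced gt p p' \<longleftrightarrow> (\<forall>i. gt (p, i) (p', i))"

text \<open>\<open>induced gt\<close> is the ordering whose existence \<open>mmon_ordering\<close> demands.\<close>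

lemma induced_eq:
  fixes gt :: "'s::finite mmon \<Rightarrow> 's mmon \<Rightarrow> bool"
  assumes "\<forall>i. \<forall>p\<in>mons m n. \<forall>p'\<in>mons m n. gt' p p' \<longleftrightarrow> gt (p, i) (p', i)"
    and "p \<in> mons m n" "p' \<in> mons m n"
  shows "gt' p p' \<longleftrightarrow> induced gt p p'"
  using assms unfolding induced_def by blast

definition t_local :: "nat \<Rightarrow> ('s::finite mmon \<Rightarrow> 's mmon \<Rightarrow> bool) \<Rightarrow> bool" where
  "t_local m gt \<longleftrightarrow> (\<forall>i<m. induced gt 0 (Poly_Mapping.single i 1, 0))"


section \<open>Leading monomials and the localisation\<close>

text \<open>
  A leading monomial is of type \<open>option\<close>, with \<open>None\<close> for the leading monomial $0$ of $0$.
  \<open>lead gt c\<close> is the largest monomial in the support of the coefficient function \<open>c\<close>.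
\<close>

definition lead :: "('p \<Rightarrow> 'p \<Rightarrow> bool) \<Rightarrow> ('p \<Rightarrow> 'k::zero) \<Rightarrow> 'p option" where
  "lead gt c = (if \<forall>p. c p = 0 then None
     else Some (THE p. c p \<noteq> 0 \<and> (\<forall>q. c q \<noteq> 0 \<and> q \<noteq> p \<longrightarrow> gt p q)))"

definition lt_rx :: "(mon \<Rightarrow> mon \<Rightarrow> bool) \<Rightarrow> 'k::field rx \<Rightarrow> 'k rx" where
  "lt_rx gt u = (case lead gt (rx_coeff u) of None \<Rightarrow> 0 | Some p \<Rightarrow> rx_term (rx_coeff u p) p)"

definition S_gt :: "nat \<Rightarrow> nat \<Rightarrow> (mon \<Rightarrow> mon \<Rightarrow> bool) \<Rightarrow> 'k::field rx set" where
  "S_gt m n gt = {u \<in> Rx m n. lt_rx gt u = 1}"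

text \<open>
  The localisation $S_>^{-1}R[x]$ of the domain $R[x]$ is realised as a subring of a field of
  fractions.  Its ordering on $\mathrm{Mon}(t,x)$ is the one induced by the module ordering \<open>gt\<close>.
\<close>

definition loc :: "nat \<Rightarrow> nat \<Rightarrow> ('s::finite mmon \<Rightarrow> 's mmon \<Rightarrow> bool) \<Rightarrow> 'k::field rx fract set" where
  "loc m n gt = {Fraction_Field.Fract f u | f u. f \<in> Rx m n \<and> u \<in> S_gt m n (induced gt)}"

definition loc_vec ::
    "nat \<Rightarrow> nat \<Rightarrow> ('s::finite mmon \<Rightarrow> 's mmon \<Rightarrow> bool) \<Rightarrow> ('k::field rx fract ^ 's) set" where
  "loc_vec m n gt = {v. \<forall>i. v $ i \<in> loc m n gt}"

definition vec_coeff :: "'k::field rx ^ 's::finite \<Rightarrow> 's mmon \<Rightarrow> 'k" where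
  "vec_coeff f = (\<lambda>(p, i). rx_coeff (f $ i) p)"

text \<open>\<open>v = f / u\<close> with $f \in R[x]^s$ and one common denominator $u \in S_>$.\<close>

definition represents :: "nat \<Rightarrow> nat \<Rightarrow> ('s::finite mmon \<Rightarrow> 's mmon \<Rightarrow> bool) \<Rightarrow>
    'k::field rx fract ^ 's \<Rightarrow> 'k rx ^ 's \<Rightarrow> 'k rx \<Rightarrow> bool" where
  "represents m n gt v f u \<longleftrightarrow>
     (\<forall>i. f $ i \<in> Rx m n) \<and> u \<in> S_gt m n (induced gt) \<and> v = (\<chi> i. Fraction_Field.Fract (f $ i) u)"

definition lm :: "nat \<Rightarrow> nat \<Rightarrow> ('s::finite mmon \<Rightarrow> 's mmon \<Rightarrow> bool) \<Rightarrow>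
    'k::field rx fract ^ 's \<Rightarrow> 's mmon option" where
  "lm m n gt v = (THE P. \<exists>f u. represents m n gt v f u \<and> P = lead gt (vec_coeff f))"

text \<open>The leading coefficient, so that the leading term of \<open>v \<noteq> 0\<close> is \<open>lc v\<close> times \<open>lm v\<close>.\<close>

definition lc :: "nat \<Rightarrow> nat \<Rightarrow> ('s::finite mmon \<Rightarrow> 's mmon \<Rightarrow> bool) \<Rightarrow>
    'k::field rx fract ^ 's \<Rightarrow> 'k" where
  "lc m n gt v =
     (THE c. \<exists>f u. represents m n gt v f u \<and> c = vec_coeff f (the (lead gt (vec_coeff f))))"

definition lm_ge :: "('p \<Rightarrow> 'p \<Rightarrow> bool) \<Rightarrow> 'p option \<Rightarrow> 'p option \<Rightarrow> bool" where
  "lm_ge gt P Q \<longleftrightarrow> (case (P, Q) of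
       (_, None) \<Rightarrow> True
     | (None, Some _) \<Rightarrow> False
     | (Some p, Some q) \<Rightarrow> p = q \<or> gt p q)"

definition lm_dvd :: "'s mmon option \<Rightarrow> 's mmon option \<Rightarrow> bool" where
  "lm_dvd P Q \<longleftrightarrow> (\<exists>p i q. P = Some (p, i) \<and> Q = Some (q + p, i))"


section \<open>Submodules and standard bases\<close>

definition is_submodule :: "'a::comm_ring_1 set \<Rightarrow> ('a ^ 's::finite) set \<Rightarrow> bool" where
  "is_submodule A M \<longleftrightarrow> 0 \<in> M \<and> (\<forall>v\<in>M. \<forall>w\<in>M. v + w \<in> M) \<and> (\<forall>c\<in>A. \<forall>v\<in>M. c *s v \<in> M)"

definition generated :: "'a::comm_ring_1 set \<Rightarrow> ('a ^ 's::finite) set \<Rightarrow> ('a ^ 's) set" where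
  "generated A B = is_submodule A hull B"

text \<open>A module monomial, or $0$, as an element of $K[t,x]^s$.\<close>

definition mon_vec :: "'s::finite mmon option \<Rightarrow> 'k::field ktx ^ 's" where
  "mon_vec P = (case P of None \<Rightarrow> 0 | Some (p, i) \<Rightarrow> axis i (Poly_Mapping.single p 1))"

definition lead_module :: "nat \<Rightarrow> nat \<Rightarrow> ('s::finite mmon \<Rightarrow> 's mmon \<Rightarrow> bool) \<Rightarrow>
    ('k::field rx fract ^ 's) set \<Rightarrow> ('k ktx ^ 's) set" where
  "lead_module m n gt G = generated (Ktx m n) ((\<lambda>g. mon_vec (lm m n gt g)) ` G)"

definition standard_basis :: "nat \<Rightarrow> nat \<Rightarrow> ('s::finite mmon \<Rightarrow> 's mmon \<Rightarrow> bool) \<Rightarrow>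
    ('k::field rx fract ^ 's) set \<Rightarrow> ('k rx fract ^ 's) set \<Rightarrow> bool" where
  "standard_basis m n gt J G \<longleftrightarrow>
     finite G \<and> G \<subseteq> J \<and> lead_module m n gt G = lead_module m n gt J"


section \<open>Division with remainder and s-polynomials\<close>

text \<open>The divisors are \<open>g 0, \<dots>, g (k - 1)\<close>.\<close>

definition division :: "nat \<Rightarrow> nat \<Rightarrow> ('s::finite mmon \<Rightarrow> 's mmon \<Rightarrow> bool) \<Rightarrow>
    nat \<Rightarrow> (nat \<Rightarrow> 'k::field rx fract ^ 's) \<Rightarrow> 'k rx fract ^ 's \<Rightarrow>
    (nat \<Rightarrow> 'k rx fract) \<Rightarrow> 'k rx fract ^ 's \<Rightarrow> bool" where
  "division m n gt k g f q r \<longleftrightarrow>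
     (\<forall>i<k. q i \<in> loc m n gt) \<and> r \<in> loc_vec m n gt \<and>
     f = (\<Sum>i<k. q i *s g i) + r \<and>
     (\<forall>i<k. lm_ge gt (lm m n gt f) (lm m n gt (q i *s g i))) \<and>
     (r \<noteq> 0 \<longrightarrow> (\<forall>i<k. \<not> lm_dvd (lm m n gt (g i)) (lm m n gt r)))"

definition normal_form :: "nat \<Rightarrow> nat \<Rightarrow> ('s::finite mmon \<Rightarrow> 's mmon \<Rightarrow> bool) \<Rightarrow>
    nat \<Rightarrow> (nat \<Rightarrow> 'k::field rx fract ^ 's) \<Rightarrow> 'k rx fract ^ 's \<Rightarrow> 'k rx fract ^ 's \<Rightarrow> bool" where
  "normal_form m n gt k g f r \<longleftrightarrow> (\<exists>q. division m n gt k g f q r)"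

definition standard_repr :: "nat \<Rightarrow> nat \<Rightarrow> ('s::finite mmon \<Rightarrow> 's mmon \<Rightarrow> bool) \<Rightarrow>
    nat \<Rightarrow> (nat \<Rightarrow> 'k::field rx fract ^ 's) \<Rightarrow> 'k rx fract ^ 's \<Rightarrow> bool" where
  "standard_repr m n gt k g f \<longleftrightarrow> (\<exists>q. division m n gt k g f q 0)"

lift_definition expo_lcm :: "expo \<Rightarrow> expo \<Rightarrow> expo" is "\<lambda>a b i. max (a i) (b i)"
proof -
  fix a b :: "nat \<Rightarrow> nat"
  assume "finite {i. a i \<noteq> 0}" "finite {i. b i \<noteq> 0}"
  then show "finite {i. max (a i) (b i) \<noteq> 0}"
    by (rule finite_subset[rotated, OF finite_UnI]) auto
qed

definition mon_lcm :: "mon \<Rightarrow> mon \<Rightarrow> mon" where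
  "mon_lcm = (\<lambda>(a, b) (a', b'). (expo_lcm a a', expo_lcm b b'))"

definition term_loc :: "'k::field \<Rightarrow> mon \<Rightarrow> 'k rx fract" where
  "term_loc c p = Fraction_Field.Fract (rx_term c p) 1"

text \<open>
  With leading terms $c\,p\,e_i$ and $d\,q\,e_i$ and $l = \mathrm{lcm}(p, q)$, the coefficients
  are $l / (c\,p)$ and $l / (d\,q)$; monomials are divided by subtracting exponents.
\<close>

definition spoly :: "nat \<Rightarrow> nat \<Rightarrow> ('s::finite mmon \<Rightarrow> 's mmon \<Rightarrow> bool) \<Rightarrow>
    'k::field rx fract ^ 's \<Rightarrow> 'k rx fract ^ 's \<Rightarrow> 'k rx fract ^ 's" where
  "spoly m n gt f g = (case (lm m n gt f, lm m n gt g) of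
       (Some (p, i), Some (q, j)) \<Rightarrow>
         if i = j then
           term_loc (1 / lc m n gt f) (mon_lcm p q - p) *s f -
           term_loc (1 / lc m n gt g) (mon_lcm p q - q) *s g
         else 0
     | _ \<Rightarrow> 0)"

end

theory Submission
  imports Defs
begin

text \<open>
  All four conditions are compared with one statement about leading monomials:
  every non-zero \<open>f \<in> J\<close> has its leading monomial divisible by that of some \<open>g i\<close>.
  This is condition (a), because a monomial lies in a module generated by monomials only if one of the
  generators divides it (\<open>generated_monomials_keys\<close>).  It implies (b), as a non-zero normal form of an
  element of \<open>J\<close> would be an element of \<open>J\<close> violating it; and an element of \<open>J\<close> violating it is a normal
  form of itself.  From (c) it follows because in a sum of products none of which exceeds the leading
  monomial of the sum, that monomial must come from one of the products; and (c) implies (d) as s-polynomials of elements of \<open>J\<close>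
  are in \<open>J\<close>.  What remains are two arguments with content: (a) implies (c), and (d) implies (a).

  Both rest on division with remainder, \<open>weak_division\<close>.  After clearing denominators, the claim is that
  \<open>u f = \<Sum> q\<^sub>l g\<^sub>l + r\<close> for some \<open>u\<close> with leading term $1$, where no product exceeds the leading monomial of
  \<open>f\<close>, and that of \<open>r\<close> is divisible by none of those of the \<open>g\<^sub>l\<close>.
  Power series have infinite support and the ordering is not a well-ordering, so the division cannot
  simply be run.  But among the monomials of bounded $x$-degree there is no infinite ascending chain
  (\<open>wf_gt_bounded\<close>): by Dickson's lemma and $t_i < 1$.  As long as the $x$-degree stays bounded, quotients and
  remainder can therefore be defined coefficient by coefficient, by well-founded recursion from the largest
  monomial downwards (\<open>bounded_division\<close>); no limit process is involved.  In that division a divisor may be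
  used only if the product stays within the degree bound, which amounts to dividing homogenised elements
  and allows a remainder whose leading monomial is divisible only after the bound is raised.  Mora's
  idea deals with this: the elements \<open>u f - \<Sum> q\<^sub>l g\<^sub>l\<close> obtained so far are used as divisors too.
  By Dickson's lemma, the homogenised leading monomials of finitely many of them divide
  those of all others.  The one with the smallest leading monomial must be a remainder as wanted: otherwise dividing it,
  preferably by the \<open>g\<^sub>l\<close>, within a large enough degree bound would give an element of the same form whose
  homogenised leading monomial none of the finitely many divides.

  For (d) implies (a), the relations expressing the s-polynomials by \<open>G\<close> are syzygies of \<open>G\<close>.  Write
  \<open>f = \<Sum> a\<^sub>l g\<^sub>l\<close> and divide the coefficient vector \<open>a\<close> by these syzygies with respect to Schreyer's
  ordering on the free module with one basis vector for each \<open>g\<^sub>l\<close>.  The remainder represents \<open>u f\<close>, and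
  since its leading term is not divisible by the leading term of any syzygy, the leading
  terms of its products with the \<open>g\<^sub>l\<close> cannot cancel (\<open>buchberger_over_Rx\<close>).  The same division theorem is used
  here for another module, which is why it is proved for vectors over an arbitrary finite index set.
\<close>

section \<open>Coefficients of elements of $R[x]$\<close>

lemma mpfs_nth_add: "mpfs_nth (f + g) a = mpfs_nth f a + mpfs_nth g a"
  by (simp add: plus_mpfs.rep_eq)

lemma mpfs_nth_uminus: "mpfs_nth (- f) a = - mpfs_nth f a"
  by (simp add: uminus_mpfs.rep_eq)

lemma mpfs_nth_sum: "mpfs_nth (sum f A) a = (\<Sum>x\<in>A. mpfs_nth (f x) a)"
  by (induction A rule: infinite_finite_induct) (simp_all add: mpfs_nth_add)

lemma finite_mon_sum_eq [simp]: "finite {(p, q). p + q = (c :: mon)}"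
proof -
  have "{(p, q). p + q = c} \<subseteq>
    (\<lambda>((a, a'), (b, b')). ((a, b), (a', b'))) `
      ({(a, a'). a + a' = fst c} \<times> {(b, b'). b + b' = snd c})"
  proof
    fix x assume "x \<in> {(p, q). p + q = c}"
    then obtain a b a' b' where x: "x = ((a, b), (a', b'))" and "(a + a', b + b') = c" by fastforce
    then have "a + a' = fst c" "b + b' = snd c" by auto
    then show "x \<in> (\<lambda>((a, a'), (b, b')). ((a, b), (a', b'))) `
        ({(a, a'). a + a' = fst c} \<times> {(b, b'). b + b' = snd c})"
      unfolding x by (intro image_eqI[of _ _ "((a, a'), (b, b'))"]) auto
  qed
  then show ?thesis
    by (rule finite_subset) (rule finite_imageI, rule finite_cartesian_product; rule finite_expo_sum_eq)
qed

lemma lookup_mult_conv: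
  fixes f g :: "expo \<Rightarrow>\<^sub>0 'a::comm_ring_1"
  shows "Poly_Mapping.lookup (f * g) c =
    (\<Sum>(a, b) | a + b = c. Poly_Mapping.lookup f a * Poly_Mapping.lookup g b)"
proof -
  have "Poly_Mapping.lookup (f * g) c =
      (\<Sum>(a, b). Poly_Mapping.lookup f a * Poly_Mapping.lookup g b when c = a + b)"
    by (simp add: times_poly_mapping.rep_eq prod_fun_unfold_prod)
  also have "\<dots> = (\<Sum>(a, b) | a + b = c. Poly_Mapping.lookup f a * Poly_Mapping.lookup g b when c = a + b)"
    by (rule Sum_any.expand_superset) (auto simp: when_def split: if_splits)
  also have "\<dots> = (\<Sum>(a, b) | a + b = c. Poly_Mapping.lookup f a * Poly_Mapping.lookup g b)"
    by (rule sum.cong) (auto simp: when_def)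
  finally show ?thesis .
qed

lemma rx_coeff_mult:
  "rx_coeff (f * g) c = (\<Sum>(p, q) | p + q = c. rx_coeff f p * rx_coeff g q)"
proof -
  obtain a b where c: "c = (a, b)" by (cases c)
  have "rx_coeff (f * g) c = (\<Sum>(b1, b2) | b1 + b2 = b. \<Sum>(a1, a2) | a1 + a2 = a.
      rx_coeff f (a1, b1) * rx_coeff g (a2, b2))"
  proof -
    have "rx_coeff (f * g) c = mpfs_nth (\<Sum>(b1, b2) | b1 + b2 = b.
        Poly_Mapping.lookup f b1 * Poly_Mapping.lookup g b2) a"
      unfolding c rx_coeff_def prod.case lookup_mult_conv ..
    also have "\<dots> = (\<Sum>(b1, b2) | b1 + b2 = b.
        mpfs_nth (Poly_Mapping.lookup f b1 * Poly_Mapping.lookup g b2) a)"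
      unfolding mpfs_nth_sum by (rule sum.cong) auto
    finally show ?thesis unfolding mpfs_nth_mult rx_coeff_def prod.case .
  qed
  also have "\<dots> = (\<Sum>((b1, b2), (a1, a2)) \<in> {(b1, b2). b1 + b2 = b} \<times> {(a1, a2). a1 + a2 = a}.
      rx_coeff f (a1, b1) * rx_coeff g (a2, b2))"
    unfolding sum.cartesian_product[symmetric] by (simp only: case_prod_unfold)
  also have "\<dots> = (\<Sum>(p, q) | p + q = c. rx_coeff f p * rx_coeff g q)"
    by (rule sum.reindex_bij_witness[where
          i = "\<lambda>((a1, b1), (a2, b2)). ((b1, b2), (a1, a2))" and
          j = "\<lambda>((b1, b2), (a1, a2)). ((a1, b1), (a2, b2))"])
       (auto simp: c)
  finally show ?thesis .
qed

lemma rx_coeff_zero [simp]: "rx_coeff 0 p = 0"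
  by (cases p) (simp add: rx_coeff_def)

lemma rx_coeff_add: "rx_coeff (f + g) p = rx_coeff f p + rx_coeff g p"
  by (cases p) (simp add: rx_coeff_def lookup_add mpfs_nth_add)

lemma rx_coeff_uminus: "rx_coeff (- f) p = - rx_coeff f p"
  by (cases p) (simp add: rx_coeff_def mpfs_nth_uminus)

lemma rx_coeff_diff: "rx_coeff (f - g) p = rx_coeff f p - rx_coeff g p"
  using rx_coeff_add[of f "- g" p] by (simp add: rx_coeff_uminus)

lemma rx_coeff_sum: "rx_coeff (sum f A) p = (\<Sum>x\<in>A. rx_coeff (f x) p)"
  by (induction A rule: infinite_finite_induct) (simp_all add: rx_coeff_add)

lemma rx_eqI: "(\<And>p. rx_coeff f p = rx_coeff g p) \<Longrightarrow> f = g"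
  by (rule poly_mapping_eqI, rule mpfs_eqI) (use rx_coeff_def in \<open>metis (no_types, lifting) case_prod_conv\<close>)

lemma rx_coeff_term: "rx_coeff (rx_term c p) q = (if q = p then c else 0)"
  by (cases p, cases q)
    (auto simp: rx_coeff_def rx_term_def mpfs_term_def lookup_single when_def Abs_mpfs_inverse)

lemma rx_coeff_one: "rx_coeff 1 q = (if q = 0 then 1 else 0)"
  by (cases q) (auto simp: rx_coeff_def lookup_one when_def one_mpfs.rep_eq zero_prod_def)

lemma rx_term_one: "rx_term 1 0 = 1"
  by (rule rx_eqI) (simp add: rx_coeff_term rx_coeff_one)

lemma rx_coeff_mult_nonzero:
  assumes "rx_coeff (f * g) c \<noteq> 0"
  obtains p q where "c = p + q" "rx_coeff f p \<noteq> 0" "rx_coeff g q \<noteq> 0"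
proof -
  have "\<exists>x\<in>{(p, q). p + q = c}. (case x of (p, q) \<Rightarrow> rx_coeff f p * rx_coeff g q) \<noteq> 0"
    using assms unfolding rx_coeff_mult by (rule contrapos_np) (auto intro!: sum.neutral)
  then show ?thesis using that by auto
qed

text \<open>For leading monomials \<open>p0\<close> and \<open>q0\<close> no other factorisation of \<open>p0 + q0\<close> contributes.\<close>

lemma rx_coeff_mult_single:
  assumes "\<And>p q. p + q = p0 + q0 \<Longrightarrow> rx_coeff f p \<noteq> 0 \<Longrightarrow> rx_coeff g q \<noteq> 0 \<Longrightarrow> p = p0"
  shows "rx_coeff (f * g) (p0 + q0) = rx_coeff f p0 * rx_coeff g q0"
proof -
  have "rx_coeff (f * g) (p0 + q0) = (\<Sum>(p, q)\<in>{(p0, q0)}. rx_coeff f p * rx_coeff g q)"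
    unfolding rx_coeff_mult
  proof (rule sum.mono_neutral_right)
    show "\<forall>x\<in>{(p, q). p + q = p0 + q0} - {(p0, q0)}.
        (case x of (p, q) \<Rightarrow> rx_coeff f p * rx_coeff g q) = 0"
    proof safe
      fix p q assume *: "p + q = p0 + q0" "rx_coeff f p * rx_coeff g q \<noteq> 0"
      then have "p = p0" using assms by auto
      then show "p = p0" and "q = q0" using * by auto
    qed
  qed auto
  then show ?thesis by simp
qed


section \<open>Monomials\<close>

lemma mons_zero [simp]: "0 \<in> mons m n"
  by (auto simp: mons_def zero_prod_def)

lemma mons_add_iff: "p + q \<in> mons m n \<longleftrightarrow> p \<in> mons m n \<and> q \<in> mons m n"
proof -
  have "Poly_Mapping.keys (a + b) = Poly_Mapping.keys a \<union> Poly_Mapping.keys b" for a b :: expo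
    by (auto simp: in_keys_iff lookup_add)
  then show ?thesis by (cases p, cases q) (auto simp: mons_def)
qed

text \<open>The total degree in the variables $x$.\<close>

definition xdeg :: "nat \<Rightarrow> mon \<Rightarrow> nat" where
  "xdeg n p = (\<Sum>i<n. Poly_Mapping.lookup (snd p) i)"

lemma xdeg_add: "xdeg n (p + q) = xdeg n p + xdeg n q"
  by (simp add: xdeg_def lookup_add sum.distrib)

lemma finite_bounded_degree_expo:
  "finite {b :: expo. Poly_Mapping.keys b \<subseteq> {..<n} \<and> (\<Sum>i<n. Poly_Mapping.lookup b i) \<le> d}"
proof -
  define c :: expo where "c = (\<Sum>i<n. Poly_Mapping.single i d)"
  have c: "Poly_Mapping.lookup c i = (if i < n then d else 0)" for i
    by (simp add: c_def lookup_sum lookup_single when_def)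
  have "Poly_Mapping.lookup b i \<le> Poly_Mapping.lookup c i"
    if b: "Poly_Mapping.keys b \<subseteq> {..<n}" "(\<Sum>i<n. Poly_Mapping.lookup b i) \<le> d" for b i
  proof (cases "i < n")
    case True
    then have "Poly_Mapping.lookup b i \<le> (\<Sum>i<n. Poly_Mapping.lookup b i)" by (intro member_le_sum) auto
    then show ?thesis using b True by (simp add: c)
  next
    case False
    then have "Poly_Mapping.lookup b i = 0" using b by (auto simp: in_keys_iff subset_iff)
    then show ?thesis by simp
  qed
  then show ?thesis by (intro finite_subset[OF _ finite_bounded_expo[of c]]) auto
qed

lemma RxI: "(\<And>p. rx_coeff f p \<noteq> 0 \<Longrightarrow> p \<in> mons m n) \<Longrightarrow> f \<in> Rx m n"
  unfolding Rx_def by blast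

lemma Rx_coeffD: "f \<in> Rx m n \<Longrightarrow> rx_coeff f p \<noteq> 0 \<Longrightarrow> p \<in> mons m n"
  unfolding Rx_def by blast

lemma Rx_zero [simp]: "0 \<in> Rx m n"
  by (rule RxI) simp

lemma Rx_one [simp]: "1 \<in> Rx m n"
  by (rule RxI) (metis mons_zero rx_coeff_one)

lemma Rx_add: "f \<in> Rx m n \<Longrightarrow> g \<in> Rx m n \<Longrightarrow> f + g \<in> Rx m n"
  by (rule RxI) (metis Rx_coeffD add.right_neutral rx_coeff_add)

lemma Rx_uminus: "f \<in> Rx m n \<Longrightarrow> - f \<in> Rx m n"
  by (rule RxI) (metis Rx_coeffD neg_equal_0_iff_equal rx_coeff_uminus)

lemma Rx_diff: "f \<in> Rx m n \<Longrightarrow> g \<in> Rx m n \<Longrightarrow> f - g \<in> Rx m n"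
  using Rx_add[of f m n "- g"] Rx_uminus[of g] by simp

lemma Rx_mult: "f \<in> Rx m n \<Longrightarrow> g \<in> Rx m n \<Longrightarrow> f * g \<in> Rx m n"
  by (rule RxI) (metis Rx_coeffD mons_add_iff rx_coeff_mult_nonzero)

lemma Rx_sum: "(\<And>x. x \<in> A \<Longrightarrow> f x \<in> Rx m n) \<Longrightarrow> sum f A \<in> Rx m n"
  by (induction A rule: infinite_finite_induct) (simp_all add: Rx_add)

lemma Rx_term: "p \<in> mons m n \<Longrightarrow> rx_term c p \<in> Rx m n"
  by (rule RxI) (metis rx_coeff_term)

lemma Rx_bounded: "\<exists>d. \<forall>p. rx_coeff f p \<noteq> 0 \<longrightarrow> xdeg n p \<le> d"
proof -
  let ?S = "(\<lambda>b. xdeg n (0, b)) ` Poly_Mapping.keys f"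
  have "xdeg n p \<le> Max ?S" if "rx_coeff f p \<noteq> 0" for p
  proof (rule Max_ge)
    obtain a b where p: "p = (a, b)" by (cases p)
    have "b \<in> Poly_Mapping.keys f" using that unfolding p rx_coeff_def by (auto simp: in_keys_iff)
    then show "xdeg n p \<in> ?S" unfolding p by (auto simp: xdeg_def)
  qed simp
  then show ?thesis by blast
qed

text \<open>
  Conversely, since there are finitely many $x^\<beta>$ of bounded degree, every coefficient function of bounded
  $x$-degree comes from an element of $R[x]$: no condition is imposed in the $t$-direction.
\<close>

lemma Rx_of_coeff:
  assumes "\<And>p. c p \<noteq> 0 \<Longrightarrow> p \<in> mons m n \<and> xdeg n p \<le> d"
  obtains f where "f \<in> Rx m n" "rx_coeff f = c"
proof -
  define h where "h b = Abs_mpfs (\<lambda>a. c (a, b))" for b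
  have "finite {b. h b \<noteq> 0}"
  proof (rule finite_subset[OF _ finite_bounded_degree_expo])
    show "{b. h b \<noteq> 0} \<subseteq>
        {b. Poly_Mapping.keys b \<subseteq> {..<n} \<and> (\<Sum>i<n. Poly_Mapping.lookup b i) \<le> d}"
    proof (clarify, goal_cases)
      case (1 b)
      then obtain a where "c (a, b) \<noteq> 0"
        by (metis (mono_tags) h_def mpfs_eqI mpfs_nth_zero Abs_mpfs_inverse UNIV_I)
      from assms[OF this] show ?case by (auto simp: mons_def xdeg_def)
    qed
  qed
  then have "rx_coeff (Abs_poly_mapping h) = c"
    by (auto simp: rx_coeff_def Abs_mpfs_inverse h_def fun_eq_iff)
  then show ?thesis using that[of "Abs_poly_mapping h"] assms by (simp add: Rx_def)
qed


section \<open>Dickson's lemma\<close>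

lemma nat_seq_monotone_subseq:
  fixes f :: "nat \<Rightarrow> nat"
  obtains r :: "nat \<Rightarrow> nat" where "strict_mono r" "\<And>j k. j \<le> k \<Longrightarrow> f (r j) \<le> f (r k)"
proof -
  obtain r where r: "strict_mono (r :: nat \<Rightarrow> nat)" "monoseq (\<lambda>k. f (r k))"
    using seq_monosub[of f] by (elim exE conjE)
  show ?thesis
  proof (cases "\<forall>j k. j \<le> k \<longrightarrow> f (r j) \<le> f (r k)")
    case True
    then show ?thesis using that[OF r(1)] by auto
  next
    case False
    then have dec: "j \<le> k \<Longrightarrow> f (r k) \<le> f (r j)" for j k using r(2) unfolding monoseq_def by blast
    define v where "v = (LEAST v. \<exists>j. v = f (r j))"
    obtain N where N: "v = f (r N)" using LeastI_ex[of "\<lambda>v. \<exists>j. v = f (r j)"] unfolding v_def by blast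
    have "f (r (N + k)) = v" for k
      using dec[of N "N + k"] Least_le[of "\<lambda>v. \<exists>j. v = f (r j)" "f (r (N + k))"] N unfolding v_def
      by fastforce
    moreover have "strict_mono (\<lambda>k. r (N + k))" using r(1) by (simp add: strict_mono_def)
    ultimately show ?thesis using that[of "\<lambda>k. r (N + k)"] by simp
  qed
qed

lemma nat_tuple_monotone_subseq:
  fixes f :: "nat \<Rightarrow> nat \<Rightarrow> nat"
  shows "\<exists>r :: nat \<Rightarrow> nat. strict_mono r \<and> (\<forall>i<N. \<forall>j k. j \<le> k \<longrightarrow> f (r j) i \<le> f (r k) i)"
proof (induction N)
  case 0
  show ?case by (rule exI[of _ id]) (simp add: strict_mono_def)
next
  case (Suc N)
  then obtain r :: "nat \<Rightarrow> nat" where r: "strict_mono r" "\<forall>i<N. \<forall>j k. j \<le> k \<longrightarrow> f (r j) i \<le> f (r k) i"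
    by (elim exE conjE)
  obtain r' :: "nat \<Rightarrow> nat" where r': "strict_mono r'" "\<And>j k. j \<le> k \<Longrightarrow> f (r (r' j)) N \<le> f (r (r' k)) N"
    by (rule nat_seq_monotone_subseq[of "\<lambda>j. f (r j) N"]) (rule that)
  have "strict_mono (\<lambda>j. r (r' j))" using r(1) r'(1) by (simp add: strict_mono_def)
  moreover have "r' j \<le> r' k" if "j \<le> k" for j k using r'(1) that by (simp add: strict_mono_less_eq)
  ultimately show ?case using r r' by (intro exI[of _ "\<lambda>j. r (r' j)"] conjI) (auto simp: less_Suc_eq)
qed

text \<open>
  \<open>P = (p, i)\<close> at level \<open>d\<close>, where \<open>d\<close> bounds the $x$-degree of \<open>p\<close>, stands for the homogenised monomial
  $t^\<alpha> x_0^{d - |\<beta>|} x^\<beta> e_i$ of degree \<open>d\<close>, and \<open>hdvd\<close> is divisibility of these.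
\<close>

definition hdvd :: "nat \<Rightarrow> (mon \<times> 'i) \<times> nat \<Rightarrow> (mon \<times> 'i) \<times> nat \<Rightarrow> bool" where
  "hdvd n = (\<lambda>((p, i), d) ((p', i'), d'). i = i' \<and> (\<exists>q. p' = q + p \<and> d + xdeg n q \<le> d'))"

lemma expo_le_imp_add:
  fixes a b :: expo
  assumes "\<And>i. Poly_Mapping.lookup a i \<le> Poly_Mapping.lookup b i"
  shows "b = (b - a) + a"
  by (rule poly_mapping_eqI) (simp add: lookup_add lookup_minus assms)

text \<open>
  Apart from the exponents, the slack \<open>d - xdeg p\<close>, which is the exponent of $x_0$, is a coordinate.
\<close>

lemma Dickson:
  fixes f :: "nat \<Rightarrow> (mon \<times> 'i) \<times> nat"
  assumes "finite I" and f: "\<And>j. f j \<in> (mons m n \<times> I) \<times> UNIV"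
    and deg: "\<And>j. xdeg n (fst (fst (f j))) \<le> snd (f j)"
  obtains j k where "j < k" "hdvd n (f j) (f k)"
proof -
  obtain e :: "'i \<Rightarrow> nat" and N where e: "e ` I = {..<N}" "inj_on e I"
    using finite_imp_inj_to_nat_seg[OF \<open>finite I\<close>] unfolding lessThan_def by (elim exE conjE)
  have eN: "i \<in> I \<Longrightarrow> e i < N" for i using e(1) by blast
  define a where "a j = fst (fst (fst (f j)))" for j
  define b where "b j = snd (fst (fst (f j)))" for j
  define i where "i j = snd (fst (f j))" for j
  define s where "s j = snd (f j)" for j
  define p where "p j = (a j, b j)" for j
  have fj: "f j = ((p j, i j), s j)" for j by (simp add: p_def a_def b_def i_def s_def)
  have mem: "p j \<in> mons m n" "i j \<in> I" "xdeg n (p j) \<le> s j" for j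
    using f[of j] deg[of j] unfolding fj by simp_all
  \<comment> \<open>The last two coordinates grow in opposite directions with the index, so that both increase
    only if the index stays the same.\<close>
  define F where "F j l = (if l < m then Poly_Mapping.lookup (a j) l else
      if l < m + n then Poly_Mapping.lookup (b j) (l - m) else
      if l = m + n then s j - xdeg n (p j) else if l = m + n + 1 then e (i j) else N - e (i j))" for j l
  obtain r :: "nat \<Rightarrow> nat" where r: "strict_mono r" "\<forall>l<m+n+3. \<forall>j k. j \<le> k \<longrightarrow> F (r j) l \<le> F (r k) l"
    using nat_tuple_monotone_subseq[of "m+n+3" F] by (elim exE conjE)
  define j where "j = r 0"
  define k where "k = r 1"
  have "j < k" using r(1) by (simp add: j_def k_def strict_mono_less)
  have le: "F j l \<le> F k l" if "l < m + n + 3" for l using r(2) that by (simp add: j_def k_def)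
  have "e (i j) = e (i k)" using le[of "m+n+1"] le[of "m+n+2"] eN[OF mem(2)[of j]] eN[OF mem(2)[of k]]
    by (simp add: F_def)
  then have ieq: "i j = i k" using e(2) mem(2) by (auto dest: inj_onD)
  have "Poly_Mapping.lookup (a j) l \<le> Poly_Mapping.lookup (a k) l" for l
  proof (cases "l < m")
    case True
    then show ?thesis using le[of l] by (simp add: F_def)
  next
    case False
    then have "Poly_Mapping.lookup (a j) l = 0"
      using mem(1)[of j] by (auto simp: mons_def p_def in_keys_iff subset_iff)
    then show ?thesis by simp
  qed
  then have 1: "a k = (a k - a j) + a j" by (rule expo_le_imp_add)
  have "Poly_Mapping.lookup (b j) l \<le> Poly_Mapping.lookup (b k) l" for l
  proof (cases "l < n")
    case True
    then show ?thesis using le[of "m + l"] by (simp add: F_def)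
  next
    case False
    then have "Poly_Mapping.lookup (b j) l = 0"
      using mem(1)[of j] by (auto simp: mons_def p_def in_keys_iff subset_iff)
    then show ?thesis by simp
  qed
  then have 2: "b k = (b k - b j) + b j" by (rule expo_le_imp_add)
  define q where "q = (a k - a j, b k - b j)"
  have pk: "p k = q + p j" using 1 2 by (simp add: q_def p_def)
  have "s j - xdeg n (p j) \<le> s k - xdeg n (p k)" using le[of "m+n"] by (simp add: F_def)
  then have "s j + xdeg n q \<le> s k" using mem(3)[of j] mem(3)[of k] pk by (simp add: xdeg_add)
  with pk ieq have "hdvd n (f j) (f k)" unfolding hdvd_def fj prod.case by blast
  with \<open>j < k\<close> show ?thesis by (rule that)
qed

text \<open>
  If no finite subset sufficed, one could keep choosing elements above none of the earlier ones.
\<close>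

lemma finite_basis_if_no_bad_sequence:
  fixes A :: "'a set" and le :: "'a \<Rightarrow> 'a \<Rightarrow> bool"
  assumes no_bad: "\<And>f. (\<And>j :: nat. f j \<in> A) \<Longrightarrow> \<exists>j k. j < k \<and> le (f j) (f k)"
  shows "\<exists>B\<subseteq>A. finite B \<and> (\<forall>a\<in>A. \<exists>b\<in>B. le b a)"
proof (rule ccontr)
  assume contra: "\<not> (\<exists>B\<subseteq>A. finite B \<and> (\<forall>a\<in>A. \<exists>b\<in>B. le b a))"
  define ch where "ch B = (SOME a. a \<in> A \<and> (\<forall>b\<in>B. \<not> le b a))" for B
  have ch0: "ch B \<in> A \<and> (\<forall>b\<in>B. \<not> le b (ch B))" if B: "finite B" "B \<subseteq> A" for B
  proof -
    have "\<not> (\<forall>a\<in>A. \<exists>b\<in>B. le b a)" using contra B by simp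
    then have "\<exists>a. a \<in> A \<and> (\<forall>b\<in>B. \<not> le b a)" by blast
    then show ?thesis unfolding ch_def by (rule someI_ex[of "\<lambda>a. a \<in> A \<and> (\<forall>b\<in>B. \<not> le b a)"])
  qed
  define S :: "nat \<Rightarrow> 'a set" where "S = rec_nat {} (\<lambda>_ B. insert (ch B) B)"
  have S_Suc: "S (Suc j) = insert (ch (S j)) (S j)" for j by (simp add: S_def)
  have S: "finite (S j) \<and> S j \<subseteq> A" for j
  proof (induction j)
    case 0
    show ?case by (simp add: S_def)
  next
    case (Suc j)
    then show ?case using ch0[of "S j"] by (simp add: S_Suc)
  qed
  have mem: "j < k \<Longrightarrow> ch (S j) \<in> S k" for j k
    by (induction k) (auto simp: S_Suc less_Suc_eq)
  have "ch (S j) \<in> A" for j using ch0 S by simp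
  from no_bad[of "\<lambda>j. ch (S j)", OF this]
  obtain j k where jk: "j < k" "le (ch (S j)) (ch (S k))" by (elim exE conjE)
  then show False using mem[OF jk(1)] ch0[of "S k"] S by simp
qed


section \<open>Module orderings and leading monomials of vectors\<close>

definition vc :: "('i \<Rightarrow> 'k::field rx) \<Rightarrow> mon \<times> 'i \<Rightarrow> 'k" where
  "vc F = (\<lambda>(p, i). rx_coeff (F i) p)"

text \<open>The product of a monomial and a module monomial; \<open>vc F P\<close> is the coefficient of \<open>F\<close> at \<open>P\<close>.\<close>

definition shift :: "mon \<Rightarrow> mon \<times> 'i \<Rightarrow> mon \<times> 'i" where
  "shift q P = (q + fst P, snd P)"

lemma vc_pair [simp]: "vc F (p, i) = rx_coeff (F i) p"
  by (simp add: vc_def)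

lemma vc_eq: "vc F P = rx_coeff (F (snd P)) (fst P)"
  by (simp add: vc_def case_prod_unfold)

lemma fst_shift [simp]: "fst (shift q P) = q + fst P"
  and snd_shift [simp]: "snd (shift q P) = snd P"
  and shift_zero [simp]: "shift 0 P = P"
  and shift_shift: "shift q (shift q' P) = shift (q + q') P"
  and shift_cancel [simp]: "shift q P = shift q' P \<longleftrightarrow> q = q'"
  by (simp_all add: shift_def prod_eq_iff add.assoc)

text \<open>
  The index set is a set rather than a type, so that Schreyer's ordering, whose indices are those of an
  arbitrary finite family of vectors, is an instance as well.  The ordering induced on monomials is
  a separate parameter \<open>mo\<close>, because it cannot be recovered from \<open>gt\<close> if the index set is empty.
\<close>

locale module_order =
  fixes m n :: nat
    and mo :: "mon \<Rightarrow> mon \<Rightarrow> bool"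
    and I :: "'i set"
    and gt :: "mon \<times> 'i \<Rightarrow> mon \<times> 'i \<Rightarrow> bool"
  assumes finite_I: "finite I"
    and gt_strict_total: "strict_total_on (mons m n \<times> I) gt"
    and gt_shift: "\<And>P Q q. P \<in> mons m n \<times> I \<Longrightarrow> Q \<in> mons m n \<times> I \<Longrightarrow> q \<in> mons m n \<Longrightarrow>
      gt P Q \<Longrightarrow> gt (shift q P) (shift q Q)"
    and gt_same_index: "\<And>i p q. i \<in> I \<Longrightarrow> p \<in> mons m n \<Longrightarrow> q \<in> mons m n \<Longrightarrow> gt (p, i) (q, i) \<longleftrightarrow> mo p q"
    and mo_ordering: "mon_ordering m n mo"
    and t_small: "\<And>i. i < m \<Longrightarrow> mo 0 (Poly_Mapping.single i 1, 0)"
begin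

abbreviation MM :: "(mon \<times> 'i) set" where "MM \<equiv> mons m n \<times> I"

definition ge :: "mon \<times> 'i \<Rightarrow> mon \<times> 'i \<Rightarrow> bool" where "ge P Q \<longleftrightarrow> P = Q \<or> gt P Q"

definition moge :: "mon \<Rightarrow> mon \<Rightarrow> bool" where "moge p q \<longleftrightarrow> p = q \<or> mo p q"

lemma shift_MM [simp]: "shift q P \<in> MM \<longleftrightarrow> q \<in> mons m n \<and> P \<in> MM"
  by (auto simp: shift_def mons_add_iff mem_Times_iff)

lemma gt_irrefl: "P \<in> MM \<Longrightarrow> \<not> gt P P"
  using gt_strict_total unfolding strict_total_on_def irreflp_on_def by blast

lemma gt_trans: "gt P Q \<Longrightarrow> gt Q R \<Longrightarrow> P \<in> MM \<Longrightarrow> Q \<in> MM \<Longrightarrow> R \<in> MM \<Longrightarrow> gt P R"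
  using gt_strict_total unfolding strict_total_on_def transp_on_def by blast

lemma gt_total: "P \<in> MM \<Longrightarrow> Q \<in> MM \<Longrightarrow> P \<noteq> Q \<Longrightarrow> gt P Q \<or> gt Q P"
  using gt_strict_total unfolding strict_total_on_def totalp_on_def by blast

lemma mo_irrefl: "p \<in> mons m n \<Longrightarrow> \<not> mo p p"
  using mo_ordering unfolding mon_ordering_def strict_total_on_def irreflp_on_def by blast

lemma mo_trans: "mo p q \<Longrightarrow> mo q r \<Longrightarrow> p \<in> mons m n \<Longrightarrow> q \<in> mons m n \<Longrightarrow> r \<in> mons m n \<Longrightarrow> mo p r"
  using mo_ordering unfolding mon_ordering_def strict_total_on_def transp_on_def by blast

lemma mo_total: "p \<in> mons m n \<Longrightarrow> q \<in> mons m n \<Longrightarrow> p \<noteq> q \<Longrightarrow> mo p q \<or> mo q p"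
  using mo_ordering unfolding mon_ordering_def strict_total_on_def totalp_on_def by blast

lemma mo_add: "mo p q \<Longrightarrow> p \<in> mons m n \<Longrightarrow> q \<in> mons m n \<Longrightarrow> r \<in> mons m n \<Longrightarrow> mo (r + p) (r + q)"
  using mo_ordering unfolding mon_ordering_def by blast

lemma ge_trans: "ge P Q \<Longrightarrow> ge Q R \<Longrightarrow> P \<in> MM \<Longrightarrow> Q \<in> MM \<Longrightarrow> R \<in> MM \<Longrightarrow> ge P R"
  unfolding ge_def using gt_trans by blast

lemma ge_gt_trans: "ge P Q \<Longrightarrow> gt Q R \<Longrightarrow> P \<in> MM \<Longrightarrow> Q \<in> MM \<Longrightarrow> R \<in> MM \<Longrightarrow> gt P R"
  unfolding ge_def using gt_trans by blast

lemma gt_ge_trans: "gt P Q \<Longrightarrow> ge Q R \<Longrightarrow> P \<in> MM \<Longrightarrow> Q \<in> MM \<Longrightarrow> R \<in> MM \<Longrightarrow> gt P R"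
  unfolding ge_def using gt_trans by blast

lemma gt_asym: "gt P Q \<Longrightarrow> ge Q P \<Longrightarrow> P \<in> MM \<Longrightarrow> Q \<in> MM \<Longrightarrow> False"
  unfolding ge_def using gt_trans gt_irrefl by blast

lemma ge_antisym: "ge P Q \<Longrightarrow> ge Q P \<Longrightarrow> P \<in> MM \<Longrightarrow> Q \<in> MM \<Longrightarrow> P = Q"
  using gt_asym unfolding ge_def by blast

lemma gt_shift_right:
  assumes "mo p q" "p \<in> mons m n" "q \<in> mons m n" "P \<in> MM"
  shows "gt (shift p P) (shift q P)"
proof -
  obtain r i where P: "P = (r, i)" "r \<in> mons m n" "i \<in> I" using assms(4) by blast
  have "mo (p + r) (q + r)" using mo_add[of p q r] assms P by (simp add: add.commute)
  then show ?thesis using gt_same_index[of i "p + r" "q + r"] assms P by (simp add: shift_def mons_add_iff)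
qed

lemma ge_shift: "ge P Q \<Longrightarrow> P \<in> MM \<Longrightarrow> Q \<in> MM \<Longrightarrow> q \<in> mons m n \<Longrightarrow> ge (shift q P) (shift q Q)"
  unfolding ge_def using gt_shift by blast

lemma ge_shift_right:
  "moge p q \<Longrightarrow> p \<in> mons m n \<Longrightarrow> q \<in> mons m n \<Longrightarrow> P \<in> MM \<Longrightarrow> ge (shift p P) (shift q P)"
  unfolding ge_def moge_def using gt_shift_right by blast

lemma mo_if_gt_shift:
  assumes "gt (shift p P) (shift q P)" "p \<in> mons m n" "q \<in> mons m n" "P \<in> MM"
  shows "mo p q"
proof (rule ccontr)
  assume "\<not> mo p q"
  then have "moge q p" using mo_total assms unfolding moge_def by blast
  then have "ge (shift q P) (shift p P)" using ge_shift_right assms by blast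
  then show False using gt_asym[OF assms(1)] assms by simp
qed

text \<open>Compatibility with products spreads $t_i < 1$ to all monomials in $t$ alone.\<close>

lemma t_power_le_one:
  assumes "Poly_Mapping.keys a \<subseteq> {..<m}"
  shows "moge 0 (a, 0)"
  using assms
proof (induction "\<Sum>i<m. Poly_Mapping.lookup a i" arbitrary: a rule: less_induct)
  case (less a)
  show ?case
  proof (cases "a = 0")
    case True
    then show ?thesis by (simp add: moge_def zero_prod_def)
  next
    case False
    then obtain i where i: "i \<in> Poly_Mapping.keys a" by fastforce
    then have im: "i < m" using less.prems by auto
    define b where "b = a - Poly_Mapping.single i 1"
    have ab: "a = b + Poly_Mapping.single i 1"
      unfolding b_def by (rule expo_le_imp_add) (use i in \<open>auto simp: lookup_single when_def in_keys_iff\<close>)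
    have "(a, 0) = (b, 0) + (Poly_Mapping.single i 1, 0 :: expo)" by (subst ab) simp
    moreover have a: "(a, 0) \<in> mons m n" using less.prems by (simp add: mons_def)
    ultimately have s: "(Poly_Mapping.single i 1, 0) \<in> mons m n" and b: "(b, 0) \<in> mons m n"
      by (metis mons_add_iff)+
    have "(\<Sum>j<m. Poly_Mapping.lookup b j) < (\<Sum>j<m. Poly_Mapping.lookup a j)"
    proof (rule sum_strict_mono_ex1)
      show "\<exists>j\<in>{..<m}. Poly_Mapping.lookup b j < Poly_Mapping.lookup a j"
        using im by (intro bexI[of _ i]) (auto simp: ab lookup_add)
    qed (auto simp: ab lookup_add)
    then have 1: "moge 0 (b, 0)" using less.hyps[of b] b by (simp add: mons_def)
    have "mo (b, 0) (a, 0)"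
      using mo_add[OF t_small[OF im] _ s b] by (simp add: ab)
    then have "mo 0 (a, 0)"
      using 1 mo_trans[of 0 "(b, 0)" "(a, 0)"] a b unfolding moge_def by auto
    then show ?thesis by (simp add: moge_def)
  qed
qed

text \<open>
  In bounded $x$-degree there is no infinite ascending chain: by Dickson's lemma some later member of the
  chain is $t^\<alpha>$ times an earlier one, hence not larger, as $t_i < 1$.
  Hence recursion from larger to smaller monomials is well-founded.
\<close>

definition MMd :: "nat \<Rightarrow> (mon \<times> 'i) set" where "MMd d = {P \<in> MM. xdeg n (fst P) \<le> d}"

lemma wf_gt_bounded: "wf {(P, Q). P \<in> MMd d \<and> Q \<in> MMd d \<and> gt P Q}"
  unfolding wf_iff_no_infinite_down_chain
proof
  assume "\<exists>f. \<forall>i. (f (Suc i), f i) \<in> {(P, Q). P \<in> MMd d \<and> Q \<in> MMd d \<and> gt P Q}"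
  then obtain f :: "nat \<Rightarrow> mon \<times> 'i" where f: "\<And>i. f i \<in> MMd d" "\<And>i. gt (f (Suc i)) (f i)" by blast
  have fM: "f i \<in> MM" for i using f(1) by (simp add: MMd_def)
  have up: "j < k \<Longrightarrow> gt (f k) (f j)" for j k
  proof (induction k)
    case (Suc k)
    then show ?case using f(2)[of k] gt_trans[of "f (Suc k)" "f k" "f j"] fM by (auto simp: less_Suc_eq)
  qed simp
  have "(f j, d) \<in> MM \<times> UNIV" "xdeg n (fst (fst (f j, d))) \<le> snd (f j, d)" for j
    using f(1)[of j] by (auto simp: MMd_def)
  then obtain j k where jk: "j < k" "hdvd n (f j, d) (f k, d)"
    using Dickson[OF finite_I, of "\<lambda>j. (f j, d)" m n] by blast
  \<comment> \<open>The bound \<open>d\<close> is the same for both, so the quotient has no \<open>x\<close>.\<close>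
  then obtain q where q: "f k = shift q (f j)" "xdeg n q = 0"
    unfolding hdvd_def shift_def by (auto simp: case_prod_unfold prod_eq_iff)
  have qM: "q \<in> mons m n" using fM[of k] unfolding q(1) by simp
  have "Poly_Mapping.lookup (snd q) l = 0" for l
  proof (cases "l < n")
    case True
    then show ?thesis using q(2) by (simp add: xdeg_def)
  next
    case False
    then show ?thesis using qM by (auto simp: mons_def in_keys_iff subset_iff case_prod_unfold)
  qed
  then have "snd q = 0" by (intro poly_mapping_eqI) simp
  then have "q = (fst q, 0)" by (simp add: prod_eq_iff)
  then have "moge 0 q" using t_power_le_one[of "fst q"] qM by (simp add: mons_def case_prod_unfold)
  then have "ge (f j) (f k)" using ge_shift_right[of 0 q "f j"] qM fM[of j] by (simp add: q)
  then show False using gt_asym[OF up[OF jk(1)]] fM by blast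
qed

definition V :: "('i \<Rightarrow> 'k::field rx) set" where
  "V = {F. \<forall>P. vc F P \<noteq> 0 \<longrightarrow> P \<in> MM}"

definition Vd :: "nat \<Rightarrow> ('i \<Rightarrow> 'k::field rx) set" where
  "Vd d = {F. \<forall>P. vc F P \<noteq> 0 \<longrightarrow> P \<in> MMd d}"

definition below :: "mon \<times> 'i \<Rightarrow> ('i \<Rightarrow> 'k::field rx) \<Rightarrow> bool" where
  "below P F \<longleftrightarrow> (\<forall>Q. vc F Q \<noteq> 0 \<longrightarrow> ge P Q)"

definition is_lm :: "mon \<times> 'i \<Rightarrow> ('i \<Rightarrow> 'k::field rx) \<Rightarrow> bool" where
  "is_lm P F \<longleftrightarrow> vc F P \<noteq> 0 \<and> below P F"

definition mbelow :: "mon \<Rightarrow> 'k::field rx \<Rightarrow> bool" where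
  "mbelow p a \<longleftrightarrow> (\<forall>q. rx_coeff a q \<noteq> 0 \<longrightarrow> moge p q)"

lemma V_D: "F \<in> V \<Longrightarrow> vc F P \<noteq> 0 \<Longrightarrow> P \<in> MM"
  unfolding V_def by blast

lemma Vd_D: "F \<in> Vd d \<Longrightarrow> vc F P \<noteq> 0 \<Longrightarrow> P \<in> MMd d"
  unfolding Vd_def by blast

lemma below_D: "below P F \<Longrightarrow> vc F Q \<noteq> 0 \<Longrightarrow> ge P Q"
  unfolding below_def by blast

lemma mbelow_D: "mbelow p a \<Longrightarrow> rx_coeff a q \<noteq> 0 \<Longrightarrow> moge p q"
  unfolding mbelow_def by blast

lemma is_lm_D: "is_lm P F \<Longrightarrow> vc F P \<noteq> 0" "is_lm P F \<Longrightarrow> below P F"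
  unfolding is_lm_def by blast+

lemma Vd_V: "F \<in> Vd d \<Longrightarrow> F \<in> V"
  unfolding Vd_def V_def MMd_def by blast

lemma MMd_mono: "P \<in> MMd d \<Longrightarrow> d \<le> d' \<Longrightarrow> P \<in> MMd d'"
  by (auto simp: MMd_def)

lemma Vd_mono: "F \<in> Vd d \<Longrightarrow> d \<le> d' \<Longrightarrow> F \<in> Vd d'"
  unfolding Vd_def using MMd_mono by blast

lemma V_component: "F \<in> V \<Longrightarrow> F i \<in> Rx m n"
  using V_D[of F "(_, i)"] by (intro RxI) auto

lemma V_outside: "F \<in> V \<Longrightarrow> i \<notin> I \<Longrightarrow> F i = 0"
  using V_D[of F "(_, i)"] by (intro rx_eqI) auto

lemma V_I:
  assumes "\<And>i. i \<in> I \<Longrightarrow> F i \<in> Rx m n" "\<And>i. i \<notin> I \<Longrightarrow> F i = 0"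
  shows "F \<in> V"
  unfolding V_def
proof safe
  fix p i assume "vc F (p, i) \<noteq> 0"
  then have "rx_coeff (F i) p \<noteq> 0" by simp
  moreover from this have "i \<in> I" using assms(2)[of i] by (cases "i \<in> I") simp_all
  ultimately show "p \<in> mons m n" "i \<in> I" using Rx_coeffD[OF assms(1)] by auto
qed

lemma V_bounded:
  assumes "F \<in> V"
  obtains d where "F \<in> Vd d"
proof -
  obtain e where e: "\<And>i p. rx_coeff (F i) p \<noteq> 0 \<Longrightarrow> xdeg n p \<le> e i"
    using Rx_bounded[of "F _" n] by metis
  have "P \<in> MMd (Max (e ` I))" if "vc F P \<noteq> 0" for P
  proof -
    have P: "P \<in> MM" by (rule V_D[OF assms that])
    have "xdeg n (fst P) \<le> e (snd P)" using e that by (simp add: vc_eq)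
    also have "\<dots> \<le> Max (e ` I)" using P finite_I by auto
    finally show ?thesis using P by (simp add: MMd_def)
  qed
  then show ?thesis using that unfolding Vd_def by blast
qed

text \<open>
  The support may be infinite, but its $x$-degree is bounded, and there a maximum exists by the
  well-foundedness above.
\<close>

lemma exists_lm:
  assumes "F \<in> V" "vc F P0 \<noteq> 0"
  obtains P where "is_lm P F"
proof -
  obtain d where d: "F \<in> Vd d" using V_bounded assms(1) .
  define S where "S = {P. vc F P \<noteq> 0}"
  have S: "S \<subseteq> MMd d" using Vd_D[OF d] by (auto simp: S_def)
  have "P0 \<in> S" using assms(2) by (simp add: S_def)
  from wfE_min[OF wf_gt_bounded[of d] this]
  obtain P where P: "P \<in> S" "\<And>Q. (Q, P) \<in> {(P, Q). P \<in> MMd d \<and> Q \<in> MMd d \<and> gt P Q} \<Longrightarrow> Q \<notin> S" by blast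
  have "ge P Q" if "Q \<in> S" for Q
  proof -
    have "P \<in> MM" "Q \<in> MM" "P \<in> MMd d" "Q \<in> MMd d" using S P(1) that by (auto simp: MMd_def)
    then show ?thesis using P(2)[of Q] gt_total[of P Q] that unfolding ge_def by blast
  qed
  then have "is_lm P F" using P(1) unfolding is_lm_def below_def S_def by blast
  then show ?thesis by (rule that)
qed

lemma is_lm_MM: "is_lm P F \<Longrightarrow> F \<in> V \<Longrightarrow> P \<in> MM"
  using is_lm_D V_D by blast

lemma is_lm_unique: "is_lm P F \<Longrightarrow> is_lm Q F \<Longrightarrow> F \<in> V \<Longrightarrow> P = Q"
  using ge_antisym[of P Q] is_lm_D[of P F] is_lm_D[of Q F] below_D[of P F Q] below_D[of Q F P]
    is_lm_MM[of P F] is_lm_MM[of Q F] by blast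

lemma below_add: "below P F \<Longrightarrow> below P G \<Longrightarrow> below P (\<lambda>i. F i + G i)"
  unfolding below_def vc_eq rx_coeff_add by (metis add.right_neutral)

lemma below_diff: "below P F \<Longrightarrow> below P G \<Longrightarrow> below P (\<lambda>i. F i - G i)"
  unfolding below_def vc_eq rx_coeff_diff by (metis diff_zero right_minus_eq)

lemma below_zero: "below P (\<lambda>i. 0)"
  by (simp add: below_def vc_eq)

lemma below_sum: "(\<And>x. x \<in> A \<Longrightarrow> below P (F x)) \<Longrightarrow> below P (\<lambda>i. \<Sum>x\<in>A. F x i)"
  by (induction A rule: infinite_finite_induct) (simp_all add: below_zero below_add)

lemma V_diff: "F \<in> V \<Longrightarrow> G \<in> V \<Longrightarrow> (\<lambda>i. F i - G i) \<in> V"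
  by (rule V_I) (simp_all add: V_component V_outside Rx_diff)

lemma V_mult: "a \<in> Rx m n \<Longrightarrow> F \<in> V \<Longrightarrow> (\<lambda>i. a * F i) \<in> V"
  by (rule V_I) (simp_all add: V_component V_outside Rx_mult)

lemma V_sum: "(\<And>x. x \<in> A \<Longrightarrow> F x \<in> V) \<Longrightarrow> (\<lambda>i. \<Sum>x\<in>A. F x i) \<in> V"
  by (rule V_I) (auto simp add: V_component V_outside intro: Rx_sum)

lemma vc_mult_nonzero:
  assumes "vc (\<lambda>i. a * F i) P \<noteq> 0"
  obtains q Q where "P = shift q Q" "rx_coeff a q \<noteq> 0" "vc F Q \<noteq> 0"
proof -
  obtain p i where P: "P = (p, i)" by (cases P)
  then have "rx_coeff (a * F i) p \<noteq> 0" using assms by simp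
  then obtain q r where "p = q + r" "rx_coeff a q \<noteq> 0" "rx_coeff (F i) r \<noteq> 0"
    by (rule rx_coeff_mult_nonzero)
  then show ?thesis using that[of q "(r, i)"] P by (simp add: shift_def)
qed

lemma Vd_mult:
  assumes "\<And>p. rx_coeff a p \<noteq> 0 \<Longrightarrow> p \<in> mons m n \<and> xdeg n p + e \<le> d" "F \<in> Vd e"
  shows "(\<lambda>i. a * F i) \<in> Vd d"
  unfolding Vd_def
proof (clarify elim!: vc_mult_nonzero)
  fix p i q r j
  assume *: "(p, i) = shift q (r, j)" "rx_coeff a q \<noteq> 0" "vc F (r, j) \<noteq> 0"
  then have "(r, j) \<in> MMd e" "q \<in> mons m n \<and> xdeg n q + e \<le> d"
    using assms unfolding Vd_def by blast+
  then show "(p, i) \<in> MMd d" unfolding * by (auto simp: MMd_def xdeg_add)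
qed

lemma below_mult:
  assumes "a \<in> Rx m n" "mbelow q a" "q \<in> mons m n" "F \<in> V" "below P F" "P \<in> MM"
  shows "below (shift q P) (\<lambda>i. a * F i)"
  unfolding below_def
proof (intro allI impI)
  fix R assume "vc (\<lambda>i. a * F i) R \<noteq> 0"
  then obtain r Q where R: "R = shift r Q" "rx_coeff a r \<noteq> 0" "vc F Q \<noteq> 0" by (rule vc_mult_nonzero)
  then have r: "r \<in> mons m n" "moge q r" and Q: "Q \<in> MM" "ge P Q"
    using assms Rx_coeffD unfolding mbelow_def below_def V_def by blast+
  have "ge (shift q P) (shift r P)" by (rule ge_shift_right) (use r assms in auto)
  moreover have "ge (shift r P) (shift r Q)" by (rule ge_shift) (use r Q assms in auto)
  ultimately show "ge (shift q P) R"
    unfolding R by (rule ge_trans) (use r Q assms in auto)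
qed

lemma is_lm_mult:
  assumes "a \<in> Rx m n" "rx_coeff a q \<noteq> 0" "mbelow q a" "F \<in> V" "is_lm P F"
  shows "vc (\<lambda>i. a * F i) (shift q P) = rx_coeff a q * vc F P"
    and "is_lm (shift q P) (\<lambda>i. a * F i)"
proof -
  obtain p i where P: "P = (p, i)" by (cases P)
  have PM: "P \<in> MM" and q: "q \<in> mons m n" using assms is_lm_MM Rx_coeffD by blast+
  have "rx_coeff (a * F i) (q + p) = rx_coeff a q * rx_coeff (F i) p"
  proof (rule rx_coeff_mult_single)
    fix r s assume *: "r + s = q + p" "rx_coeff a r \<noteq> 0" "rx_coeff (F i) s \<noteq> 0"
    show "r = q"
    proof (rule ccontr)
      assume "r \<noteq> q"
      then have r: "r \<in> mons m n" "mo q r" using * assms(1,3) Rx_coeffD unfolding mbelow_def moge_def by blast+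
      have s: "(s, i) \<in> MM" "ge P (s, i)"
        using *(3) V_D[OF assms(4), of "(s, i)"] below_D[OF is_lm_D(2)[OF assms(5)], of "(s, i)"] by simp_all
      have "gt (shift q P) (shift r P)" by (rule gt_shift_right) (use r q PM in auto)
      moreover have "ge (shift r P) (shift r (s, i))" by (rule ge_shift) (use r s PM in auto)
      ultimately have "gt (shift q P) (shift r (s, i))" by (rule gt_ge_trans) (use r s q PM in auto)
      moreover have "shift r (s, i) = shift q P" using *(1) by (simp add: shift_def P)
      ultimately show False using gt_irrefl[of "shift q P"] q PM by simp
    qed
  qed
  then show 1: "vc (\<lambda>i. a * F i) (shift q P) = rx_coeff a q * vc F P" by (simp add: P shift_def)
  show "is_lm (shift q P) (\<lambda>i. a * F i)"
    using 1 assms below_mult[of a q F P] PM q by (simp add: is_lm_def)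
qed

end


section \<open>Division in bounded $x$-degree\<close>

context module_order
begin

text \<open>
  The function \<open>\<sigma>\<close> prescribes for every monomial the divisor that is to cancel it, or leaves it to the
  remainder; the proof of Mora's theorem depends on the freedom to choose it.
  Imagine the monomials treated from the largest downwards, and let \<open>H P\<close> be the coefficient found at \<open>P\<close>
  when its turn comes: it is that of \<open>f\<close>, changed by the finitely many cancellations at larger monomials
  \<open>Q\<close> that contribute to \<open>P\<close>.  This determines \<open>H\<close> by well-founded recursion, and \<open>H\<close> determines quotients
  and remainder.  The last property holds because \<open>H\<close> vanishes at monomials not below those of \<open>f\<close>.
\<close>

lemma bounded_division:
  fixes h :: "'l \<Rightarrow> 'i \<Rightarrow> 'k::field rx" and lmh :: "'l \<Rightarrow> mon \<times> 'i" and e :: "'l \<Rightarrow> nat"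
    and \<sigma> :: "mon \<times> 'i \<Rightarrow> 'l option" and f :: "'i \<Rightarrow> 'k rx"
  assumes fin: "finite L"
    and h: "\<And>l. l \<in> L \<Longrightarrow> h l \<in> Vd (e l)" "\<And>l. l \<in> L \<Longrightarrow> is_lm (lmh l) (h l)"
    and f: "f \<in> Vd d"
    and \<sigma>: "\<And>P l. P \<in> MMd d \<Longrightarrow> \<sigma> P = Some l \<Longrightarrow>
      l \<in> L \<and> (\<exists>x. P = shift x (lmh l) \<and> xdeg n x + e l \<le> d)"
  obtains q r where
    "\<And>l. l \<in> L \<Longrightarrow> q l \<in> Rx m n"
    "\<And>l x. l \<in> L \<Longrightarrow> rx_coeff (q l) x \<noteq> 0 \<Longrightarrow> xdeg n x + e l \<le> d \<and> \<sigma> (shift x (lmh l)) = Some l"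
    "r \<in> Vd d"
    "\<And>P. vc r P \<noteq> 0 \<Longrightarrow> \<sigma> P = None"
    "\<And>i. f i = (\<Sum>l\<in>L. q l * h l i) + r i"
    "\<And>P0 l x. P0 \<in> MM \<Longrightarrow> below P0 f \<Longrightarrow> l \<in> L \<Longrightarrow> rx_coeff (q l) x \<noteq> 0 \<Longrightarrow> ge P0 (shift x (lmh l))"
proof -
  define R where "R = {(P, Q). P \<in> MMd d \<and> Q \<in> MMd d \<and> gt P Q}"
  have wfR: "wf R" unfolding R_def by (rule wf_gt_bounded)
  define c where "c l = vc (h l) (lmh l)" for l
  have c: "c l \<noteq> 0" if "l \<in> L" for l using is_lm_D(1)[OF h(2)[OF that]] by (simp add: c_def)
  have lmh: "lmh l \<in> MMd (e l)" "lmh l \<in> MM" if "l \<in> L" for l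
    using Vd_D[OF h(1)[OF that] is_lm_D(1)[OF h(2)[OF that]]] by (simp_all add: MMd_def)
  have lmh_deg: "xdeg n (fst (lmh l)) \<le> e l" if "l \<in> L" for l
    using lmh[OF that] by (simp add: MMd_def)
  define G where "G H P = vc f P - (\<Sum>l\<in>L. \<Sum>(x, y) | x + y = fst P.
      if (shift x (lmh l), P) \<in> R \<and> \<sigma> (shift x (lmh l)) = Some l
      then H (shift x (lmh l)) / c l * vc (h l) (y, snd P) else 0)" for H :: "mon \<times> 'i \<Rightarrow> 'k" and P
  define H where "H = wfrec R G"
  have H_rec: "H P = G H P" for P
  proof -
    have "H P = G (cut H R P) P" unfolding H_def by (rule wfrec[OF wfR])
    also have "\<dots> = G H P"
      unfolding G_def by (intro arg_cong2[of _ _ _ _ minus] sum.cong refl)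
        (auto simp: cut_apply split: prod.splits if_splits)
    finally show ?thesis .
  qed
  define ok where "ok l x \<longleftrightarrow> x \<in> mons m n \<and> xdeg n x + e l \<le> d \<and> \<sigma> (shift x (lmh l)) = Some l" for l x
  define qc where "qc l x = (if ok l x then H (shift x (lmh l)) / c l else 0)" for l x
  have "\<exists>f. f \<in> Rx m n \<and> rx_coeff f = qc l" for l
    by (rule Rx_of_coeff[of "qc l" m n d]) (auto simp: qc_def ok_def split: if_splits)
  then obtain q where q: "\<And>l. q l \<in> Rx m n" "\<And>l. rx_coeff (q l) = qc l" by metis
  define rc where "rc i x = (if (x, i) \<in> MMd d \<and> \<sigma> (x, i) = None then H (x, i) else 0)" for i x
  have "\<exists>f. f \<in> Rx m n \<and> rx_coeff f = rc i" for i
    by (rule Rx_of_coeff[of "rc i" m n d]) (auto simp: rc_def MMd_def split: if_splits)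
  then obtain r where r: "\<And>i. rx_coeff (r i) = rc i" by metis
  have ok_iff: "ok l x \<longleftrightarrow> \<sigma> (shift x (lmh l)) = Some l" if "l \<in> L" "shift x (lmh l) \<in> MMd d" for l x
    using that \<sigma>[of "shift x (lmh l)" l] by (auto simp: ok_def MMd_def)
  have ok_MMd: "shift x (lmh l) \<in> MMd d" if "l \<in> L" "ok l x" for l x
    using that lmh[of l] lmh_deg[of l] by (auto simp: ok_def MMd_def xdeg_add)
  have rV: "r \<in> Vd d" unfolding Vd_def by (auto simp: r rc_def split: if_splits)
  have qhV: "(\<lambda>i. q l * h l i) \<in> Vd d" if "l \<in> L" for l
    by (rule Vd_mult[OF _ h(1)[OF that]]) (auto simp: q qc_def ok_def split: if_splits)
  \<comment> \<open>A contribution of \<open>q l * h l\<close> to \<open>P\<close> either comes from the cancellation at a larger monomial, and then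
    occurs in \<open>G\<close>, or is the one that cancels \<open>P\<close> itself.\<close>
  have term_eq: "qc l x * vc (h l) (y, snd P) =
      (if (shift x (lmh l), P) \<in> R \<and> \<sigma> (shift x (lmh l)) = Some l
       then H (shift x (lmh l)) / c l * vc (h l) (y, snd P) else 0) +
      (if shift x (lmh l) = P \<and> \<sigma> P = Some l then H P else 0)"
    if P: "P \<in> MMd d" and l: "l \<in> L" and xy: "x + y = fst P" for P l x y
  proof (cases "vc (h l) (y, snd P) = 0")
    case True
    have "shift x (lmh l) \<noteq> P"
    proof
      assume "shift x (lmh l) = P"
      then have "fst P = x + fst (lmh l)" "snd P = snd (lmh l)" by auto
      then have "(y, snd P) = lmh l" using xy by (metis add_left_cancel prod.collapse)
      then show False using True c[OF l] by (simp add: c_def)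
    qed
    then show ?thesis using True by simp
  next
    case False
    have yM: "(y, snd P) \<in> MM" using Vd_D[OF h(1)[OF l] False] by (simp add: MMd_def)
    have xM: "x \<in> mons m n" using P xy mons_add_iff[of x y m n] by (auto simp: MMd_def)
    have Py: "P = shift x (y, snd P)" using xy by (simp add: shift_def prod_eq_iff)
    have PM: "P \<in> MM" using P by (simp add: MMd_def)
    have "ge (lmh l) (y, snd P)" by (rule below_D[OF is_lm_D(2)[OF h(2)[OF l]] False])
    then consider "lmh l = (y, snd P)" | "gt (lmh l) (y, snd P)" by (auto simp: ge_def)
    then show ?thesis
    proof cases
      case 1
      then have eq: "shift x (lmh l) = P" using Py by simp
      have "(P, P) \<notin> R" using gt_irrefl PM by (simp add: R_def)
      moreover have "qc l x * vc (h l) (y, snd P) = (if \<sigma> P = Some l then H P else 0)"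
        using ok_iff[OF l, of x] P c[OF l] unfolding 1[symmetric] c_def[symmetric] by (simp add: qc_def eq)
      ultimately show ?thesis by (simp add: eq)
    next
      case 2
      then have gt: "gt (shift x (lmh l)) P"
        using gt_shift[of "lmh l" "(y, snd P)" x] lmh[OF l] yM xM Py by simp
      then have "shift x (lmh l) \<noteq> P" using gt_irrefl PM by metis
      moreover have "ok l x \<longleftrightarrow> (shift x (lmh l), P) \<in> R \<and> \<sigma> (shift x (lmh l)) = Some l"
        using ok_iff[OF l, of x] ok_MMd[OF l, of x] gt P by (auto simp: R_def)
      ultimately show ?thesis by (simp add: qc_def)
    qed
  qed
  have coeff_eq: "vc f P = (\<Sum>l\<in>L. vc (\<lambda>i. q l * h l i) P) + vc r P" for P
  proof (cases "P \<in> MMd d")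
    case False
    then have "vc f P = 0" "vc r P = 0" "\<And>l. l \<in> L \<Longrightarrow> vc (\<lambda>i. q l * h l i) P = 0"
      using Vd_D[OF f] Vd_D[OF rV] Vd_D[OF qhV] by metis+
    then show ?thesis by simp
  next
    case True
    have "(\<Sum>l\<in>L. vc (\<lambda>i. q l * h l i) P) =
        (\<Sum>l\<in>L. \<Sum>(x, y) | x + y = fst P. qc l x * vc (h l) (y, snd P))"
      by (simp add: vc_eq rx_coeff_mult q)
    also have "\<dots> = (\<Sum>l\<in>L. \<Sum>z | (case z of (x, y) \<Rightarrow> x + y = fst P).
        (case z of (x, y) \<Rightarrow> if (shift x (lmh l), P) \<in> R \<and> \<sigma> (shift x (lmh l)) = Some l
          then H (shift x (lmh l)) / c l * vc (h l) (y, snd P) else 0) +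
        (case z of (x, y) \<Rightarrow> if shift x (lmh l) = P \<and> \<sigma> P = Some l then H P else 0))"
    proof (intro sum.cong refl, goal_cases)
      case (1 l z)
      then show ?case using term_eq[OF True 1(1), of "fst z" "snd z"] by (simp add: case_prod_unfold)
    qed
    also have "\<dots> = (vc f P - H P) + (\<Sum>l\<in>L. \<Sum>(x, y) | x + y = fst P.
        if shift x (lmh l) = P \<and> \<sigma> P = Some l then H P else 0)"
      using H_rec[of P] by (simp add: sum.distrib G_def)
    also have "(\<Sum>l\<in>L. \<Sum>(x, y) | x + y = fst P.
        if shift x (lmh l) = P \<and> \<sigma> P = Some l then H P else 0) = H P - vc r P"
    proof (cases "\<sigma> P")
      case None
      have "vc r P = H P" using True None by (simp add: vc_eq r rc_def)
      then show ?thesis using None by simp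
    next
      case (Some l0)
      then obtain x0 where l0: "l0 \<in> L" "P = shift x0 (lmh l0)" using \<sigma>[OF True] by blast
      have "vc r P = 0" using Some by (simp add: vc_eq r rc_def)
      have "(\<Sum>l\<in>L. \<Sum>(x, y) | x + y = fst P. if shift x (lmh l) = P \<and> \<sigma> P = Some l then H P else 0)
        = (\<Sum>l\<in>{l0}. \<Sum>(x, y) | x + y = fst P. if shift x (lmh l) = P \<and> \<sigma> P = Some l then H P else 0)"
      proof (rule sum.mono_neutral_right)
        show "\<forall>l\<in>L - {l0}. (\<Sum>(x, y) | x + y = fst P.
            if shift x (lmh l) = P \<and> \<sigma> P = Some l then H P else 0) = 0"
          using Some by (intro ballI sum.neutral) auto
      qed (use fin l0 in auto)
      also have "\<dots> = (\<Sum>(x, y) | x + y = fst P. if shift x (lmh l0) = P then H P else 0)"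
        using Some by simp
      also have "\<dots> = (\<Sum>(x, y)\<in>{(x0, fst (lmh l0))}. if shift x (lmh l0) = P then H P else 0)"
      proof (rule sum.mono_neutral_right)
        show "\<forall>z\<in>{(x, y). x + y = fst P} - {(x0, fst (lmh l0))}.
            (case z of (x, y) \<Rightarrow> if shift x (lmh l0) = P then H P else 0) = 0"
        proof
          fix z assume z: "z \<in> {(x, y). x + y = fst P} - {(x0, fst (lmh l0))}"
          obtain x y where xy: "z = (x, y)" by (cases z)
          have "x \<noteq> x0" using z xy l0(2) by auto
          then show "(case z of (x, y) \<Rightarrow> if shift x (lmh l0) = P then H P else 0) = 0"
            by (simp add: xy l0(2))
        qed
      qed (use l0 in auto)
      finally show ?thesis using l0 \<open>vc r P = 0\<close> by simp
    qed
    finally show ?thesis by simp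
  qed
  have eq: "f i = (\<Sum>l\<in>L. q l * h l i) + r i" for i
  proof (rule rx_eqI)
    fix p show "rx_coeff (f i) p = rx_coeff ((\<Sum>l\<in>L. q l * h l i) + r i) p"
      using coeff_eq[of "(p, i)"] by (simp add: rx_coeff_add rx_coeff_sum)
  qed
  have bound: "ge P0 P" if P0: "P0 \<in> MM" "below P0 f" and "P \<in> MMd d" "H P \<noteq> 0" for P0 P
    using that(3,4)
  proof (induction P rule: wf_induct_rule[OF wfR])
    case (1 P)
    show ?case
    proof (cases "vc f P = 0")
      case False
      then show ?thesis using below_D[OF P0(2)] by blast
    next
      case True
      have "\<exists>l\<in>L. \<exists>x. (shift x (lmh l), P) \<in> R \<and> H (shift x (lmh l)) \<noteq> 0"
      proof (rule ccontr)
        assume "\<not> ?thesis"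
        then have "G H P = 0" unfolding G_def True by (auto intro!: sum.neutral)
        then show False using 1 H_rec[of P] by simp
      qed
      then obtain l x where lx: "l \<in> L" "(shift x (lmh l), P) \<in> R" "H (shift x (lmh l)) \<noteq> 0" by blast
      then have "ge P0 (shift x (lmh l))" using 1(1)[OF lx(2)] by (simp add: R_def)
      then have "gt P0 P" using lx(2) ge_gt_trans[of P0 "shift x (lmh l)" P] P0(1)
        by (simp add: R_def MMd_def)
      then show ?thesis by (simp add: ge_def)
    qed
  qed
  show ?thesis
  proof (rule that[of q r, OF q(1) _ rV _ eq])
    fix l x assume l: "l \<in> L" and x: "rx_coeff (q l) x \<noteq> 0"
    then have ok: "ok l x" "H (shift x (lmh l)) \<noteq> 0" by (auto simp: q qc_def split: if_splits)
    then show "xdeg n x + e l \<le> d \<and> \<sigma> (shift x (lmh l)) = Some l" by (simp add: ok_def)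
    fix P0 assume "P0 \<in> MM" "below P0 f"
    then show "ge P0 (shift x (lmh l))" using bound ok_MMd[OF l ok(1)] ok(2) by blast
  next
    fix P assume "vc r P \<noteq> 0"
    then show "\<sigma> P = None" by (auto simp: vc_eq r rc_def split: if_splits)
  qed
qed

end


section \<open>Weak division with remainder\<close>

lemma finite_has_least:
  assumes "finite A" "A \<noteq> {}"
    and "\<And>x y. x \<in> A \<Longrightarrow> y \<in> A \<Longrightarrow> le x y \<or> le y x"
    and "\<And>x y z. x \<in> A \<Longrightarrow> y \<in> A \<Longrightarrow> z \<in> A \<Longrightarrow> le x y \<Longrightarrow> le y z \<Longrightarrow> le x z"
  shows "\<exists>x\<in>A. \<forall>y\<in>A. le x y"
  using assms
proof (induction A rule: finite_ne_induct)
  case (singleton x)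
  then show ?case by blast
next
  case (insert a A)
  have "\<exists>x\<in>A. \<forall>y\<in>A. le x y"
  proof (rule insert.IH)
    show "le x y \<or> le y x" if "x \<in> A" "y \<in> A" for x y using insert.prems(1) that by blast
    show "le x z" if "x \<in> A" "y \<in> A" "z \<in> A" "le x y" "le y z" for x y z
      using insert.prems(2)[of x y z] that by blast
  qed
  then obtain x where x: "x \<in> A" "\<And>y. y \<in> A \<Longrightarrow> le x y" by blast
  have refl: "le a a" using insert.prems(1)[of a a] by blast
  show ?case
  proof (cases "le x a")
    case True
    then show ?thesis using x by blast
  next
    case False
    then have "le a x" using insert.prems(1)[of a x] x(1) by blast
    then have "le a y" if "y \<in> A" for y using insert.prems(2)[of a x y] x that by blast
    then show ?thesis using refl by blast
  qed
qed

context module_order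
begin

text \<open>
  The multiplicative set $S_>$, described by coefficients; \<open>S_gt_eq_U\<close> identifies it with \<open>S_gt\<close>.
\<close>

definition U :: "'k::field rx set" where
  "U = {u \<in> Rx m n. rx_coeff u 0 = 1 \<and> mbelow 0 u}"

lemma one_U: "1 \<in> U"
  by (auto simp: U_def rx_coeff_one mbelow_def moge_def)

lemma U_mult_coeff:
  assumes "a \<in> Rx m n" "mbelow 0 a" "u \<in> U"
  shows "mbelow 0 (a * u)" "rx_coeff (a * u) 0 = rx_coeff a 0"
proof -
  have pos: "moge 0 (p + q) \<and> (p + q = 0 \<longrightarrow> p = 0)" if "rx_coeff a p \<noteq> 0" "rx_coeff u q \<noteq> 0" for p q
  proof -
    have p: "p \<in> mons m n" "moge 0 p" using that assms Rx_coeffD mbelow_D by blast+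
    have q: "q \<in> mons m n" "moge 0 q" using that assms(3) Rx_coeffD mbelow_D unfolding U_def by blast+
    have pq: "p + q \<in> mons m n" using p q by (simp add: mons_add_iff)
    have 1: "moge p (p + q)" using q mo_add[of 0 q p] p by (auto simp: moge_def)
    show ?thesis
    proof (cases "p = 0")
      case True
      then show ?thesis using 1 by simp
    next
      case False
      then have "mo 0 p" using p by (simp add: moge_def)
      then have "mo 0 (p + q)" using 1 mo_trans[of 0 p "p + q"] p pq by (auto simp: moge_def)
      moreover from this have "p + q \<noteq> 0" using mo_irrefl[of 0] by force
      ultimately show ?thesis by (simp add: moge_def)
    qed
  qed
  show "mbelow 0 (a * u)"
    unfolding mbelow_def using pos by (blast elim: rx_coeff_mult_nonzero)
  have "rx_coeff (a * u) (0 + 0) = rx_coeff a 0 * rx_coeff u 0"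
    by (rule rx_coeff_mult_single) (use pos in \<open>simp add: plus_prod_def zero_prod_def\<close>, blast?)
  then show "rx_coeff (a * u) 0 = rx_coeff a 0" using assms(3) by (simp add: U_def)
qed

lemma U_mult: "u \<in> U \<Longrightarrow> v \<in> U \<Longrightarrow> u * v \<in> U"
  using U_mult_coeff[of u v] by (simp add: U_def Rx_mult)

lemma U_Rx: "u \<in> U \<Longrightarrow> u \<in> Rx m n"
  by (simp add: U_def)

lemma mbelow_add: "mbelow p a \<Longrightarrow> mbelow p b \<Longrightarrow> mbelow p (a + b)"
  unfolding mbelow_def rx_coeff_add by (metis add.right_neutral)

lemma mbelow_uminus: "mbelow p a \<Longrightarrow> mbelow p (- a)"
  unfolding mbelow_def rx_coeff_uminus by simp

lemma mbelow_zero: "mbelow p 0"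
  by (simp add: mbelow_def)

lemma mbelow_sum: "(\<And>x. x \<in> A \<Longrightarrow> mbelow p (f x)) \<Longrightarrow> mbelow p (sum f A)"
  by (induction A rule: infinite_finite_induct) (simp_all add: mbelow_zero mbelow_add)

lemma U_minus_small:
  assumes "u \<in> U" "b \<in> Rx m n" "mbelow 0 b" "rx_coeff b 0 = 0"
  shows "u - b \<in> U"
  using assms mbelow_add[of 0 u "- b"] mbelow_uminus[of 0 b]
  by (simp add: U_def Rx_diff rx_coeff_diff)

lemma U_scale:
  assumes "u \<in> U" "F \<in> V" "is_lm P F"
  shows "is_lm P (\<lambda>i. u * F i)" "vc (\<lambda>i. u * F i) P = vc F P"
  using is_lm_mult[of u 0 F P] assms by (simp_all add: U_def)

lemma below_mult_zero:
  "a \<in> Rx m n \<Longrightarrow> mbelow 0 a \<Longrightarrow> F \<in> V \<Longrightarrow> below P F \<Longrightarrow> P \<in> MM \<Longrightarrow> below P (\<lambda>i. a * F i)"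
  using below_mult[of a 0 F P] by simp

lemma hdvd_shift: "hdvd n (P, d) (Q, d') \<longleftrightarrow> (\<exists>x. Q = shift x P \<and> d + xdeg n x \<le> d')"
  by (auto simp: hdvd_def shift_def case_prod_unfold prod_eq_iff)

definition lmv :: "('i \<Rightarrow> 'k::field rx) \<Rightarrow> mon \<times> 'i" where
  "lmv F = (SOME P. is_lm P F)"

lemma lmv: "is_lm P F \<Longrightarrow> is_lm (lmv F) F"
  unfolding lmv_def by (rule someI)

text \<open>
  Mora's division theorem, by a minimality argument in place of an algorithm.  The set \<open>E\<close> consists of the
  non-zero combinations \<open>h = u f - \<Sum> q\<^sub>l g\<^sub>l\<close> of the required shape, each with a bound for its
  $x$-degree, and \<open>B\<close> is a finite subset whose homogenised leading monomials divide those of all of \<open>E\<close>.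
\<close>

lemma weak_division:
  fixes g :: "'l \<Rightarrow> 'i \<Rightarrow> 'k::field rx" and lmg :: "'l \<Rightarrow> mon \<times> 'i" and f :: "'i \<Rightarrow> 'k rx"
  assumes fin: "finite L"
    and g: "\<And>l. l \<in> L \<Longrightarrow> g l \<in> V" "\<And>l. l \<in> L \<Longrightarrow> is_lm (lmg l) (g l)"
    and f: "f \<in> V" "is_lm P0 f"
  obtains u q r where "u \<in> U" "\<And>l. l \<in> L \<Longrightarrow> q l \<in> Rx m n" "r \<in> V"
    "\<And>i. u * f i = (\<Sum>l\<in>L. q l * g l i) + r i"
    "\<And>l. l \<in> L \<Longrightarrow> below P0 (\<lambda>i. q l * g l i)"
    "\<And>Q l x. is_lm Q r \<Longrightarrow> l \<in> L \<Longrightarrow> Q \<noteq> shift x (lmg l)"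
proof -
  have P0: "P0 \<in> MM" using is_lm_MM f by blast
  define repr where "repr u q h \<longleftrightarrow> u \<in> U \<and> (\<forall>l\<in>L. q l \<in> Rx m n \<and> below P0 (\<lambda>i. q l * g l i)) \<and>
    (\<forall>i. h i = u * f i - (\<Sum>l\<in>L. q l * g l i))" for u q h
  define E where "E = {(h, d). h \<in> Vd d \<and> (\<exists>P. is_lm P h) \<and> (\<exists>u q. repr u q h)}"
  have E_iff: "(h, d) \<in> E \<longleftrightarrow> h \<in> Vd d \<and> (\<exists>P. is_lm P h) \<and> (\<exists>u q. repr u q h)" for h d
    by (simp add: E_def)
  have lm_E: "is_lm (lmv h) h" if "(h, d) \<in> E" for h d using that lmv unfolding E_iff by blast
  have V_E: "h \<in> Vd d" if "(h, d) \<in> E" for h d using that unfolding E_iff by blast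
  have below_E: "below P0 h" if hd: "(h, d) \<in> E" for h d
  proof -
    obtain u q where uq: "repr u q h" using hd unfolding E_iff by (elim exE conjE)
    have "below P0 (\<lambda>i. u * f i - (\<Sum>l\<in>L. q l * g l i))"
    proof (intro below_diff below_sum)
      show "below P0 (\<lambda>i. u * f i)"
        by (rule is_lm_D(2)[OF U_scale(1)[OF _ f]]) (use uq in \<open>simp add: repr_def\<close>)
    qed (use uq in \<open>simp add: repr_def\<close>)
    moreover have "h = (\<lambda>i. u * f i - (\<Sum>l\<in>L. q l * g l i))" using uq by (auto simp: repr_def)
    ultimately show ?thesis by simp
  qed
  define hd where "hd x = (lmv (fst x), snd x)" for x :: "('i \<Rightarrow> 'k rx) \<times> nat"
  define le where "le x y \<longleftrightarrow> hdvd n (hd x) (hd y)" for x y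
  have hd_MMd: "lmv h \<in> MMd d" if "(h, d) \<in> E" for h d
    using Vd_D[OF V_E[OF that] is_lm_D(1)[OF lm_E[OF that]]] .
  have "\<exists>B\<subseteq>E. finite B \<and> (\<forall>a\<in>E. \<exists>b\<in>B. le b a)"
  proof (rule finite_basis_if_no_bad_sequence)
    fix s :: "nat \<Rightarrow> ('i \<Rightarrow> 'k rx) \<times> nat"
    assume "\<And>j. s j \<in> E"
    then have s: "lmv (fst (s j)) \<in> MMd (snd (s j))" for j using hd_MMd by simp
    have "hd (s j) \<in> MM \<times> UNIV" "xdeg n (fst (fst (hd (s j)))) \<le> snd (hd (s j))" for j
      using s[of j] by (auto simp: hd_def MMd_def)
    then obtain j k where "j < k" "hdvd n (hd (s j)) (hd (s k))"
      using Dickson[OF finite_I, of "\<lambda>j. hd (s j)" m n] by blast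
    then show "\<exists>j k. j < k \<and> le (s j) (s k)" unfolding le_def by blast
  qed
  then obtain B where B: "B \<subseteq> E" "finite B" "\<And>a. a \<in> E \<Longrightarrow> \<exists>b\<in>B. le b a" by blast
  obtain df where df: "f \<in> Vd df" using V_bounded f(1) .
  have "repr 1 (\<lambda>_. 0) f" by (simp add: repr_def one_U below_zero)
  then have "(f, df) \<in> E" using df f(2) unfolding E_iff by blast
  then have "B \<noteq> {}" using B(3) by blast
  have B_MM: "lmv (fst b) \<in> MM" if "b \<in> B" for b
    using hd_MMd[of "fst b" "snd b"] that B(1) by (auto simp: MMd_def)
  \<comment> \<open>A member of \<open>B\<close> with the smallest leading monomial: when it is divided, the quotients by members of \<open>B\<close>
    that occur after its leading term has been cancelled by some \<open>g l\<close> are smaller than \<open>1\<close>.\<close>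
  have "\<exists>x\<in>B. \<forall>y\<in>B. ge (lmv (fst y)) (lmv (fst x))"
  proof (rule finite_has_least[OF \<open>finite B\<close> \<open>B \<noteq> {}\<close>])
    show "ge (lmv (fst y)) (lmv (fst x)) \<or> ge (lmv (fst x)) (lmv (fst y))" if "x \<in> B" "y \<in> B" for x y
      using gt_total B_MM that unfolding ge_def by blast
    show "ge (lmv (fst z)) (lmv (fst x))"
      if "x \<in> B" "y \<in> B" "z \<in> B" "ge (lmv (fst y)) (lmv (fst x))" "ge (lmv (fst z)) (lmv (fst y))" for x y z
      using ge_trans[OF that(5,4)] B_MM that(1-3) by blast
  qed
  then obtain h dh where hB: "(h, dh) \<in> B" and h_min: "\<And>b. b \<in> B \<Longrightarrow> ge (lmv (fst b)) (lmv h)" by force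
  have hE: "(h, dh) \<in> E" using hB B(1) by blast
  obtain uh qh where uqh: "repr uh qh h" using hE unfolding E_iff by blast
  have hV: "h \<in> V" using Vd_V[OF V_E[OF hE]] .
  show ?thesis
  proof (cases "\<exists>l\<in>L. \<exists>x. lmv h = shift x (lmg l)")
    case False
    show ?thesis
    proof (rule that[of uh qh h])
      show "Q \<noteq> shift x (lmg l)" if "is_lm Q h" "l \<in> L" for Q l x
        unfolding is_lm_unique[OF that(1) lm_E[OF hE] hV] using False that(2) by blast
    qed (use uqh hV in \<open>auto simp: repr_def\<close>)
  next
    case True
    then obtain l0 x0 where l0: "l0 \<in> L" "lmv h = shift x0 (lmg l0)" by blast
    have "\<exists>e. g l \<in> Vd e" if "l \<in> L" for l using V_bounded[OF g(1)[OF that]] by metis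
    then obtain dg where dg: "\<And>l. l \<in> L \<Longrightarrow> g l \<in> Vd (dg l)" by metis
    \<comment> \<open>Large enough for \<open>h\<close> and for the product that cancels its leading term.\<close>
    define d where "d = dh + xdeg n x0 + dg l0"
    define byg where "byg P l \<longleftrightarrow> l \<in> L \<and> (\<exists>x. P = shift x (lmg l) \<and> xdeg n x + dg l \<le> d)" for P l
    define byB where "byB P b \<longleftrightarrow> b \<in> B \<and> (\<exists>x. P = shift x (lmv (fst b)) \<and> xdeg n x + snd b \<le> d)" for P b
    \<comment> \<open>Prefer the \<open>g l\<close>; in particular \<open>h\<close>, which may belong to \<open>B\<close>, is not just divided by itself.\<close>
    define \<sigma> :: "mon \<times> 'i \<Rightarrow> ('l + ('i \<Rightarrow> 'k rx) \<times> nat) option" where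
      "\<sigma> P = (if \<exists>l. byg P l then Some (Inl (SOME l. byg P l))
              else if \<exists>b. byB P b then Some (Inr (SOME b. byB P b)) else None)" for P
    have \<sigma>_Inl: "byg P l" if "\<sigma> P = Some (Inl l)" for P l
      using that someI_ex[of "byg P"] by (auto simp: \<sigma>_def split: if_splits)
    have \<sigma>_Inr: "byB P b" if "\<sigma> P = Some (Inr b)" for P b
      using that someI_ex[of "byB P"] by (auto simp: \<sigma>_def split: if_splits)
    define hh :: "'l + ('i \<Rightarrow> 'k rx) \<times> nat \<Rightarrow> 'i \<Rightarrow> 'k rx" where "hh = case_sum g fst"
    define lmh :: "'l + ('i \<Rightarrow> 'k rx) \<times> nat \<Rightarrow> mon \<times> 'i" where "lmh = case_sum lmg (\<lambda>b. lmv (fst b))"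
    define e :: "'l + ('i \<Rightarrow> 'k rx) \<times> nat \<Rightarrow> nat" where "e = case_sum dg snd"
    have fst_B: "fst b \<in> Vd (snd b)" "is_lm (lmv (fst b)) (fst b)" if "b \<in> B" for b
      using V_E[of "fst b" "snd b"] lm_E[of "fst b" "snd b"] that B(1) by auto
    have hd: "h \<in> Vd d" by (rule Vd_mono[OF V_E[OF hE]]) (simp add: d_def)
    have finL: "finite (Inl ` L \<union> Inr ` B)" using fin B(2) by simp
    obtain q r where
      q: "\<And>l. l \<in> Inl ` L \<union> Inr ` B \<Longrightarrow> q l \<in> Rx m n" and
      q_\<sigma>: "\<And>l x. l \<in> Inl ` L \<union> Inr ` B \<Longrightarrow> rx_coeff (q l) x \<noteq> 0 \<Longrightarrow>
        xdeg n x + e l \<le> d \<and> \<sigma> (shift x (lmh l)) = Some l" and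
      r: "r \<in> Vd d" and r_\<sigma>: "\<And>P. vc r P \<noteq> 0 \<Longrightarrow> \<sigma> P = None" and
      h_eq: "\<And>i. h i = (\<Sum>l\<in>Inl ` L \<union> Inr ` B. q l * hh l i) + r i" and
      q_bound: "\<And>P0 l x. P0 \<in> MM \<Longrightarrow> below P0 h \<Longrightarrow> l \<in> Inl ` L \<union> Inr ` B \<Longrightarrow>
        rx_coeff (q l) x \<noteq> 0 \<Longrightarrow> ge P0 (shift x (lmh l))"
    proof (rule bounded_division[OF finL _ _ hd, of hh e lmh \<sigma>])
      show "hh l \<in> Vd (e l)" if "l \<in> Inl ` L \<union> Inr ` B" for l
        using that dg fst_B by (auto simp: hh_def e_def)
      show "is_lm (lmh l) (hh l)" if "l \<in> Inl ` L \<union> Inr ` B" for l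
        using that g(2) fst_B by (auto simp: hh_def lmh_def)
      show "l \<in> Inl ` L \<union> Inr ` B \<and> (\<exists>x. P = shift x (lmh l) \<and> xdeg n x + e l \<le> d)"
        if "\<sigma> P = Some l" for P l
        using that \<sigma>_Inl[of P] \<sigma>_Inr[of P]
        by (cases l) (auto simp: byg_def byB_def lmh_def e_def)
    qed (rule that)
    have "byg (lmv h) l0" unfolding byg_def using l0 by (auto simp: d_def)
    then have \<sigma>_h: "\<sigma> (lmv h) \<noteq> Some (Inr b)" for b by (auto simp: \<sigma>_def)
    have lmvh: "lmv h \<in> MM" using hd_MMd[OF hE] by (simp add: MMd_def)
    have qB_small: "mo 0 x" if b: "b \<in> B" and x: "rx_coeff (q (Inr b)) x \<noteq> 0" for b x
    proof -
      have xM: "x \<in> mons m n" using Rx_coeffD[OF q x] b by blast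
      have "ge (lmv h) (shift x (lmv (fst b)))"
        using q_bound[OF lmvh is_lm_D(2)[OF lm_E[OF hE]], of "Inr b" x] b x by (simp add: lmh_def)
      moreover have "lmv h \<noteq> shift x (lmv (fst b))"
        using q_\<sigma>[of "Inr b" x] b x \<sigma>_h[of b] by (auto simp: lmh_def)
      ultimately have "gt (lmv h) (shift x (lmv (fst b)))" by (simp add: ge_def)
      then have "gt (shift 0 (lmv (fst b))) (shift x (lmv (fst b)))"
        using ge_gt_trans[OF h_min[OF b]] B_MM[OF b] xM lmvh by simp
      then show ?thesis by (rule mo_if_gt_shift) (use xM B_MM[OF b] in auto)
    qed
    have "\<exists>u qq. repr u qq (fst b)" if "b \<in> B" for b
      using that B(1) by (cases b) (auto simp: E_iff)
    then obtain ub qb where uqb: "\<And>b. b \<in> B \<Longrightarrow> repr (ub b) (qb b) (fst b)" by metis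
    \<comment> \<open>Substituting the representations of the members of \<open>B\<close> puts the remainder into the shape required
      by \<open>E\<close>; \<open>u'\<close> keeps the leading term \<open>1\<close> since only smaller terms are subtracted.\<close>
    define u' where "u' = uh - (\<Sum>b\<in>B. q (Inr b) * ub b)"
    define q' where "q' l = qh l + q (Inl l) - (\<Sum>b\<in>B. q (Inr b) * qb b l)" for l
    have qB_mbelow: "q (Inr b) \<in> Rx m n" "mbelow 0 (q (Inr b))" "rx_coeff (q (Inr b)) 0 = 0"
      if b: "b \<in> B" for b
    proof -
      show "q (Inr b) \<in> Rx m n" using q b by blast
      show "mbelow 0 (q (Inr b))" unfolding mbelow_def moge_def using qB_small[OF b] by blast
      show "rx_coeff (q (Inr b)) 0 = 0"
        by (rule ccontr) (use qB_small[OF b, of 0] mo_irrefl[of 0] in simp)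
    qed
    have ub_U: "ub b \<in> U" if "b \<in> B" for b using uqb[OF that] by (simp add: repr_def)
    have u': "u' \<in> U"
      unfolding u'_def
    proof (rule U_minus_small)
      show "uh \<in> U" using uqh by (simp add: repr_def)
      show "(\<Sum>b\<in>B. q (Inr b) * ub b) \<in> Rx m n"
        by (intro Rx_sum Rx_mult qB_mbelow U_Rx ub_U)
      show "mbelow 0 (\<Sum>b\<in>B. q (Inr b) * ub b)"
        by (intro mbelow_sum U_mult_coeff qB_mbelow ub_U)
      show "rx_coeff (\<Sum>b\<in>B. q (Inr b) * ub b) 0 = 0"
        using U_mult_coeff(2)[OF qB_mbelow(1,2) ub_U] qB_mbelow(3) by (simp add: rx_coeff_sum)
    qed
    have q'_Rx: "q' l \<in> Rx m n" if "l \<in> L" for l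
    proof -
      have "qb b l \<in> Rx m n" if "b \<in> B" for b using uqb[OF that] \<open>l \<in> L\<close> by (simp add: repr_def)
      moreover have "qh l \<in> Rx m n" using uqh \<open>l \<in> L\<close> by (simp add: repr_def)
      moreover have "q (Inl l) \<in> Rx m n" using q that by blast
      ultimately show ?thesis unfolding q'_def by (intro Rx_diff Rx_add Rx_sum Rx_mult qB_mbelow)
    qed
    have q'_below: "below P0 (\<lambda>i. q' l * g l i)" if l: "l \<in> L" for l
    proof -
      have 1: "below P0 (\<lambda>i. qh l * g l i)" using uqh l by (simp add: repr_def)
      have 2: "below P0 (\<lambda>i. q (Inl l) * g l i)"
        unfolding below_def
      proof (intro allI impI)
        fix Q assume "vc (\<lambda>i. q (Inl l) * g l i) Q \<noteq> 0"
        then obtain x T where Q: "Q = shift x T" "rx_coeff (q (Inl l)) x \<noteq> 0" "vc (g l) T \<noteq> 0"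
          by (rule vc_mult_nonzero)
        have x: "x \<in> mons m n" using Rx_coeffD[OF q Q(2)] l by blast
        have T: "T \<in> MM" "ge (lmg l) T" using V_D[OF g(1)[OF l] Q(3)] below_D[OF is_lm_D(2)[OF g(2)[OF l]] Q(3)] by auto
        have lg: "lmg l \<in> MM" using is_lm_MM g l by blast
        have "ge P0 (shift x (lmg l))"
          using q_bound[OF P0 below_E[OF hE], of "Inl l" x] l Q(2) by (simp add: lmh_def)
        then show "ge P0 Q"
          unfolding Q(1) by (rule ge_trans) (use ge_shift T lg x P0 in auto)
      qed
      have 3: "below P0 (\<lambda>i. q (Inr b) * (qb b l * g l i))" if b: "b \<in> B" for b
        by (rule below_mult_zero) (use qB_mbelow[OF b] uqb[OF b] l g(1) P0 in \<open>auto simp: repr_def intro: V_mult\<close>)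
      have "below P0 (\<lambda>i. (qh l * g l i + q (Inl l) * g l i) - (\<Sum>b\<in>B. q (Inr b) * (qb b l * g l i)))"
        by (intro below_diff below_add below_sum 1 2 3)
      moreover have "q' l * g l i = (qh l * g l i + q (Inl l) * g l i) - (\<Sum>b\<in>B. q (Inr b) * (qb b l * g l i))" for i
        by (simp add: q'_def algebra_simps sum_distrib_left sum_distrib_right)
      ultimately show ?thesis by simp
    qed
    have r_eq: "r i = u' * f i - (\<Sum>l\<in>L. q' l * g l i)" for i
    proof -
      have h_i: "h i = uh * f i - (\<Sum>l\<in>L. qh l * g l i)" using uqh by (simp add: repr_def)
      have b_i: "fst b i = ub b * f i - (\<Sum>l\<in>L. qb b l * g l i)" if "b \<in> B" for b
        using uqb[OF that] by (simp add: repr_def)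
      have "(\<Sum>l\<in>Inl ` L \<union> Inr ` B. q l * hh l i) =
          (\<Sum>l\<in>Inl ` L. q l * hh l i) + (\<Sum>l\<in>Inr ` B. q l * hh l i)"
        by (rule sum.union_disjoint) (use fin B(2) in auto)
      also have "\<dots> = (\<Sum>l\<in>L. q (Inl l) * g l i) + (\<Sum>b\<in>B. q (Inr b) * fst b i)"
        by (simp add: sum.reindex hh_def)
      also have "(\<Sum>b\<in>B. q (Inr b) * fst b i) =
          (\<Sum>b\<in>B. q (Inr b) * ub b) * f i - (\<Sum>b\<in>B. \<Sum>l\<in>L. q (Inr b) * qb b l * g l i)"
        by (simp add: b_i algebra_simps sum_subtractf sum_distrib_left sum_distrib_right)
      also have "(\<Sum>b\<in>B. \<Sum>l\<in>L. q (Inr b) * qb b l * g l i) = (\<Sum>l\<in>L. (\<Sum>b\<in>B. q (Inr b) * qb b l) * g l i)"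
        by (subst sum.swap) (simp add: sum_distrib_right)
      finally have "r i = uh * f i - (\<Sum>l\<in>L. qh l * g l i) - ((\<Sum>l\<in>L. q (Inl l) * g l i) +
          ((\<Sum>b\<in>B. q (Inr b) * ub b) * f i - (\<Sum>l\<in>L. (\<Sum>b\<in>B. q (Inr b) * qb b l) * g l i)))"
        using h_eq[of i] h_i by (simp add: algebra_simps)
      also have "\<dots> = u' * f i - (\<Sum>l\<in>L. q' l * g l i)"
        by (simp add: u'_def q'_def algebra_simps sum.distrib sum_subtractf)
      finally show ?thesis .
    qed
    have repr': "repr u' q' r" using u' q'_Rx q'_below r_eq by (simp add: repr_def)
    show ?thesis
    proof (rule that[of u' q' r])
      fix Q l x assume Q: "is_lm Q r"
      \<comment> \<open>A non-zero remainder would be in \<open>E\<close>, but its leading monomial is divisible by none of \<open>B\<close>.\<close>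
      then have rE: "(r, d) \<in> E" using r repr' unfolding E_iff by blast
      then obtain b where b: "b \<in> B" "le b (r, d)" using B(3) by blast
      then obtain y where "lmv r = shift y (lmv (fst b))" "snd b + xdeg n y \<le> d"
        unfolding le_def hd_def hdvd_shift by auto
      then have "byB (lmv r) b" using b(1) by (auto simp: byB_def add.commute)
      then have "\<exists>b. byB (lmv r) b" by (rule exI)
      then have "\<sigma> (lmv r) \<noteq> None" by (simp add: \<sigma>_def del: split_paired_Ex)
      then show "Q \<noteq> shift x (lmg l)" using r_\<sigma>[OF is_lm_D(1)[OF lm_E[OF rE]]] by simp
    qed (use u' q'_Rx q'_below r_eq Vd_V[OF r] in auto)
  qed
qed

end


section \<open>Least common multiples\<close>

lemma lookup_expo_lcm: "Poly_Mapping.lookup (expo_lcm a b) i = max (Poly_Mapping.lookup a i) (Poly_Mapping.lookup b i)"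
  by transfer simp

lemma mon_lcm_left: "(mon_lcm p q - p) + p = mon_lcm p q"
  and mon_lcm_right: "(mon_lcm p q - q) + q = mon_lcm p q"
proof -
  have "(expo_lcm a b - a) + a = expo_lcm a b" "(expo_lcm a b - b) + b = expo_lcm a b" for a b
    using expo_le_imp_add[of a "expo_lcm a b"] expo_le_imp_add[of b "expo_lcm a b"]
    by (simp_all add: lookup_expo_lcm)
  then show "(mon_lcm p q - p) + p = mon_lcm p q" "(mon_lcm p q - q) + q = mon_lcm p q"
    by (simp_all add: mon_lcm_def case_prod_unfold prod_eq_iff)
qed

lemma mon_lcm_mons: "p \<in> mons m n \<Longrightarrow> q \<in> mons m n \<Longrightarrow> mon_lcm p q \<in> mons m n"
  by (auto simp: mons_def mon_lcm_def in_keys_iff lookup_expo_lcm subset_iff split: prod.splits)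
    (metis max.commute max_0L neq0_conv)+

lemma mon_lcm_quotients_mons:
  assumes "p \<in> mons m n" "q \<in> mons m n"
  shows "mon_lcm p q - p \<in> mons m n" "mon_lcm p q - q \<in> mons m n"
  using mon_lcm_mons[OF assms] mon_lcm_left[of p q] mon_lcm_right[of p q] by (metis mons_add_iff)+

lemma mon_lcm_least:
  assumes "x + p = y + q"
  obtains z where "x = z + (mon_lcm p q - p)"
proof -
  have *: "\<exists>c. a = c + (expo_lcm b b' - b)" if ab: "a + b = a' + b'" for a b a' b' :: expo
  proof -
    have "Poly_Mapping.lookup (expo_lcm b b' - b) i \<le> Poly_Mapping.lookup a i" for i
      using arg_cong[OF ab, of "\<lambda>x. Poly_Mapping.lookup x i"]
      by (simp add: lookup_minus lookup_expo_lcm lookup_add)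
    from expo_le_imp_add[OF this] show ?thesis by blast
  qed
  obtain c1 where c1: "fst x = c1 + (expo_lcm (fst p) (fst q) - fst p)"
    using *[of "fst x" "fst p" "fst y" "fst q"] arg_cong[OF assms, of fst] by auto
  obtain c2 where c2: "snd x = c2 + (expo_lcm (snd p) (snd q) - snd p)"
    using *[of "snd x" "snd p" "snd y" "snd q"] arg_cong[OF assms, of snd] by auto
  have "x = (c1, c2) + (mon_lcm p q - p)"
    using c1 c2 by (simp add: mon_lcm_def case_prod_unfold prod_eq_iff)
  then show ?thesis by (rule that)
qed


section \<open>Schreyer's ordering and Buchberger's criterion\<close>

context module_order
begin

text \<open>
  A monomial multiple \<open>p e\<^sub>l\<close> of a basis vector is compared by the leading monomial of \<open>p g\<^sub>l\<close>.  Among equals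
  the smaller index wins, so that the syzygy of a pair \<open>i < j\<close> has its leading term at \<open>i\<close>.
\<close>

definition schreyer_gt :: "('l::linorder \<Rightarrow> mon \<times> 'i) \<Rightarrow> mon \<times> 'l \<Rightarrow> mon \<times> 'l \<Rightarrow> bool" where
  "schreyer_gt lmg A B \<longleftrightarrow>
     gt (shift (fst A) (lmg (snd A))) (shift (fst B) (lmg (snd B))) \<or>
     shift (fst A) (lmg (snd A)) = shift (fst B) (lmg (snd B)) \<and> snd A < snd B"

lemma schreyer_module_order:
  fixes lmg :: "'l::linorder \<Rightarrow> mon \<times> 'i"
  assumes "finite L" and lmg: "\<And>l. l \<in> L \<Longrightarrow> lmg l \<in> MM"
  shows "module_order m n mo L (schreyer_gt lmg)"
proof
  define img where "img A = shift (fst A) (lmg (snd A))" for A :: "mon \<times> 'l"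
  have img: "img A \<in> MM" if "A \<in> mons m n \<times> L" for A using that lmg by (auto simp: img_def)
  have sgt: "schreyer_gt lmg A B \<longleftrightarrow> gt (img A) (img B) \<or> img A = img B \<and> snd A < snd B" for A B
    by (simp add: schreyer_gt_def img_def)
  have img_shift: "img (shift q A) = shift q (img A)" for q A by (simp add: img_def shift_shift)
  show "finite L" by fact
  show "strict_total_on (mons m n \<times> L) (schreyer_gt lmg)"
    unfolding strict_total_on_def
  proof (intro conjI)
    show "irreflp_on (mons m n \<times> L) (schreyer_gt lmg)"
      unfolding irreflp_on_def sgt using img gt_irrefl by blast
    show "transp_on (mons m n \<times> L) (schreyer_gt lmg)"
      unfolding transp_on_def
    proof (intro ballI impI)
      fix A B C assume M: "A \<in> mons m n \<times> L" "B \<in> mons m n \<times> L" "C \<in> mons m n \<times> L"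
        and gts: "schreyer_gt lmg A B" "schreyer_gt lmg B C"
      then show "schreyer_gt lmg A C"
        using gt_trans[of "img A" "img B" "img C"] img[OF M(1)] img[OF M(2)] img[OF M(3)]
        unfolding sgt by (elim disjE conjE) (auto intro: less_trans)
    qed
    show "totalp_on (mons m n \<times> L) (schreyer_gt lmg)"
      unfolding totalp_on_def
    proof (intro ballI impI)
      fix A B assume M: "A \<in> mons m n \<times> L" "B \<in> mons m n \<times> L" and ne: "A \<noteq> B"
      show "schreyer_gt lmg A B \<or> schreyer_gt lmg B A"
      proof (cases "img A = img B")
        case True
        then have "snd A \<noteq> snd B" using ne by (auto simp: img_def prod_eq_iff)
        then show ?thesis using True unfolding sgt by (metis linorder_neqE)
      next
        case False
        then show ?thesis using gt_total[OF img[OF M(1)] img[OF M(2)]] unfolding sgt by blast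
      qed
    qed
  qed
  show "schreyer_gt lmg (shift q A) (shift q B)"
    if M: "A \<in> mons m n \<times> L" "B \<in> mons m n \<times> L" "q \<in> mons m n" and gts: "schreyer_gt lmg A B" for A B q
    using gts gt_shift[OF img[OF M(1)] img[OF M(2)] M(3)] unfolding sgt img_shift by auto
  show "schreyer_gt lmg (p, i) (q, i) \<longleftrightarrow> mo p q"
    if "i \<in> L" "p \<in> mons m n" "q \<in> mons m n" for i p q
    using that gt_shift_right[of p q "lmg i"] mo_if_gt_shift[of p "lmg i" q] lmg[of i]
    by (auto simp: schreyer_gt_def)
qed (use mo_ordering t_small in auto)

text \<open>A ring element is treated as a vector with a single non-zero component.\<close>

lemma exists_leading_ring:
  assumes i: "i \<in> I" and a: "a \<in> Rx m n" "rx_coeff a p \<noteq> 0"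
  obtains q where "rx_coeff a q \<noteq> 0" "mbelow q a"
proof -
  define F where "F j = (if j = i then a else 0)" for j
  have F: "F \<in> V" by (rule V_I) (use a i in \<open>auto simp: F_def\<close>)
  have "vc F (p, i) \<noteq> 0" using a by (simp add: F_def)
  then obtain Q where Q: "is_lm Q F" using exists_lm[OF F] by metis
  obtain q j where qj: "Q = (q, j)" by (cases Q)
  have j: "j = i" "rx_coeff a q \<noteq> 0" using is_lm_D(1)[OF Q] by (auto simp: qj F_def split: if_splits)
  have "moge q r" if r: "rx_coeff a r \<noteq> 0" for r
  proof -
    have "vc F (r, i) \<noteq> 0" using r by (simp add: F_def)
    from below_D[OF is_lm_D(2)[OF Q] this]
    show ?thesis using gt_same_index[OF i Rx_coeffD[OF a(1) j(2)] Rx_coeffD[OF a(1) r]]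
      by (auto simp: ge_def moge_def qj j)
  qed
  then show ?thesis using that j(2) unfolding mbelow_def by blast
qed

lemma is_lm_diff_smaller:
  assumes "is_lm P F" "F \<in> V" "\<And>Q. vc G Q \<noteq> 0 \<Longrightarrow> gt P Q"
  shows "is_lm P (\<lambda>i. F i - G i)"
proof -
  have "vc G P = 0" using assms(3)[of P] gt_irrefl is_lm_MM[OF assms(1,2)] by blast
  then have "vc (\<lambda>i. F i - G i) P = vc F P" by (simp add: vc_eq rx_coeff_diff)
  moreover have "below P G" using assms(3) unfolding below_def ge_def by blast
  ultimately show ?thesis using assms(1) below_diff unfolding is_lm_def by metis
qed

text \<open>
  If all products \<open>q * g\<close> lie strictly below \<open>P\<close>, then so do the products of leading monomials
  with each single monomial of \<open>q\<close>.
\<close>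

lemma gt_shift_if_product_below:
  assumes q: "q \<in> Rx m n" "rx_coeff q x \<noteq> 0" and g: "g \<in> V" "is_lm Q g" and P: "P \<in> MM"
    and lt: "\<And>R. vc (\<lambda>i. q * g i) R \<noteq> 0 \<Longrightarrow> gt P R"
  shows "gt P (shift x Q)"
proof -
  have Q: "Q \<in> MM" using is_lm_MM g by blast
  obtain y where y: "rx_coeff q y \<noteq> 0" "mbelow y q"
    using exists_leading_ring[OF _ q] Q by (metis mem_Times_iff)
  have xy: "x \<in> mons m n" "y \<in> mons m n" using Rx_coeffD[OF q(1)] q(2) y(1) by auto
  have "gt P (shift y Q)"
    by (rule lt) (rule is_lm_D(1)[OF is_lm_mult(2)[OF q(1) y g]])
  moreover have "ge (shift y Q) (shift x Q)"
    by (rule ge_shift_right) (use mbelow_D[OF y(2) q(2)] xy Q in auto)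
  ultimately show ?thesis by (rule gt_ge_trans) (use xy Q P in auto)
qed

text \<open>
  The assumption \<open>spoly\<close> says that each s-polynomial, up to a factor from $S_>$, is a combination of the \<open>g l\<close>
  with all products strictly below the least common multiple.  Hence the corresponding syzygy has the leading
  monomial \<open>\<tau> i j e\<^sub>i\<close>.  Let \<open>x e\<^sub>i\<close> be the leading monomial of the remainder \<open>\<rho>\<close> of \<open>a\<close> modulo these syzygies.
  If another product \<open>\<rho> l * g l\<close> reached the leading monomial of \<open>\<rho> i * g i\<close>, then \<open>i < l\<close>, and \<open>x\<close> would be a multiple of
  \<open>\<tau> i l\<close>, contrary to the choice of \<open>\<rho>\<close>.  So the leading term of \<open>\<rho> i * g i\<close> survives in the sum.
\<close>

lemma buchberger_over_Rx:
  fixes g :: "'l::linorder \<Rightarrow> 'i \<Rightarrow> 'k::field rx" and lmg :: "'l \<Rightarrow> mon \<times> 'i"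
  defines "\<tau> \<equiv> \<lambda>i j. mon_lcm (fst (lmg i)) (fst (lmg j)) - fst (lmg i)"
    and "\<tau>' \<equiv> \<lambda>i j. mon_lcm (fst (lmg i)) (fst (lmg j)) - fst (lmg j)"
  assumes fin: "finite L"
    and g: "\<And>l. l \<in> L \<Longrightarrow> g l \<in> V" "\<And>l. l \<in> L \<Longrightarrow> is_lm (lmg l) (g l)"
    and spoly: "\<And>i j. i \<in> L \<Longrightarrow> j \<in> L \<Longrightarrow> i < j \<Longrightarrow> snd (lmg i) = snd (lmg j) \<Longrightarrow>
      \<exists>w q. w \<in> U \<and> (\<forall>l\<in>L. q l \<in> Rx m n \<and>
          (\<forall>Q. vc (\<lambda>c. q l * g l c) Q \<noteq> 0 \<longrightarrow> gt (mon_lcm (fst (lmg i)) (fst (lmg j)), snd (lmg i)) Q)) \<and>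
        (\<forall>c. w * (rx_term (1 / vc (g i) (lmg i)) (\<tau> i j) * g i c -
                  rx_term (1 / vc (g j) (lmg j)) (\<tau>' i j) * g j c) = (\<Sum>l\<in>L. q l * g l c))"
    and a: "\<And>l. l \<in> L \<Longrightarrow> a l \<in> Rx m n"
    and F: "\<And>c. F c = (\<Sum>l\<in>L. a l * g l c)" "F \<in> V" "is_lm P F"
  shows "\<exists>l\<in>L. \<exists>x. P = shift x (lmg l)"
proof -
  have lmg: "lmg l \<in> MM" if "l \<in> L" for l using is_lm_MM g that by blast
  interpret S: module_order m n mo L "schreyer_gt lmg"
    by (rule schreyer_module_order[OF fin lmg])
  define PP where "PP = {(i, j). i \<in> L \<and> j \<in> L \<and> i < j \<and> snd (lmg i) = snd (lmg j)}"
  have finPP: "finite PP" by (rule finite_subset[of _ "L \<times> L"]) (use fin in \<open>auto simp: PP_def\<close>)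
  define lcmM where "lcmM i j = (mon_lcm (fst (lmg i)) (fst (lmg j)), snd (lmg i))" for i j
  have lcm_i: "shift (\<tau> i j) (lmg i) = lcmM i j" for i j
    by (simp add: shift_def lcmM_def \<tau>_def mon_lcm_left)
  have lcm_j: "shift (\<tau>' i j) (lmg j) = lcmM i j" if "snd (lmg i) = snd (lmg j)" for i j
    using that by (simp add: shift_def lcmM_def \<tau>'_def mon_lcm_right)
  have "\<exists>s. \<forall>z\<in>PP. s z \<in> S.V \<and> S.is_lm (\<tau> (fst z) (snd z), fst z) (s z) \<and>
      (\<forall>c. (\<Sum>l\<in>L. s z l * g l c) = 0)"
  proof (rule bchoice, rule ballI)
    fix z assume z: "z \<in> PP"
    obtain i j where zij: "z = (i, j)" by (cases z)
    have ij: "i \<in> L" "j \<in> L" "i < j" "snd (lmg i) = snd (lmg j)" using z by (auto simp: PP_def zij)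
    have ne: "i \<noteq> j" using ij by auto
    obtain w q where w: "w \<in> U" and q_all: "\<forall>l\<in>L. q l \<in> Rx m n \<and>
        (\<forall>Q. vc (\<lambda>c. q l * g l c) Q \<noteq> 0 \<longrightarrow> gt (lcmM i j) Q)" and
      wq: "\<forall>c. w * (rx_term (1 / vc (g i) (lmg i)) (\<tau> i j) * g i c -
                  rx_term (1 / vc (g j) (lmg j)) (\<tau>' i j) * g j c) = (\<Sum>l\<in>L. q l * g l c)"
      using spoly[OF ij] unfolding lcmM_def by (elim exE conjE)
    have q: "q l \<in> Rx m n" "vc (\<lambda>c. q l * g l c) Q \<noteq> 0 \<Longrightarrow> gt (lcmM i j) Q" if "l \<in> L" for l Q
      using q_all that by blast+
    have \<tau>M: "\<tau> i j \<in> mons m n" "\<tau>' i j \<in> mons m n"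
      using lmg[OF ij(1)] lmg[OF ij(2)] mon_lcm_quotients_mons unfolding \<tau>_def \<tau>'_def by auto
    have lcmMM: "lcmM i j \<in> MM" using lcm_i[of i j] \<tau>M lmg[OF ij(1)] by (metis shift_MM)
    \<comment> \<open>The part of the syzygy that comes from the definition of the s-polynomial; it carries the leading term.\<close>
    define T where "T l = (if l = i then rx_term (1 / vc (g i) (lmg i)) (\<tau> i j)
        else if l = j then - rx_term (1 / vc (g j) (lmg j)) (\<tau>' i j) else 0)" for l
    have TV: "T \<in> S.V" by (rule S.V_I) (use ij \<tau>M in \<open>auto simp: T_def intro: Rx_term Rx_uminus\<close>)
    have "S.ge (\<tau> i j, i) A" if "vc T A \<noteq> 0" for A
    proof -
      obtain x l where A: "A = (x, l)" by (cases A)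
      have "(x, l) = (\<tau> i j, i) \<or> (x, l) = (\<tau>' i j, j)"
        using that by (auto simp: A T_def rx_coeff_term rx_coeff_uminus split: if_splits)
      moreover have "schreyer_gt lmg (\<tau> i j, i) (\<tau>' i j, j)"
        using ij by (simp add: schreyer_gt_def lcm_i lcm_j)
      ultimately show ?thesis unfolding A S.ge_def by auto
    qed
    moreover have "vc T (\<tau> i j, i) \<noteq> 0"
      using is_lm_D(1)[OF g(2)[OF ij(1)]] by (simp add: T_def rx_coeff_term)
    ultimately have "S.is_lm (\<tau> i j, i) T" unfolding S.is_lm_def S.below_def by blast
    from S.U_scale(1)[OF w TV this]
    have lm1: "S.is_lm (\<tau> i j, i) (\<lambda>l. w * T l)" .
    define q0 where "q0 l = (if l \<in> L then q l else 0)" for l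
    have q0V: "q0 \<in> S.V" by (rule S.V_I) (use q in \<open>auto simp: q0_def\<close>)
    have small: "schreyer_gt lmg (\<tau> i j, i) A" if A: "vc q0 A \<noteq> 0" for A
    proof -
      obtain x l where xl: "A = (x, l)" by (cases A)
      have l: "l \<in> L" "rx_coeff (q l) x \<noteq> 0" using A by (auto simp: xl q0_def split: if_splits)
      have "gt (lcmM i j) (shift x (lmg l))"
        by (rule gt_shift_if_product_below[OF q(1)[OF l(1)] l(2) g(1)[OF l(1)] g(2)[OF l(1)] lcmMM q(2)[OF l(1)]])
      then show ?thesis by (simp add: schreyer_gt_def lcm_i xl)
    qed
    define s where "s l = w * T l - q0 l" for l
    have wT: "(\<lambda>l. w * T l) \<in> S.V" by (rule S.V_mult[OF U_Rx[OF w] TV])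
    have "S.is_lm (\<tau> i j, i) s"
      unfolding s_def by (rule S.is_lm_diff_smaller[OF lm1 wT small])
    moreover have "s \<in> S.V" unfolding s_def by (rule S.V_diff[OF wT q0V])
    moreover have "(\<Sum>l\<in>L. s l * g l c) = 0" for c
    proof -
      have "(\<Sum>l\<in>L. T l * g l c) = (\<Sum>l\<in>{i, j}. T l * g l c)"
        by (rule sum.mono_neutral_right) (use fin ij in \<open>auto simp: T_def\<close>)
      then have "w * (\<Sum>l\<in>L. T l * g l c) = (\<Sum>l\<in>L. q l * g l c)"
        using wq[THEN spec, of c] ne by (simp add: T_def)
      then show ?thesis
        by (simp add: s_def q0_def left_diff_distrib sum_subtractf sum_distrib_left mult.assoc)
    qed
    ultimately show "\<exists>s. s \<in> S.V \<and> S.is_lm (\<tau> (fst z) (snd z), fst z) s \<and> (\<forall>c. (\<Sum>l\<in>L. s l * g l c) = 0)"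
      by (auto simp: zij)
  qed
  then obtain s where s: "\<And>z. z \<in> PP \<Longrightarrow> s z \<in> S.V"
    "\<And>z. z \<in> PP \<Longrightarrow> S.is_lm (\<tau> (fst z) (snd z), fst z) (s z)"
    "\<And>z c. z \<in> PP \<Longrightarrow> (\<Sum>l\<in>L. s z l * g l c) = 0" by blast
  define A where "A l = (if l \<in> L then a l else 0)" for l
  have AV: "A \<in> S.V" by (rule S.V_I) (use a in \<open>auto simp: A_def\<close>)
  have "\<exists>B. vc A B \<noteq> 0"
  proof (rule ccontr)
    assume "\<not> ?thesis"
    then have "A l = 0" for l by (intro rx_eqI) (metis vc_pair rx_coeff_zero)
    then have "F c = 0" for c unfolding F(1) by (intro sum.neutral) (metis A_def mult_zero_left)
    then show False using is_lm_D(1)[OF F(3)] by (simp add: vc_eq)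
  qed
  then obtain P1 where P1: "S.is_lm P1 A" using S.exists_lm[OF AV] by metis
  obtain u b \<rho> where u: "u \<in> U" and \<rho>: "\<rho> \<in> S.V" and
    A_eq: "\<And>l. u * A l = (\<Sum>z\<in>PP. b z * s z l) + \<rho> l" and
    irred: "\<And>Q z x. S.is_lm Q \<rho> \<Longrightarrow> z \<in> PP \<Longrightarrow> Q \<noteq> shift x (\<tau> (fst z) (snd z), fst z)"
    by (rule S.weak_division[of PP s "\<lambda>z. (\<tau> (fst z) (snd z), fst z)", OF finPP s(1,2) AV P1])
      (assumption, assumption, rule that)
  have uF: "u * F c = (\<Sum>l\<in>L. \<rho> l * g l c)" for c
  proof -
    have "u * F c = (\<Sum>l\<in>L. u * A l * g l c)"
      by (simp add: F(1) sum_distrib_left A_def mult.assoc)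
    also have "\<dots> = (\<Sum>l\<in>L. \<Sum>z\<in>PP. b z * (s z l * g l c)) + (\<Sum>l\<in>L. \<rho> l * g l c)"
      by (simp add: A_eq distrib_right sum.distrib sum_distrib_right mult.assoc)
    also have "(\<Sum>l\<in>L. \<Sum>z\<in>PP. b z * (s z l * g l c)) = (\<Sum>z\<in>PP. b z * (\<Sum>l\<in>L. s z l * g l c))"
      by (subst sum.swap) (simp add: sum_distrib_left)
    also have "\<dots> = 0" by (simp add: s(3))
    finally show ?thesis by simp
  qed
  have uF_lm: "is_lm P (\<lambda>c. u * F c)" by (rule U_scale(1)[OF u F(2,3)])
  have "\<exists>B. vc \<rho> B \<noteq> 0"
  proof (rule ccontr)
    assume "\<not> ?thesis"
    then have "\<rho> l = 0" for l by (intro rx_eqI) (metis vc_pair rx_coeff_zero)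
    then show False using is_lm_D(1)[OF uF_lm] by (simp add: uF vc_eq)
  qed
  then obtain Q where Q: "S.is_lm Q \<rho>" using S.exists_lm[OF \<rho>] by metis
  obtain x i where xi: "Q = (x, i)" by (cases Q)
  have i: "i \<in> L" and x: "x \<in> mons m n" using S.is_lm_MM[OF Q \<rho>] by (auto simp: xi)
  define X where "X = shift x (lmg i)"
  have X: "X \<in> MM" using lmg[OF i] x by (simp add: X_def)
  have key: "ge X (shift y T) \<and> (shift y T = X \<longrightarrow> l = i)"
    if l: "l \<in> L" and y: "rx_coeff (\<rho> l) y \<noteq> 0" and T: "vc (g l) T \<noteq> 0" for l y T
  proof -
    have yl: "vc \<rho> (y, l) \<noteq> 0" using y by simp
    have yM: "y \<in> mons m n" using S.V_D[OF \<rho> yl] by simp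
    have TM: "T \<in> MM" using V_D[OF g(1)[OF l] T] .
    have "S.ge (x, i) (y, l)" using S.below_D[OF S.is_lm_D(2)[OF Q] yl] by (simp add: xi)
    then have c: "(x, i) = (y, l) \<or> gt X (shift y (lmg l)) \<or> X = shift y (lmg l) \<and> i < l"
      unfolding S.ge_def schreyer_gt_def by (simp add: X_def)
    have 1: "ge X (shift y (lmg l))" using c by (auto simp: ge_def X_def)
    have 2: "ge (shift y (lmg l)) (shift y T)"
      by (rule ge_shift) (use below_D[OF is_lm_D(2)[OF g(2)[OF l]] T] lmg[OF l] TM yM in auto)
    have "ge X (shift y T)" by (rule ge_trans[OF 1 2]) (use lmg[OF l] TM yM X in auto)
    moreover have "l = i" if eq: "shift y T = X"
    proof (rule ccontr)
      assume "l \<noteq> i"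
      have eq': "shift y (lmg l) = X"
        using ge_antisym[OF 1] 2 X yM lmg[OF l] by (simp add: eq)
      with c \<open>l \<noteq> i\<close> have il: "i < l" using gt_irrefl[OF X] by auto
      have xy: "x + fst (lmg i) = y + fst (lmg l)" "snd (lmg i) = snd (lmg l)"
        using eq' by (auto simp: X_def shift_def)
      obtain z where "x = z + \<tau> i l" using mon_lcm_least[OF xy(1)] unfolding \<tau>_def by blast
      then have "Q = shift z (\<tau> i l, i)" by (simp add: xi shift_def)
      moreover have "(i, l) \<in> PP" using i l il xy by (simp add: PP_def)
      ultimately show False using irred[OF Q, of "(i, l)" z] by simp
    qed
    ultimately show ?thesis by blast
  qed
  have "below X (\<lambda>c. \<Sum>l\<in>L. \<rho> l * g l c)"
  proof (rule below_sum)
    fix l assume "l \<in> L"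
    then show "below X (\<lambda>c. \<rho> l * g l c)"
      unfolding below_def using key by (blast elim: vc_mult_nonzero)
  qed
  moreover have "vc (\<lambda>c. \<Sum>l\<in>L. \<rho> l * g l c) X \<noteq> 0"
  proof -
    have others: "vc (\<lambda>c. \<rho> l * g l c) X = 0" if l: "l \<in> L" "l \<noteq> i" for l
    proof (rule ccontr)
      assume "vc (\<lambda>c. \<rho> l * g l c) X \<noteq> 0"
      then obtain y T where "X = shift y T" "rx_coeff (\<rho> l) y \<noteq> 0" "vc (g l) T \<noteq> 0"
        by (rule vc_mult_nonzero)
      then show False using key[OF l(1)] l(2) by metis
    qed
    have "vc (\<lambda>c. \<Sum>l\<in>L. \<rho> l * g l c) X = (\<Sum>l\<in>L. vc (\<lambda>c. \<rho> l * g l c) X)"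
      by (simp add: vc_eq rx_coeff_sum)
    also have "\<dots> = (\<Sum>l\<in>{i}. vc (\<lambda>c. \<rho> l * g l c) X)"
      by (rule sum.mono_neutral_right) (use fin i others in auto)
    also have "\<dots> = rx_coeff (\<rho> i) x * vc (g i) (lmg i)"
    proof -
      have "mbelow x (\<rho> i)"
        unfolding mbelow_def
      proof (intro allI impI)
        fix y assume y: "rx_coeff (\<rho> i) y \<noteq> 0"
        then have yi: "vc \<rho> (y, i) \<noteq> 0" by simp
        have yM: "y \<in> mons m n" using S.V_D[OF \<rho> yi] by simp
        have "S.ge (x, i) (y, i)" using S.below_D[OF S.is_lm_D(2)[OF Q] yi] by (simp add: xi)
        then show "moge x y" using S.gt_same_index[OF i x yM] by (auto simp: S.ge_def moge_def)
      qed
      moreover have "rx_coeff (\<rho> i) x \<noteq> 0" using S.is_lm_D(1)[OF Q] by (simp add: xi)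
      ultimately show ?thesis
        using is_lm_mult(1)[OF S.V_component[OF \<rho>] _ _ g(1)[OF i] g(2)[OF i]] by (simp add: X_def)
    qed
    also have "\<dots> \<noteq> 0" using S.is_lm_D(1)[OF Q] is_lm_D(1)[OF g(2)[OF i]] by (simp add: xi)
    finally show ?thesis .
  qed
  ultimately have "is_lm X (\<lambda>c. u * F c)" unfolding uF is_lm_def by blast
  then have "X = P" using is_lm_unique[OF _ uF_lm V_mult[OF U_Rx[OF u] F(2)]] by blast
  then show ?thesis using i unfolding X_def by blast
qed

end


section \<open>Fractions with denominators in $S_>$\<close>

text \<open>
  The embedding of $R[x]$ into its field of fractions, through which equations between fractions become
  equations in $R[x]$.
\<close>

definition emb :: "'k::field rx \<Rightarrow> 'k rx fract" where
  "emb a = Fraction_Field.Fract a 1"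

lemma emb_add: "emb (a + b) = emb a + emb b"
  and emb_diff: "emb (a - b) = emb a - emb b"
  and emb_mult: "emb (a * b) = emb a * emb b"
  and emb_uminus: "emb (- a) = - emb a"
  and emb_zero [simp]: "emb 0 = 0"
  and emb_one [simp]: "emb 1 = 1"
  and emb_eq_iff [simp]: "emb a = emb b \<longleftrightarrow> a = b"
  by (simp_all add: emb_def Zero_fract_def One_fract_def eq_fract)

lemma emb_sum: "emb (sum f A) = (\<Sum>x\<in>A. emb (f x))"
  by (induction A rule: infinite_finite_induct) (simp_all add: emb_add)

lemma emb_eq_0_iff [simp]: "emb a = 0 \<longleftrightarrow> a = 0"
  using emb_eq_iff[of a 0] by (simp del: emb_eq_iff)

lemma Fract_eq_emb: "Fraction_Field.Fract a b = emb a / emb b"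
  by (simp add: emb_def divide_fract)

definition vemb :: "('s::finite \<Rightarrow> 'k::field rx) \<Rightarrow> 'k rx fract ^ 's" where
  "vemb F = (\<chi> i. emb (F i))"

lemma vemb_nth [simp]: "vemb F $ i = emb (F i)"
  by (simp add: vemb_def)

locale local_ordering =
  fixes m n :: nat and gt :: "'s::finite mmon \<Rightarrow> 's mmon \<Rightarrow> bool"
  assumes ordering: "mmon_ordering m n gt" and tlocal: "t_local m gt"
begin

lemma module_order_UNIV: "module_order m n (induced gt) (UNIV :: 's set) gt"
proof -
  obtain gt' where gt': "mon_ordering m n gt'"
    "\<forall>i. \<forall>p\<in>mons m n. \<forall>p'\<in>mons m n. gt' p p' \<longleftrightarrow> gt (p, i) (p', i)"
    using ordering unfolding mmon_ordering_def by (elim conjE exE)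
  have ind: "induced gt p q \<longleftrightarrow> gt' p q" if "p \<in> mons m n" "q \<in> mons m n" for p q
    using induced_eq[OF gt'(2) that] by simp
  have gt'_tot: "irreflp_on (mons m n) gt'" "transp_on (mons m n) gt'" "totalp_on (mons m n) gt'"
    using gt'(1) unfolding mon_ordering_def strict_total_on_def by blast+
  have gt'_add: "gt' (q + p) (q + p')"
    if "p \<in> mons m n" "p' \<in> mons m n" "q \<in> mons m n" "gt' p p'" for p p' q
    using gt'(1) that unfolding mon_ordering_def by blast
  have "strict_total_on (mons m n) (induced gt)"
    unfolding strict_total_on_def
  proof (intro conjI)
    show "irreflp_on (mons m n) (induced gt)"
      using gt'_tot(1) ind unfolding irreflp_on_def by blast
    show "transp_on (mons m n) (induced gt)"
      unfolding transp_on_def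
    proof (intro ballI impI)
      fix p q r assume "p \<in> mons m n" "q \<in> mons m n" "r \<in> mons m n" "induced gt p q" "induced gt q r"
      then show "induced gt p r" using transp_onD[OF gt'_tot(2), of p q r] ind by simp
    qed
    show "totalp_on (mons m n) (induced gt)"
      using gt'_tot(3) ind unfolding totalp_on_def by metis
  qed
  then have mo: "mon_ordering m n (induced gt)"
    unfolding mon_ordering_def
  proof (intro conjI ballI impI)
    fix p p' q assume M: "p \<in> mons m n" "p' \<in> mons m n" "q \<in> mons m n" and "induced gt p p'"
    then have "gt' (q + p) (q + p')" using gt'_add ind by blast
    then show "induced gt (q + p) (q + p')" using ind M by (simp add: mons_add_iff)
  qed
  show ?thesis
  proof
    show "strict_total_on (mons m n \<times> UNIV) gt"
      using ordering unfolding mmon_ordering_def mmons_def by blast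
    show "gt (shift q P) (shift q Q)"
      if "P \<in> mons m n \<times> UNIV" "Q \<in> mons m n \<times> UNIV" "q \<in> mons m n" "gt P Q" for P Q :: "'s mmon" and q
    proof -
      have "\<forall>p\<in>mons m n. \<forall>p'\<in>mons m n. \<forall>i j. \<forall>q\<in>mons m n.
          gt (p, i) (p', j) \<longrightarrow> gt (q + p, i) (q + p', j)"
        using ordering unfolding mmon_ordering_def by (elim conjE)
      from this[rule_format, of "fst P" "fst Q" q "snd P" "snd Q"] that
      show ?thesis by (simp add: shift_def mem_Times_iff)
    qed
    show "gt (p, i) (q, i) \<longleftrightarrow> induced gt p q" if "p \<in> mons m n" "q \<in> mons m n" for p q i
      using gt'(2) ind that by blast
    show "induced gt 0 (Poly_Mapping.single i 1, 0)" if "i < m" for i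
      using tlocal that unfolding t_local_def by blast
  qed (use mo in simp_all)
qed

sublocale module_order m n "induced gt" "UNIV :: 's set" gt
  by (rule module_order_UNIV)

abbreviation Loc :: "'k::field rx fract set" where "Loc \<equiv> loc m n gt"
abbreviation LocV :: "('k::field rx fract ^ 's) set" where "LocV \<equiv> loc_vec m n gt"
abbreviation LM :: "'k::field rx fract ^ 's \<Rightarrow> 's mmon option" where "LM \<equiv> lm m n gt"
abbreviation LC :: "'k::field rx fract ^ 's \<Rightarrow> 'k" where "LC \<equiv> lc m n gt"

lemma U_nonzero: "u \<in> U \<Longrightarrow> u \<noteq> 0"
  by (auto simp: U_def)

lemma lead_ring:
  assumes "a \<in> Rx m n" "rx_coeff a p \<noteq> 0" "mbelow p a"
  shows "lead (induced gt) (rx_coeff a) = Some p"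
proof -
  have "(THE p. rx_coeff a p \<noteq> 0 \<and> (\<forall>q. rx_coeff a q \<noteq> 0 \<and> q \<noteq> p \<longrightarrow> induced gt p q)) = p"
  proof (rule the_equality)
    show "rx_coeff a p \<noteq> 0 \<and> (\<forall>q. rx_coeff a q \<noteq> 0 \<and> q \<noteq> p \<longrightarrow> induced gt p q)"
      using assms(2) mbelow_D[OF assms(3)] unfolding moge_def by blast
    fix q assume q: "rx_coeff a q \<noteq> 0 \<and> (\<forall>r. rx_coeff a r \<noteq> 0 \<and> r \<noteq> q \<longrightarrow> induced gt q r)"
    have pq: "p \<in> mons m n" "q \<in> mons m n" using Rx_coeffD[OF assms(1)] assms(2) q by auto
    show "q = p"
    proof (rule ccontr)
      assume "q \<noteq> p"
      then have "induced gt q p" using q[THEN conjunct2, THEN spec, of p] assms(2) by simp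
      moreover have "induced gt p q"
        using q mbelow_D[OF assms(3), of q] \<open>q \<noteq> p\<close> unfolding moge_def by blast
      ultimately
      show False using mo_trans[of p q p] mo_irrefl[of p] pq by blast
    qed
  qed
  then show ?thesis using assms(2) unfolding lead_def by metis
qed

lemma S_gt_eq_U: "S_gt m n (induced gt) = U"
proof (intro set_eqI iffI)
  fix u :: "'k::field rx"
  assume u: "u \<in> S_gt m n (induced gt)"
  then have uR: "u \<in> Rx m n" and lt: "lt_rx (induced gt) u = 1" by (auto simp: S_gt_def)
  have one: "(1 :: 'k rx) \<noteq> 0" by simp
  obtain p0 where "rx_coeff u p0 \<noteq> 0"
  proof (rule ccontr)
    assume "\<not> thesis"
    then have "\<forall>p. rx_coeff u p = 0" using that by blast
    then show False using lt one by (simp add: lt_rx_def lead_def del: split_paired_All)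
  qed
  then obtain p where p: "rx_coeff u p \<noteq> 0" "mbelow p u"
    by (rule exists_leading_ring[OF UNIV_I uR])
  have "rx_term (rx_coeff u p) p = 1" using lt lead_ring[OF uR p] by (simp add: lt_rx_def)
  from arg_cong[OF this, of "\<lambda>f. rx_coeff f p"]
  have "p = 0" "rx_coeff u p = 1" using p(1) by (auto simp: rx_coeff_term rx_coeff_one split: if_splits)
  then show "u \<in> U" using uR p(2) by (simp add: U_def)
next
  fix u :: "'k::field rx" assume u: "u \<in> U"
  then have "lead (induced gt) (rx_coeff u) = Some 0" by (intro lead_ring) (auto simp: U_def)
  then show "u \<in> S_gt m n (induced gt)"
    using u by (simp add: S_gt_def lt_rx_def U_def rx_term_one)
qed

lemma Loc_iff: "c \<in> Loc \<longleftrightarrow> (\<exists>a u. a \<in> Rx m n \<and> u \<in> U \<and> c = emb a / emb u)"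
  unfolding loc_def S_gt_eq_U Fract_eq_emb by blast

lemma LocI: "a \<in> Rx m n \<Longrightarrow> u \<in> U \<Longrightarrow> emb a / emb u \<in> Loc"
  unfolding Loc_iff by blast

lemma emb_Loc: "a \<in> Rx m n \<Longrightarrow> emb a \<in> Loc"
  using LocI[OF _ one_U, of a] by simp

lemma Loc_add: "c \<in> Loc \<Longrightarrow> d \<in> Loc \<Longrightarrow> c + d \<in> Loc"
proof -
  assume "c \<in> Loc" "d \<in> Loc"
  then obtain a u b w where *: "a \<in> Rx m n" "u \<in> U" "c = emb a / emb u" "b \<in> Rx m n" "w \<in> U" "d = emb b / emb w"
    unfolding Loc_iff by blast
  then have "c + d = emb (a * w + b * u) / emb (u * w)"
    by (simp add: emb_add emb_mult U_nonzero add_frac_eq)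
  then show ?thesis using * LocI[of "a * w + b * u" "u * w"] by (simp add: Rx_add Rx_mult U_mult U_Rx)
qed

lemma Loc_mult: "c \<in> Loc \<Longrightarrow> d \<in> Loc \<Longrightarrow> c * d \<in> Loc"
proof -
  assume "c \<in> Loc" "d \<in> Loc"
  then obtain a u b w where *: "a \<in> Rx m n" "u \<in> U" "c = emb a / emb u" "b \<in> Rx m n" "w \<in> U" "d = emb b / emb w"
    unfolding Loc_iff by blast
  then have "c * d = emb (a * b) / emb (u * w)" by (simp add: emb_mult)
  then show ?thesis using * LocI[of "a * b" "u * w"] by (simp add: Rx_mult U_mult)
qed

lemma Loc_zero [simp]: "0 \<in> Loc"
  using emb_Loc[of 0] by simp

lemma LocV_zero [simp]: "0 \<in> LocV"
  by (simp add: loc_vec_def)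

lemma LocV_scale: "c \<in> Loc \<Longrightarrow> v \<in> LocV \<Longrightarrow> c *s v \<in> LocV"
  by (simp add: loc_vec_def Loc_mult)

text \<open>\<open>v = F / u\<close>, with \<open>F\<close> a function, as everywhere above, and stated without division.\<close>

definition rep :: "'k::field rx fract ^ 's \<Rightarrow> ('s \<Rightarrow> 'k rx) \<Rightarrow> 'k rx \<Rightarrow> bool" where
  "rep v F u \<longleftrightarrow> F \<in> V \<and> u \<in> U \<and> (\<forall>i. emb u * v $ i = emb (F i))"

lemma rep_D:
  assumes "rep v F u"
  shows "F \<in> V" "u \<in> U" "emb u * v $ i = emb (F i)"
  using assms unfolding rep_def by blast+

lemma represents_iff_rep: "represents m n gt v f u \<longleftrightarrow> rep v (\<lambda>i. f $ i) u"
proof -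
  have "(\<forall>i. f $ i \<in> Rx m n) \<longleftrightarrow> (\<lambda>i. f $ i) \<in> V"
    using V_component[of "\<lambda>i. f $ i"] V_I[of "\<lambda>i. f $ i"] by auto
  moreover have "v = (\<chi> i. Fraction_Field.Fract (f $ i) u) \<longleftrightarrow> (\<forall>i. emb u * v $ i = emb (f $ i))" if "u \<in> U"
    using U_nonzero[OF that] by (auto simp: vec_eq_iff Fract_eq_emb field_simps)
  ultimately show ?thesis unfolding represents_def rep_def S_gt_eq_U by blast
qed

lemma rep_unique:
  assumes "rep v F u" "rep v F' u'"
  shows "u' * F i = u * F' i"
proof -
  have "emb u' * (emb u * v $ i) = emb u * (emb u' * v $ i)" by (simp add: mult.left_commute)
  then have "emb (u' * F i) = emb (u * F' i)"
    unfolding rep_D(3)[OF assms(1)] rep_D(3)[OF assms(2)] by (simp add: emb_mult)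
  then show ?thesis by simp
qed

text \<open>
  Leading terms of fractions are well defined: \<open>u' F = u F'\<close>, and multiplication by elements of $S_>$
  does not change leading terms.
\<close>

lemma rep_lm_unique:
  assumes "rep v F u" "rep v F' u'" "is_lm P F"
  shows "is_lm P F'" "vc F' P = vc F P"
proof -
  have FV: "F \<in> V" "F' \<in> V" "u \<in> U" "u' \<in> U" using assms by (auto simp: rep_def)
  have eq: "(\<lambda>i. u' * F i) = (\<lambda>i. u * F' i)" using rep_unique[OF assms(1,2)] by blast
  have lm1: "is_lm P (\<lambda>i. u' * F i)" and vc1: "vc (\<lambda>i. u' * F i) P = vc F P"
    using U_scale[OF FV(4,1) assms(3)] by auto
  have "\<exists>Q. vc F' Q \<noteq> 0"
  proof (rule ccontr)
    assume "\<not> ?thesis"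
    then have "F' i = 0" for i by (intro rx_eqI) (metis vc_pair rx_coeff_zero)
    then show False using is_lm_D(1)[OF lm1] by (simp add: eq vc_eq)
  qed
  then obtain Q where Q: "is_lm Q F'" using exists_lm[OF FV(2)] by metis
  have lm2: "is_lm Q (\<lambda>i. u * F' i)" and vc2: "vc (\<lambda>i. u * F' i) Q = vc F' Q"
    using U_scale[OF FV(3,2) Q] by auto
  have "Q = P" using is_lm_unique[OF lm2 lm1[unfolded eq]] V_mult[OF U_Rx[OF FV(3)] FV(2)] by blast
  then show "is_lm P F'" "vc F' P = vc F P" using Q vc1 vc2 eq by simp_all
qed

lemma lead_vec:
  assumes "F \<in> V" "is_lm P F"
  shows "lead gt (vc F) = Some P"
proof -
  have PM: "P \<in> MM" using is_lm_MM[OF assms(2,1)] .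
  have "(THE p. vc F p \<noteq> 0 \<and> (\<forall>q. vc F q \<noteq> 0 \<and> q \<noteq> p \<longrightarrow> gt p q)) = P"
  proof (rule the_equality)
    show "vc F P \<noteq> 0 \<and> (\<forall>q. vc F q \<noteq> 0 \<and> q \<noteq> P \<longrightarrow> gt P q)"
      using is_lm_D[OF assms(2)] below_D unfolding ge_def by blast
    fix Q assume Q: "vc F Q \<noteq> 0 \<and> (\<forall>q. vc F q \<noteq> 0 \<and> q \<noteq> Q \<longrightarrow> gt Q q)"
    then have "is_lm Q F" unfolding is_lm_def below_def ge_def by blast
    then show "Q = P" using is_lm_unique assms by blast
  qed
  then show ?thesis using is_lm_D(1)[OF assms(2)] unfolding lead_def by metis
qed

lemma lead_vec_zero: "(\<And>i. F i = 0) \<Longrightarrow> lead gt (vc F) = None"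
  by (simp add: lead_def vc_eq)

lemma vec_coeff_eq_vc: "vec_coeff f = vc (\<lambda>i. f $ i)"
  by (simp add: vec_coeff_def vc_def)

lemma zero_or_is_lm:
  assumes "F \<in> V"
  shows "(\<forall>i. F i = 0) \<or> (\<exists>P. is_lm P F)"
proof (cases "\<exists>P. vc F P \<noteq> 0")
  case True
  then show ?thesis using exists_lm[OF assms] by metis
next
  case False
  then have "F i = 0" for i by (intro rx_eqI) (metis vc_pair rx_coeff_zero)
  then show ?thesis by blast
qed

lemma LM_LC_eq:
  assumes F: "rep v F u" "is_lm P F"
  shows "LM v = Some P" "LC v = vc F P"
proof -
  have FV: "F \<in> V" using F by (simp add: rep_def)
  have r: "represents m n gt v (\<chi> i. F i) u" using F by (simp add: represents_iff_rep)
  have uniq: "lead gt (vec_coeff f) = Some P \<and> vec_coeff f P = vc F P" if "represents m n gt v f w" for f w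
  proof -
    have f: "rep v (\<lambda>i. f $ i) w" using that by (simp add: represents_iff_rep)
    then have "(\<lambda>i. f $ i) \<in> V" by (simp add: rep_def)
    then show ?thesis unfolding vec_coeff_eq_vc
      using rep_lm_unique[OF F(1) f F(2)] lead_vec by blast
  qed
  show "LM v = Some P"
    unfolding lm_def by (rule the_equality) (use r uniq in \<open>metis+\<close>)
  show "LC v = vc F P"
    unfolding lc_def by (rule the_equality) (use r uniq in \<open>metis option.sel\<close>)+
qed

lemma rep_zero_iff: "rep v F u \<Longrightarrow> (\<forall>i. F i = 0) \<longleftrightarrow> v = 0"
  using U_nonzero[OF rep_D(2), of v F u] rep_D(3)[of v F u]
  by (metis emb_eq_0_iff mult_eq_0_iff vec_eq_iff zero_index)

lemma LM_zero [simp]: "LM 0 = None"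
proof -
  have r: "represents m n gt 0 0 1" by (auto simp: represents_iff_rep rep_def one_U intro: V_I)
  have uniq: "lead gt (vec_coeff f) = None" if "represents m n gt 0 f w" for f w
    unfolding vec_coeff_eq_vc
    by (rule lead_vec_zero) (use that rep_zero_iff[of 0 "\<lambda>i. f $ i" w] in \<open>simp add: represents_iff_rep\<close>)
  show ?thesis unfolding lm_def by (rule the_equality) (use r uniq in \<open>metis+\<close>)
qed

lemma LM_eq_SomeD: "rep v F u \<Longrightarrow> LM v = Some P \<Longrightarrow> is_lm P F"
  using zero_or_is_lm[of F] LM_LC_eq(1)[of v F u] rep_zero_iff[of v F u] by (auto simp: rep_def)

lemma common_denominator:
  assumes "finite A" "\<forall>x\<in>A. c x \<in> Loc"
  shows "\<exists>u a. u \<in> U \<and> (\<forall>x\<in>A. a x \<in> Rx m n \<and> emb u * c x = emb (a x))"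
  using assms
proof (induction A rule: finite_induct)
  case empty
  then show ?case using one_U by blast
next
  case (insert y A)
  then obtain u a where ua: "u \<in> U" "\<And>x. x \<in> A \<Longrightarrow> a x \<in> Rx m n" "\<And>x. x \<in> A \<Longrightarrow> emb u * c x = emb (a x)"
    by auto
  obtain b w where bw: "b \<in> Rx m n" "w \<in> U" "c y = emb b / emb w"
    using bspec[OF insert.prems insertI1] unfolding Loc_iff by blast
  have y: "emb (u * w) * c y = emb (u * b)"
    using bw(3) U_nonzero[OF bw(2)] by (simp add: emb_mult)
  have x: "emb (u * w) * c x = emb (w * a x)" if "x \<in> A" for x
  proof -
    have "emb (u * w) * c x = emb w * (emb u * c x)" by (simp add: emb_mult mult_ac)
    then show ?thesis using ua(3)[OF that] by (simp add: emb_mult)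
  qed
  show ?case
  proof (intro exI conjI ballI)
    show "u * w \<in> U" using ua bw U_mult by blast
    fix x assume "x \<in> insert y A"
    then show "(if x = y then u * b else w * a x) \<in> Rx m n"
      using ua bw by (auto intro: Rx_mult U_Rx)
    show "emb (u * w) * c x = emb (if x = y then u * b else w * a x)"
      using x y \<open>x \<in> insert y A\<close> by auto
  qed
qed

lemma common_rep:
  assumes "finite A" "\<forall>x\<in>A. v x \<in> LocV"
  shows "\<exists>u F. u \<in> U \<and> (\<forall>x\<in>A. rep (v x) (F x) u)"
proof -
  have "\<forall>z\<in>A \<times> (UNIV :: 's set). v (fst z) $ (snd z) \<in> Loc"
    using assms(2) by (auto simp: loc_vec_def)
  from common_denominator[OF _ this] assms(1)
  obtain u a where u: "u \<in> U" and a: "\<forall>z\<in>A \<times> (UNIV :: 's set). a z \<in> Rx m n \<and>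
      emb u * v (fst z) $ (snd z) = emb (a z)" by auto
  have "rep (v x) (\<lambda>i. a (x, i)) u" if "x \<in> A" for x
    unfolding rep_def
  proof (intro conjI allI)
    show "(\<lambda>i. a (x, i)) \<in> V" by (rule V_I) (use a that in auto)
    show "emb u * v x $ i = emb (a (x, i))" for i using bspec[OF a, of "(x, i)"] that by simp
  qed (rule u)
  then show ?thesis using u by (intro exI[of _ u] exI[of _ "\<lambda>x i. a (x, i)"]) blast
qed

lemma rep_exists: "v \<in> LocV \<Longrightarrow> \<exists>F u. rep v F u"
  using common_rep[of "{()}" "\<lambda>_. v"] by auto

lemma LM_nonzero: "v \<in> LocV \<Longrightarrow> v \<noteq> 0 \<Longrightarrow> \<exists>P. LM v = Some P"
proof -
  assume v: "v \<in> LocV" "v \<noteq> 0"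
  obtain F u where F: "rep v F u" using rep_exists[OF v(1)] by blast
  then show ?thesis using zero_or_is_lm[of F] rep_zero_iff[OF F] v(2) LM_LC_eq(1)[OF F] by (auto simp: rep_def)
qed

lemma LM_MM: "v \<in> LocV \<Longrightarrow> LM v = Some P \<Longrightarrow> P \<in> MM"
  by (metis rep_exists LM_eq_SomeD is_lm_MM rep_def)

lemma lm_dvd_iff: "lm_dvd (Some Q) (Some P) \<longleftrightarrow> (\<exists>x. P = shift x Q)"
  by (cases P, cases Q) (auto simp: lm_dvd_def shift_def)

lemma lm_dvd_Some: "lm_dvd M (Some P) \<longleftrightarrow> (\<exists>Q x. M = Some Q \<and> P = shift x Q)"
  by (cases M) (simp_all add: lm_dvd_iff, simp add: lm_dvd_def)

lemma rep_scale:
  assumes "emb w * c = emb a" "w \<in> U" "a \<in> Rx m n" "rep v F u"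
  shows "rep (c *s v) (\<lambda>i. a * F i) (w * u)"
proof -
  have "emb (w * u) * (c *s v) $ i = emb (a * F i)" for i
  proof -
    have "emb (w * u) * (c *s v) $ i = (emb w * c) * (emb u * v $ i)" by (simp add: emb_mult mult_ac)
    then show ?thesis by (simp add: assms(1) rep_D(3)[OF assms(4)] emb_mult)
  qed
  then show ?thesis using U_mult[OF assms(2) rep_D(2)[OF assms(4)]] V_mult[OF assms(3) rep_D(1)[OF assms(4)]]
    unfolding rep_def by blast
qed

text \<open>The leading monomial of \<open>c\<close> itself is the quotient.\<close>

lemma LM_scale:
  assumes "c \<in> Loc" "v \<in> LocV" "LM (c *s v) = Some P"
  shows "lm_dvd (LM v) (Some P)"
proof -
  obtain a w where a: "a \<in> Rx m n" "w \<in> U" "c = emb a / emb w" using assms(1) unfolding Loc_iff by blast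
  have wc: "emb w * c = emb a" using a(3) U_nonzero[OF a(2)] by simp
  obtain F u where F: "rep v F u" using rep_exists[OF assms(2)] by blast
  have FV: "F \<in> V" using F by (simp add: rep_def)
  have P: "is_lm P (\<lambda>i. a * F i)" using LM_eq_SomeD[OF rep_scale[OF wc a(2,1) F] assms(3)] .
  obtain y T where yT: "rx_coeff a y \<noteq> 0" "vc F T \<noteq> 0"
    using is_lm_D(1)[OF P] by (rule vc_mult_nonzero)
  obtain x where x: "rx_coeff a x \<noteq> 0" "mbelow x a"
    by (rule exists_leading_ring[OF UNIV_I a(1) yT(1)])
  obtain Q where Q: "is_lm Q F" using exists_lm[OF FV yT(2)] .
  have "P = shift x Q"
    using is_lm_unique[OF P is_lm_mult(2)[OF a(1) x FV Q] V_mult[OF a(1) FV]] .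
  then show ?thesis using LM_LC_eq(1)[OF F Q] by (auto simp: lm_dvd_Some)
qed

lemma rep_sum:
  assumes "\<And>x. x \<in> A \<Longrightarrow> rep (v x) (F x) u" "u \<in> U"
  shows "rep (\<Sum>x\<in>A. v x) (\<lambda>i. \<Sum>x\<in>A. F x i) u"
proof -
  have "emb u * (\<Sum>x\<in>A. v x) $ i = emb (\<Sum>x\<in>A. F x i)" for i
    using assms by (simp add: sum_component sum_distrib_left emb_sum rep_def)
  then show ?thesis using assms V_sum[of A F] by (simp add: rep_def)
qed

end


section \<open>Submodules and monomial submodules\<close>

lemma is_submodule_hull: "is_submodule A (is_submodule A hull B)"
  by (rule hull_in) (auto simp: is_submodule_def)

lemma generated_superset: "B \<subseteq> generated A B"
  unfolding generated_def by (rule hull_subset)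

lemma generated_least: "B \<subseteq> M \<Longrightarrow> is_submodule A M \<Longrightarrow> generated A B \<subseteq> M"
  unfolding generated_def by (rule hull_minimal)

lemma generated_submodule: "is_submodule A (generated A B)"
  unfolding generated_def by (rule is_submodule_hull)

lemma submodule_sum:
  assumes "is_submodule A M" "\<And>x. x \<in> S \<Longrightarrow> v x \<in> M"
  shows "sum v S \<in> M"
  using assms(2) by (induction S rule: infinite_finite_induct) (use assms(1) in \<open>auto simp: is_submodule_def\<close>)

lemma submodule_scale: "is_submodule A M \<Longrightarrow> c \<in> A \<Longrightarrow> v \<in> M \<Longrightarrow> c *s v \<in> M"
  unfolding is_submodule_def by blast

lemma submodule_add: "is_submodule A M \<Longrightarrow> v \<in> M \<Longrightarrow> w \<in> M \<Longrightarrow> v + w \<in> M"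
  unfolding is_submodule_def by blast

text \<open>A monomial lies in a module generated by monomials only if one of these divides it.\<close>

lemma generated_monomials_keys:
  fixes M :: "'s::finite mmon option set"
  assumes "v \<in> generated (Ktx m n) ((mon_vec :: _ \<Rightarrow> 'k::field ktx ^ 's) ` M)"
    and "p \<in> Poly_Mapping.keys (v $ i)"
  shows "\<exists>P\<in>M. lm_dvd P (Some (p, i))"
proof -
  define T where "T = {v :: 'k ktx ^ 's. \<forall>i. \<forall>p\<in>Poly_Mapping.keys (v $ i). \<exists>P\<in>M. lm_dvd P (Some (p, i))}"
  have "mon_vec ` M \<subseteq> T"
  proof
    fix w :: "'k ktx ^ 's" assume "w \<in> mon_vec ` M"
    then obtain P where P: "P \<in> M" "w = mon_vec P" by blast
    have "\<exists>P\<in>M. lm_dvd P (Some (p, i))" if p: "p \<in> Poly_Mapping.keys (w $ i)" for p i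
    proof (cases P)
      case None
      then show ?thesis using p by (simp add: P mon_vec_def)
    next
      case (Some Q)
      obtain q j where Q: "Q = (q, j)" by (cases Q)
      have "p = q" "i = j" using p by (auto simp: P Some Q mon_vec_def axis_def split: if_splits)
      then have "lm_dvd P (Some (p, i))" unfolding lm_dvd_def Some Q by (intro exI[of _ q] exI[of _ j] exI[of _ 0]) simp
      then show ?thesis using P by blast
    qed
    then show "w \<in> T" unfolding T_def by blast
  qed
  moreover have "is_submodule (Ktx m n) T"
    unfolding is_submodule_def
  proof (intro conjI ballI)
    show "0 \<in> T" by (simp add: T_def)
    fix v w assume vw: "v \<in> T" "w \<in> T"
    have "Poly_Mapping.keys ((v + w) $ i) \<subseteq> Poly_Mapping.keys (v $ i) \<union> Poly_Mapping.keys (w $ i)" for i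
      using Poly_Mapping.keys_add[of "v $ i" "w $ i"] by simp
    then show "v + w \<in> T" using vw unfolding T_def by blast
  next
    fix c :: "'k ktx" and v assume v: "v \<in> T"
    have "\<exists>P\<in>M. lm_dvd P (Some (p, i))" if p: "p \<in> Poly_Mapping.keys ((c *s v) $ i)" for p i
    proof -
      obtain a b where ab: "p = a + b" "b \<in> Poly_Mapping.keys (v $ i)"
        using p Poly_Mapping.keys_mult[of c "v $ i"] by auto
      then obtain P where P: "P \<in> M" "lm_dvd P (Some (b, i))" using v unfolding T_def by blast
      then obtain r q where "P = Some (r, i)" "b = q + r" unfolding lm_dvd_def by auto
      then have "lm_dvd P (Some (p, i))"
        unfolding lm_dvd_def ab(1) by (intro exI[of _ r] exI[of _ i] exI[of _ "a + q"]) (simp add: add.assoc)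
      then show ?thesis using P(1) by blast
    qed
    then show "c *s v \<in> T" unfolding T_def by blast
  qed
  ultimately have "v \<in> T" using generated_least assms(1) by blast
  then show ?thesis using assms(2) unfolding T_def by blast
qed


section \<open>The equivalences\<close>

context local_ordering
begin

text \<open>The form of condition (a) to which the other conditions are compared.\<close>

lemma standard_basis_iff:
  fixes J G :: "('k::field rx fract ^ 's) set"
  assumes J: "J \<subseteq> LocV" and G: "finite G" "G \<subseteq> J"
  shows "standard_basis m n gt J G \<longleftrightarrow> (\<forall>f\<in>J. f \<noteq> 0 \<longrightarrow> (\<exists>g\<in>G. lm_dvd (LM g) (LM f)))"
proof -
  let ?mv = "\<lambda>g. mon_vec (LM g) :: 'k ktx ^ 's"
  have img: "?mv ` H = mon_vec ` (LM ` H)" for H :: "('k rx fract ^ 's) set"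
    by (rule image_image[symmetric])
  have "\<forall>f\<in>J. f \<noteq> 0 \<longrightarrow> (\<exists>g\<in>G. lm_dvd (LM g) (LM f))" if sb: "standard_basis m n gt J G"
  proof (intro ballI impI)
    fix f assume f: "f \<in> J" "f \<noteq> 0"
    then obtain P where P: "LM f = Some P" using LM_nonzero J by blast
    obtain p i where pi: "P = (p, i)" by (cases P)
    have "?mv f \<in> lead_module m n gt J"
      unfolding lead_module_def by (rule subsetD[OF generated_superset imageI[OF f(1)]])
    then have "?mv f \<in> generated (Ktx m n) (mon_vec ` (LM ` G))"
      using sb unfolding standard_basis_def lead_module_def img by simp
    moreover have "p \<in> Poly_Mapping.keys (?mv f $ i)" by (simp add: P pi mon_vec_def axis_def)
    ultimately have "\<exists>M\<in>LM ` G. lm_dvd M (Some (p, i))" by (rule generated_monomials_keys)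
    then show "\<exists>g\<in>G. lm_dvd (LM g) (LM f)" by (simp add: P pi)
  qed
  moreover have "standard_basis m n gt J G"
    if dv: "\<forall>f\<in>J. f \<noteq> 0 \<longrightarrow> (\<exists>g\<in>G. lm_dvd (LM g) (LM f))"
  proof -
    have "?mv f \<in> lead_module m n gt G" if f: "f \<in> J" for f
    proof (cases "f = 0")
      case True
      then show ?thesis using generated_submodule[of "Ktx m n" "?mv ` G"]
        by (simp add: lead_module_def is_submodule_def mon_vec_def)
    next
      case False
      then obtain g where g: "g \<in> G" "lm_dvd (LM g) (LM f)" using dv f by blast
      then obtain p i q where pq: "LM g = Some (p, i)" "LM f = Some (q + p, i)" unfolding lm_dvd_def by blast
      have "q + p \<in> mons m n" using LM_MM[of f "(q + p, i)"] f J pq(2) by auto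
      then have "Poly_Mapping.single q 1 \<in> Ktx m n" by (simp add: Ktx_def mons_add_iff)
      moreover have "?mv g \<in> lead_module m n gt G"
        unfolding lead_module_def by (rule subsetD[OF generated_superset imageI[OF g(1)]])
      ultimately have "Poly_Mapping.single q 1 *s ?mv g \<in> lead_module m n gt G"
        unfolding lead_module_def by (rule submodule_scale[OF generated_submodule])
      moreover have "Poly_Mapping.single q 1 *s ?mv g = ?mv f"
        by (simp add: pq mon_vec_def vec_eq_iff axis_def Poly_Mapping.mult_single)
      ultimately show ?thesis by simp
    qed
    then have "lead_module m n gt J \<subseteq> lead_module m n gt G"
      unfolding lead_module_def[of m n gt J]
      by (intro generated_least) (auto simp: lead_module_def intro: generated_submodule)
    moreover have "lead_module m n gt G \<subseteq> lead_module m n gt J"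
      unfolding lead_module_def[of m n gt G]
    proof (rule generated_least)
      show "?mv ` G \<subseteq> lead_module m n gt J"
        unfolding lead_module_def by (rule subset_trans[OF image_mono[OF G(2)] generated_superset])
    qed (simp add: lead_module_def generated_submodule)
    ultimately show ?thesis using G unfolding standard_basis_def by blast
  qed
  ultimately show ?thesis by blast
qed

lemma standard_repr_iff:
  "standard_repr m n gt k g f \<longleftrightarrow> (\<exists>q. (\<forall>i<k. q i \<in> Loc) \<and> f = (\<Sum>i<k. q i *s g i) \<and>
     (\<forall>i<k. lm_ge gt (LM f) (LM (q i *s g i))))"
  unfolding standard_repr_def division_def by simp

lemma lm_ge_Some: "lm_ge gt (Some P) (Some Q) \<longleftrightarrow> ge P Q"
  by (simp add: lm_ge_def ge_def)

lemma lm_ge_None: "lm_ge gt M None"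
  by (simp add: lm_ge_def split: option.splits)

text \<open>In a standard representation some product \<open>q i *s g i\<close> must contribute the leading monomial.\<close>

lemma standard_repr_imp_lm_dvd:
  assumes g: "\<And>i. i < k \<Longrightarrow> g i \<in> LocV" and f: "standard_repr m n gt k g f" "f \<noteq> 0"
  shows "\<exists>i<k. lm_dvd (LM (g i)) (LM f)"
proof -
  obtain q where q: "\<And>i. i < k \<Longrightarrow> q i \<in> Loc" and f_eq: "f = (\<Sum>i<k. q i *s g i)" and
    q_ge: "\<And>i. i < k \<Longrightarrow> lm_ge gt (LM f) (LM (q i *s g i))"
    using f(1) unfolding standard_repr_iff by blast
  have "\<forall>i\<in>{..<k}. q i *s g i \<in> LocV" by (auto intro!: LocV_scale q g)
  from common_rep[OF finite_lessThan this]
  obtain u F where u: "u \<in> U" and F: "\<And>i. i \<in> {..<k} \<Longrightarrow> rep (q i *s g i) (F i) u" by blast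
  have f_rep: "rep f (\<lambda>c. \<Sum>i<k. F i c) u" unfolding f_eq by (rule rep_sum[OF F u])
  obtain P where P: "is_lm P (\<lambda>c. \<Sum>i<k. F i c)"
    using zero_or_is_lm[OF rep_D(1)[OF f_rep]] rep_zero_iff[OF f_rep] f(2) by blast
  have LMf: "LM f = Some P" by (rule LM_LC_eq(1)[OF f_rep P])
  have "(\<Sum>i<k. vc (F i) P) \<noteq> 0" using is_lm_D(1)[OF P] by (simp add: vc_eq rx_coeff_sum)
  then obtain i where i: "i < k" "vc (F i) P \<noteq> 0"
    by (metis (no_types, lifting) lessThan_iff sum.neutral)
  have Fi: "rep (q i *s g i) (F i) u" using F i(1) by simp
  obtain Q where Q: "is_lm Q (F i)" using exists_lm[OF rep_D(1)[OF Fi] i(2)] .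
  have LMq: "LM (q i *s g i) = Some Q" by (rule LM_LC_eq(1)[OF Fi Q])
  have "ge P Q" using q_ge[OF i(1)] by (simp add: LMf LMq lm_ge_Some)
  moreover have "ge Q P" by (rule below_D[OF is_lm_D(2)[OF Q] i(2)])
  ultimately have "P = Q"
    using ge_antisym is_lm_MM[OF P rep_D(1)[OF f_rep]] is_lm_MM[OF Q rep_D(1)[OF Fi]] by blast
  then have "lm_dvd (LM (g i)) (LM f)"
    using LM_scale[OF q[OF i(1)] g[OF i(1)] LMq] by (simp add: LMf)
  then show ?thesis using i(1) by blast
qed

text \<open>
  The remainder \<open>r\<close> of a division of \<open>f\<close> lies in \<open>J\<close> as well; were it not zero, its leading monomial would be divisible by
  one of those of the \<open>g i\<close>.  Zero members of the family, which have no leading monomial, take no part in the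
  division and get the coefficient \<open>0\<close>.
\<close>

lemma lm_dvd_imp_standard_repr:
  assumes J: "J \<subseteq> LocV" "is_submodule Loc J" and g: "\<And>i. i < k \<Longrightarrow> g i \<in> J"
    and dv: "\<And>f. f \<in> J \<Longrightarrow> f \<noteq> 0 \<Longrightarrow> \<exists>i<k. lm_dvd (LM (g i)) (LM f)"
    and f: "f \<in> J"
  shows "standard_repr m n gt k g f"
proof (cases "f = 0")
  case True
  then show ?thesis unfolding standard_repr_iff by (intro exI[of _ "\<lambda>_. 0"]) (simp add: lm_ge_None)
next
  case False
  define v where "v i = (if i < k then g i else f)" for i
  have "\<forall>i\<in>{..k}. v i \<in> LocV" using f g J(1) by (auto simp: v_def)
  from common_rep[OF finite_atMost this]
  obtain u H where u: "u \<in> U" and H: "\<And>i. i \<in> {..k} \<Longrightarrow> rep (v i) (H i) u" by blast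
  have Hg: "rep (g i) (H i) u" if "i < k" for i using H[of i] that by (simp add: v_def)
  have Hf: "rep f (H k) u" using H[of k] by (simp add: v_def)
  define L where "L = {i. i < k \<and> g i \<noteq> 0}"
  have L: "finite L" "L \<subseteq> {..<k}" by (auto simp: L_def)
  have HgV: "H l \<in> V" if "l \<in> L" for l using rep_D(1)[OF Hg] that by (simp add: L_def)
  have Hlm: "is_lm (lmv (H l)) (H l)" if l: "l \<in> L" for l
    using zero_or_is_lm[OF HgV[OF l]] rep_zero_iff[OF Hg, of l] l lmv by (auto simp: L_def)
  obtain P0 where P0: "is_lm P0 (H k)"
    using zero_or_is_lm[OF rep_D(1)[OF Hf]] rep_zero_iff[OF Hf] False by blast
  obtain w q r where w: "w \<in> U" and q: "\<And>l. l \<in> L \<Longrightarrow> q l \<in> Rx m n" and r: "r \<in> V" and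
    eq: "\<And>c. w * H k c = (\<Sum>l\<in>L. q l * H l c) + r c" and
    qb: "\<And>l. l \<in> L \<Longrightarrow> below P0 (\<lambda>c. q l * H l c)" and
    irred: "\<And>Q l x. is_lm Q r \<Longrightarrow> l \<in> L \<Longrightarrow> Q \<noteq> shift x (lmv (H l))"
    by (rule weak_division[of L H "\<lambda>l. lmv (H l)" "H k" P0, OF L(1) HgV Hlm rep_D(1)[OF Hf] P0])
      (assumption, assumption, rule that)
  have uJ: "emb a *s v \<in> J" if "v \<in> J" "a \<in> Rx m n" for a v
    by (rule submodule_scale[OF J(2) emb_Loc that(1)]) (rule that)
  have r_eq: "vemb r = emb (w * u) *s f + (\<Sum>l\<in>L. emb (- (q l * u)) *s g l)"
  proof (subst vec_eq_iff, rule allI)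
    fix c
    have "emb (w * u) * f $ c = emb (w * H k c)"
      using rep_D(3)[OF Hf, of c] by (simp add: emb_mult mult.assoc)
    moreover have "emb (- (q l * u)) * g l $ c = - emb (q l * H l c)" if "l \<in> L" for l
      using rep_D(3)[OF Hg, of l c] that by (simp add: L_def emb_mult emb_uminus mult.assoc)
    ultimately have "(emb (w * u) *s f + (\<Sum>l\<in>L. emb (- (q l * u)) *s g l)) $ c =
        emb (w * H k c) - (\<Sum>l\<in>L. emb (q l * H l c))"
      by (simp add: sum_component sum_negf)
    also have "\<dots> = emb (r c)" by (simp add: eq emb_add emb_sum)
    finally show "vemb r $ c = (emb (w * u) *s f + (\<Sum>l\<in>L. emb (- (q l * u)) *s g l)) $ c" by simp
  qed
  have rJ: "vemb r \<in> J"
    unfolding r_eq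
  proof (intro submodule_add[OF J(2)] submodule_sum[OF J(2)] uJ f)
    show "w * u \<in> Rx m n" using Rx_mult U_Rx u w by blast
    fix l assume l: "l \<in> L"
    show "g l \<in> J" using g l by (simp add: L_def)
    show "- (q l * u) \<in> Rx m n" using Rx_uminus Rx_mult U_Rx u q[OF l] by blast
  qed
  have r_rep: "rep (vemb r) r 1" using r by (simp add: rep_def one_U)
  have r0: "r c = 0" for c
  proof (rule ccontr)
    assume "r c \<noteq> 0"
    then obtain Q where Q: "is_lm Q r" using zero_or_is_lm[OF r] by blast
    then have LMr: "LM (vemb r) = Some Q" by (rule LM_LC_eq(1)[OF r_rep])
    then have "vemb r \<noteq> 0" by auto
    then obtain i where i: "i < k" "lm_dvd (LM (g i)) (Some Q)" using dv[OF rJ] by (auto simp: LMr)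
    then obtain T x where T: "LM (g i) = Some T" "Q = shift x T" unfolding lm_dvd_Some by blast
    then have iL: "i \<in> L" using i(1) by (auto simp: L_def)
    have "T = lmv (H i)" using LM_LC_eq(1)[OF Hg[OF i(1)] Hlm[OF iL]] T(1) by simp
    then show False using irred[OF Q iL, of x] T(2) by simp
  qed
  define q' where "q' i = (if i \<in> L then emb (q i) / emb w else 0)" for i
  have w0: "emb w \<noteq> 0" "emb u \<noteq> 0" using U_nonzero[OF w] U_nonzero[OF u] by simp_all
  show ?thesis
    unfolding standard_repr_iff
  proof (intro exI[of _ q'] conjI allI impI)
    show "q' i \<in> Loc" for i using LocI[OF q w] by (simp add: q'_def)
    show "f = (\<Sum>i<k. q' i *s g i)"
    proof (subst vec_eq_iff, rule allI)
      fix c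
      have "emb (w * u) * (\<Sum>i<k. q' i *s g i) $ c = (\<Sum>i<k. emb (w * u) * (q' i * g i $ c))"
        by (simp add: sum_component sum_distrib_left)
      also have "\<dots> = (\<Sum>i\<in>L. emb (w * u) * (q' i * g i $ c))"
        by (rule sum.mono_neutral_right) (use L in \<open>auto simp: q'_def\<close>)
      also have "\<dots> = (\<Sum>i\<in>L. emb (q i * H i c))"
      proof (rule sum.cong[OF refl])
        fix i assume i: "i \<in> L"
        have "emb (w * u) * (q' i * g i $ c) = emb (q i) * (emb u * g i $ c)"
          using w0 i by (simp add: q'_def emb_mult)
        also have "emb u * g i $ c = emb (H i c)" by (rule rep_D(3)[OF Hg]) (use i in \<open>simp add: L_def\<close>)
        finally show "emb (w * u) * (q' i * g i $ c) = emb (q i * H i c)" by (simp add: emb_mult)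
      qed
      also have "\<dots> = emb (w * H k c)" by (simp add: eq r0 emb_sum)
      also have "\<dots> = emb (w * u) * f $ c"
        using rep_D(3)[OF Hf, of c] by (simp add: emb_mult mult.assoc)
      finally show "f $ c = (\<Sum>i<k. q' i *s g i) $ c" using w0 by (simp add: emb_mult)
    qed
    fix i assume i: "i < k"
    have LMf: "LM f = Some P0" by (rule LM_LC_eq(1)[OF Hf P0])
    show "lm_ge gt (LM f) (LM (q' i *s g i))"
    proof (cases "LM (q' i *s g i)")
      case None
      then show ?thesis by (simp add: lm_ge_None)
    next
      case (Some P)
      then have iL: "i \<in> L" by (cases "i \<in> L") (auto simp: q'_def)
      have "rep (q' i *s g i) (\<lambda>c. q i * H i c) (w * u)"
        by (rule rep_scale[OF _ w q[OF iL] Hg[OF i]]) (use w0 iL in \<open>simp add: q'_def\<close>)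
      from is_lm_D(1)[OF LM_eq_SomeD[OF this Some]]
      have "ge P0 P" by (rule below_D[OF qb[OF iL]])
      then show ?thesis by (simp add: LMf Some lm_ge_Some)
    qed
  qed
qed

text \<open>The combinations form a submodule that contains the generators.\<close>

lemma generated_combination:
  fixes g :: "nat \<Rightarrow> 'k::field rx fract ^ 's"
  assumes "f \<in> generated Loc (g ` {..<k})"
  obtains q where "\<And>i. i < k \<Longrightarrow> q i \<in> Loc" "f = (\<Sum>i<k::nat. q i *s g i)"
proof -
  define T where "T = {f. \<exists>q. (\<forall>i<k. q i \<in> Loc) \<and> f = (\<Sum>i<k. q i *s g i)}"
  have "g ` {..<k} \<subseteq> T"
  proof
    fix v assume "v \<in> g ` {..<k}"
    then obtain j where j: "j < k" "v = g j" by blast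
    have "(\<Sum>i<k. (if i = j then 1 else 0) *s g i) = (\<Sum>i<k. if i = j then g i else 0)"
      by (rule sum.cong) auto
    also have "\<dots> = g j" using j by simp
    finally have "v = (\<Sum>i<k. (if i = j then 1 else 0) *s g i)" using j by simp
    moreover have "(1 :: 'k rx fract) \<in> Loc" using emb_Loc[OF Rx_one] by simp
    ultimately show "v \<in> T" unfolding T_def by (intro CollectI exI[of _ "\<lambda>i. if i = j then 1 else 0"]) simp
  qed
  moreover have "is_submodule Loc T"
    unfolding is_submodule_def
  proof (intro conjI ballI)
    show "0 \<in> T" unfolding T_def by (intro CollectI exI[of _ "\<lambda>_. 0"]) simp
  next
    fix v w assume "v \<in> T" "w \<in> T"
    then obtain q q' where "\<forall>i<k. q i \<in> Loc" "v = (\<Sum>i<k. q i *s g i)"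
      "\<forall>i<k. q' i \<in> Loc" "w = (\<Sum>i<k. q' i *s g i)" unfolding T_def by blast
    then show "v + w \<in> T" unfolding T_def
      by (intro CollectI exI[of _ "\<lambda>i. q i + q' i"])
        (simp add: Loc_add sum.distrib vector_sadd_rdistrib)
  next
    fix c :: "'k rx fract" and v assume "c \<in> Loc" "v \<in> T"
    then obtain q where "\<forall>i<k. q i \<in> Loc" "v = (\<Sum>i<k. q i *s g i)" unfolding T_def by blast
    then show "c *s v \<in> T" using \<open>c \<in> Loc\<close> unfolding T_def
      by (intro CollectI exI[of _ "\<lambda>i. c * q i"])
        (simp add: Loc_mult vec_eq_iff sum_component sum_distrib_left mult.assoc)
  qed
  ultimately have "f \<in> T" using generated_least assms by blast
  then show ?thesis using that unfolding T_def by blast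
qed


lemma term_loc_eq_emb: "term_loc c p = emb (rx_term c p)"
  by (simp add: term_loc_def emb_def)

lemma spoly_eq:
  assumes "LM f = Some (p, i)" "LM g = Some (q, i)"
  shows "spoly m n gt f g = emb (rx_term (1 / LC f) (mon_lcm p q - p)) *s f -
     emb (rx_term (1 / LC g) (mon_lcm p q - q)) *s g"
  using assms by (simp add: spoly_def term_loc_eq_emb)

lemma spoly_in_submodule:
  assumes J: "J \<subseteq> LocV" "is_submodule Loc J" and fg: "f \<in> J" "g \<in> J"
  shows "spoly m n gt f g \<in> J"
proof (cases "\<exists>p q i. LM f = Some (p, i) \<and> LM g = Some (q, i)")
  case False
  then have "spoly m n gt f g = 0" by (auto simp: spoly_def split: option.splits)
  then show ?thesis using J(2) by (simp add: is_submodule_def)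
next
  case True
  then obtain p q i where pq: "LM f = Some (p, i)" "LM g = Some (q, i)" by blast
  have "p \<in> mons m n" "q \<in> mons m n" using LM_MM[OF _ pq(1)] LM_MM[OF _ pq(2)] J fg by auto
  note M = mon_lcm_quotients_mons[OF this]
  have eq: "spoly m n gt f g = emb (rx_term (1 / LC f) (mon_lcm p q - p)) *s f +
     emb (- rx_term (1 / LC g) (mon_lcm p q - q)) *s g"
    unfolding spoly_eq[OF pq] by (simp add: vec_eq_iff emb_uminus)
  show ?thesis
    unfolding eq
    by (intro submodule_add[OF J(2)] submodule_scale[OF J(2)] emb_Loc Rx_uminus Rx_term M fg)
qed

lemma is_lm_term_mult:
  assumes "F \<in> V" "is_lm P F" "x \<in> mons m n" "c \<noteq> 0"
  shows "is_lm (shift x P) (\<lambda>i. rx_term c x * F i)" "vc (\<lambda>i. rx_term c x * F i) (shift x P) = c * vc F P"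
proof -
  have "mbelow x (rx_term c x)" by (simp add: mbelow_def rx_coeff_term moge_def)
  moreover have "rx_coeff (rx_term c x) x = c" by (simp add: rx_coeff_term)
  ultimately show "is_lm (shift x P) (\<lambda>i. rx_term c x * F i)"
    "vc (\<lambda>i. rx_term c x * F i) (shift x P) = c * vc F P"
    using is_lm_mult[OF Rx_term[OF assms(3)], of c x F P] assms by auto
qed

text \<open>Both terms of an s-polynomial have the leading coefficient \<open>1\<close> at the least common multiple, where they cancel.\<close>

lemma spoly_below_lcm:
  assumes F: "F \<in> V" "is_lm P F" and G: "G \<in> V" "is_lm Q G" and same: "snd P = snd Q"
    and R: "vc (\<lambda>i. rx_term (1 / vc F P) (mon_lcm (fst P) (fst Q) - fst P) * F i -
      rx_term (1 / vc G Q) (mon_lcm (fst P) (fst Q) - fst Q) * G i) R \<noteq> 0"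
  shows "gt (mon_lcm (fst P) (fst Q), snd P) R"
proof -
  let ?l = "(mon_lcm (fst P) (fst Q), snd P)"
  let ?f = "\<lambda>i. rx_term (1 / vc F P) (mon_lcm (fst P) (fst Q) - fst P) * F i"
  let ?g = "\<lambda>i. rx_term (1 / vc G Q) (mon_lcm (fst P) (fst Q) - fst Q) * G i"
  have "P \<in> MM" "Q \<in> MM" using is_lm_MM F G by blast+
  then have M: "mon_lcm (fst P) (fst Q) - fst P \<in> mons m n" "mon_lcm (fst P) (fst Q) - fst Q \<in> mons m n"
    using mon_lcm_quotients_mons[of "fst P" m n "fst Q"] by auto
  have l: "shift (mon_lcm (fst P) (fst Q) - fst P) P = ?l" "shift (mon_lcm (fst P) (fst Q) - fst Q) Q = ?l"
    using same by (simp_all add: shift_def mon_lcm_left mon_lcm_right)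
  have f: "is_lm ?l ?f" "vc ?f ?l = 1"
    using is_lm_term_mult[OF F M(1), of "1 / vc F P"] is_lm_D(1)[OF F(2)] by (simp_all only: l) simp_all
  have g: "is_lm ?l ?g" "vc ?g ?l = 1"
    using is_lm_term_mult[OF G M(2), of "1 / vc G Q"] is_lm_D(1)[OF G(2)] by (simp_all only: l) simp_all
  have "vc (\<lambda>i. ?f i - ?g i) ?l = vc ?f ?l - vc ?g ?l" by (simp add: vc_eq rx_coeff_diff)
  then have "R \<noteq> ?l" using f(2) g(2) R by auto
  moreover have "ge ?l R"
    using below_D[OF below_diff[OF is_lm_D(2)[OF f(1)] is_lm_D(2)[OF g(1)]] R] .
  ultimately show ?thesis by (simp add: ge_def)
qed

text \<open>
  All data are brought over common denominators, which are in $S_>$ and so affect neither leading monomials nor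
  membership; then \<open>buchberger_over_Rx\<close> applies to the numerators of the non-zero \<open>g i\<close>.
\<close>

lemma buchberger_criterion:
  fixes g :: "nat \<Rightarrow> 'k::field rx fract ^ 's"
  assumes g: "\<And>i. i < k \<Longrightarrow> g i \<in> LocV"
    and sp: "\<And>i j. i < j \<Longrightarrow> j < k \<Longrightarrow> standard_repr m n gt k g (spoly m n gt (g i) (g j))"
    and f: "f \<in> generated Loc (g ` {..<k})" "f \<noteq> 0"
  shows "\<exists>i<k. lm_dvd (LM (g i)) (LM f)"
proof -
  have "\<forall>i\<in>{..<k}. g i \<in> LocV" using g by simp
  from common_rep[OF finite_lessThan this]
  obtain u G where u: "u \<in> U" and G_all: "\<forall>i\<in>{..<k}. rep (g i) (G i) u" by blast
  have G: "rep (g i) (G i) u" if "i < k" for i using G_all that by simp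
  define L where "L = {i. i < k \<and> g i \<noteq> 0}"
  have L: "finite L" "L \<subseteq> {..<k}" by (auto simp: L_def)
  have GV: "G l \<in> V" if "l \<in> L" for l using rep_D(1)[OF G] that by (simp add: L_def)
  have Glm: "is_lm (lmv (G l)) (G l)" if l: "l \<in> L" for l
    using zero_or_is_lm[OF GV[OF l]] rep_zero_iff[OF G, of l] l lmv by (auto simp: L_def)
  have LMg: "LM (g l) = Some (lmv (G l))" "LC (g l) = vc (G l) (lmv (G l))" if "l \<in> L" for l
    using LM_LC_eq[OF G Glm[OF that]] that by (simp_all add: L_def)
  have G0: "G l c = 0" if "l < k" "l \<notin> L" for l c
    using rep_zero_iff[OF G[OF that(1)]] that by (auto simp: L_def)
  have scalars: "\<exists>w b. w \<in> U \<and> (\<forall>l<k. b l \<in> Rx m n \<and> emb w * q l = emb (b l))"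
    if "\<forall>l<k. q l \<in> Loc" for q :: "nat \<Rightarrow> 'k rx fract"
    using common_denominator[of "{..<k}" q] that by (simp add: Ball_def)
  have expand: "emb (w * u) * (\<Sum>l<k. q l *s g l) $ c = emb (\<Sum>l\<in>L. b l * G l c)"
    if b: "\<forall>l<k. b l \<in> Rx m n \<and> emb w * q l = emb (b l)" for w b q c
  proof -
    have "emb (w * u) * (\<Sum>l<k. q l *s g l) $ c = (\<Sum>l<k. (emb w * q l) * (emb u * g l $ c))"
      by (simp add: sum_component sum_distrib_left emb_mult mult_ac)
    also have "\<dots> = (\<Sum>l<k. emb (b l * G l c))"
      by (rule sum.cong[OF refl]) (use b rep_D(3)[OF G] in \<open>simp add: emb_mult\<close>)
    also have "\<dots> = (\<Sum>l\<in>L. emb (b l * G l c))"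
      by (rule sum.mono_neutral_right) (use L G0 in auto)
    finally show ?thesis by (simp add: emb_sum)
  qed
  obtain q where q: "\<forall>i<k. q i \<in> Loc" and f_eq: "f = (\<Sum>i<k. q i *s g i)"
    using generated_combination[OF f(1)] by metis
  obtain w a where w: "w \<in> U" and a: "\<forall>l<k. a l \<in> Rx m n \<and> emb w * q l = emb (a l)"
    using scalars[OF q] by blast
  have aR: "a l \<in> Rx m n" if "l \<in> L" for l using a that by (simp add: L_def)
  have f_rep: "rep f (\<lambda>c. \<Sum>l\<in>L. a l * G l c) (w * u)"
    unfolding rep_def
  proof (intro conjI allI)
    show "(\<lambda>c. \<Sum>l\<in>L. a l * G l c) \<in> V" by (intro V_sum V_mult aR GV)
    show "w * u \<in> U" using w u by (rule U_mult)
    show "emb (w * u) * f $ c = emb (\<Sum>l\<in>L. a l * G l c)" for c unfolding f_eq by (rule expand[OF a])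
  qed
  obtain P where P: "is_lm P (\<lambda>c. \<Sum>l\<in>L. a l * G l c)"
    using zero_or_is_lm[OF rep_D(1)[OF f_rep]] rep_zero_iff[OF f_rep] f(2) by blast
  have "\<exists>l\<in>L. \<exists>x. P = shift x (lmv (G l))"
  proof (rule buchberger_over_Rx[of L G "\<lambda>l. lmv (G l)" a "\<lambda>c. \<Sum>l\<in>L. a l * G l c" P])
    fix i j assume ij: "i \<in> L" "j \<in> L" "i < j" and same: "snd (lmv (G i)) = snd (lmv (G j))"
    define l where "l = mon_lcm (fst (lmv (G i))) (fst (lmv (G j)))"
    define S where "S c = rx_term (1 / vc (G i) (lmv (G i))) (l - fst (lmv (G i))) * G i c -
        rx_term (1 / vc (G j) (lmv (G j))) (l - fst (lmv (G j))) * G j c" for c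
    have ijk: "i < k" "j < k" using ij by (auto simp: L_def)
    have M: "lmv (G i) \<in> MM" "lmv (G j) \<in> MM" using is_lm_MM[OF Glm GV] ij by blast+
    have Q: "l - fst (lmv (G i)) \<in> mons m n" "l - fst (lmv (G j)) \<in> mons m n"
      unfolding l_def using mon_lcm_quotients_mons[of "fst (lmv (G i))" m n "fst (lmv (G j))"] M by auto
    have S_below: "gt (l, snd (lmv (G i))) R" if "vc S R \<noteq> 0" for R
      using spoly_below_lcm[OF GV[OF ij(1)] Glm[OF ij(1)] GV[OF ij(2)] Glm[OF ij(2)] same, of R] that
      unfolding S_def[abs_def] l_def by blast
    have SV: "S \<in> V" unfolding S_def[abs_def] by (intro V_diff V_mult Rx_term Q GV ij)
    let ?sp = "spoly m n gt (g i) (g j)"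
    have sp_eq: "?sp = emb (rx_term (1 / vc (G i) (lmv (G i))) (l - fst (lmv (G i)))) *s g i -
        emb (rx_term (1 / vc (G j) (lmv (G j))) (l - fst (lmv (G j)))) *s g j"
      unfolding l_def LMg(2)[OF ij(1), symmetric] LMg(2)[OF ij(2), symmetric]
      by (rule spoly_eq[of _ _ "snd (lmv (G i))"]) (use LMg(1) ij same in \<open>auto simp: prod_eq_iff\<close>)
    have u_sp: "emb u * ?sp $ c = emb (S c)" for c
      unfolding sp_eq S_def emb_diff emb_mult rep_D(3)[OF G[OF ijk(1)], of c, symmetric]
        rep_D(3)[OF G[OF ijk(2)], of c, symmetric]
      by (simp add: algebra_simps)
    have sp_rep: "rep ?sp S u" using SV u u_sp by (simp add: rep_def)
    obtain p where p: "\<forall>l<k. p l \<in> Loc" and p_eq: "?sp = (\<Sum>l<k. p l *s g l)" and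
      p_ge: "\<And>l. l < k \<Longrightarrow> lm_ge gt (LM ?sp) (LM (p l *s g l))"
      using sp[OF ij(3) ijk(2)] unfolding standard_repr_iff by blast
    obtain v b where v: "v \<in> U" and b: "\<forall>l<k. b l \<in> Rx m n \<and> emb v * p l = emb (b l)"
      using scalars[OF p] by blast
    have small: "gt (l, snd (lmv (G i))) R" if h: "h \<in> L" and R: "vc (\<lambda>c. b h * G h c) R \<noteq> 0" for h R
    proof -
      have hk: "h < k" using h by (simp add: L_def)
      have h_rep: "rep (p h *s g h) (\<lambda>c. b h * G h c) (v * u)"
        by (rule rep_scale[OF _ v _ G[OF hk]]) (use b hk in auto)
      obtain T where T: "is_lm T (\<lambda>c. b h * G h c)" using exists_lm[OF rep_D(1)[OF h_rep] R] .
      have LMT: "LM (p h *s g h) = Some T" by (rule LM_LC_eq(1)[OF h_rep T])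
      obtain X where X: "LM ?sp = Some X" "ge X T"
        using p_ge[OF hk] by (cases "LM ?sp") (auto simp: LMT lm_ge_Some, simp add: lm_ge_def)
      have Xlm: "is_lm X S" by (rule LM_eq_SomeD[OF sp_rep X(1)])
      have "ge T R" by (rule below_D[OF is_lm_D(2)[OF T] R])
      then have "ge X R"
        using ge_trans[OF X(2)] is_lm_MM[OF Xlm SV] is_lm_MM[OF T rep_D(1)[OF h_rep]] V_D[OF rep_D(1)[OF h_rep] R]
        by blast
      moreover have "gt (l, snd (lmv (G i))) X" by (rule S_below[OF is_lm_D(1)[OF Xlm]])
      moreover have "(l, snd (lmv (G i))) \<in> MM"
        unfolding l_def using mon_lcm_mons[of "fst (lmv (G i))" m n "fst (lmv (G j))"] M by auto
      ultimately show ?thesis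
        using gt_ge_trans is_lm_MM[OF Xlm SV] V_D[OF rep_D(1)[OF h_rep] R] by blast
    qed
    have eqn: "v * S c = (\<Sum>h\<in>L. b h * G h c)" for c
    proof -
      have "emb (v * S c) = emb (v * u) * ?sp $ c" by (simp add: emb_mult u_sp mult.assoc)
      also have "\<dots> = emb (\<Sum>h\<in>L. b h * G h c)" unfolding p_eq by (rule expand[OF b])
      finally show ?thesis by simp
    qed
    show "\<exists>w q. w \<in> U \<and> (\<forall>l\<in>L. q l \<in> Rx m n \<and>
          (\<forall>Q. vc (\<lambda>c. q l * G l c) Q \<noteq> 0 \<longrightarrow>
            gt (mon_lcm (fst (lmv (G i))) (fst (lmv (G j))), snd (lmv (G i))) Q)) \<and>
        (\<forall>c. w * (rx_term (1 / vc (G i) (lmv (G i))) (mon_lcm (fst (lmv (G i))) (fst (lmv (G j))) - fst (lmv (G i))) * G i c -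
                  rx_term (1 / vc (G j) (lmv (G j))) (mon_lcm (fst (lmv (G i))) (fst (lmv (G j))) - fst (lmv (G j))) * G j c) =
          (\<Sum>l\<in>L. q l * G l c))"
    proof (intro exI[of _ v] exI[of _ b] conjI ballI allI impI)
      show "v \<in> U" by (rule v)
      show "b h \<in> Rx m n" if "h \<in> L" for h using b that by (simp add: L_def)
      show "gt (mon_lcm (fst (lmv (G i))) (fst (lmv (G j))), snd (lmv (G i))) R"
        if "h \<in> L" "vc (\<lambda>c. b h * G h c) R \<noteq> 0" for h R
        using small[OF that] unfolding l_def .
      show "v * (rx_term (1 / vc (G i) (lmv (G i))) (mon_lcm (fst (lmv (G i))) (fst (lmv (G j))) - fst (lmv (G i))) * G i c -
                  rx_term (1 / vc (G j) (lmv (G j))) (mon_lcm (fst (lmv (G i))) (fst (lmv (G j))) - fst (lmv (G j))) * G j c) =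
          (\<Sum>l\<in>L. b l * G l c)" for c
        using eqn[of c] unfolding S_def l_def .
    qed
  qed (use L(1) GV Glm aR P rep_D(1)[OF f_rep] in auto)
  then obtain l x where lx: "l \<in> L" "P = shift x (lmv (G l))" by blast
  have "LM f = Some P" by (rule LM_LC_eq(1)[OF f_rep P])
  then have "lm_dvd (LM (g l)) (LM f)" using lx LMg(1) by (auto simp: lm_dvd_Some)
  then show ?thesis using lx(1) by (auto simp: L_def)
qed

lemma lm_dvd_iff_normal_forms_zero:
  fixes g :: "nat \<Rightarrow> 'k::field rx fract ^ 's"
  assumes J: "J \<subseteq> LocV" "is_submodule Loc J" and g: "\<And>i. i < k \<Longrightarrow> g i \<in> J"
  shows "(\<forall>f\<in>J. f \<noteq> 0 \<longrightarrow> (\<exists>i<k. lm_dvd (LM (g i)) (LM f))) \<longleftrightarrow>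
    (\<forall>f\<in>J. \<forall>r. normal_form m n gt k g f r \<longrightarrow> r = 0)"
proof safe
  fix f r assume dv: "\<forall>f\<in>J. f \<noteq> 0 \<longrightarrow> (\<exists>i<k. lm_dvd (LM (g i)) (LM f))"
    and f: "f \<in> J" and "normal_form m n gt k g f r"
  then obtain q where "division m n gt k g f q r" unfolding normal_form_def by blast
  then have q: "\<forall>i<k. q i \<in> Loc" "f = (\<Sum>i<k. q i *s g i) + r"
    "r \<noteq> 0 \<longrightarrow> (\<forall>i<k. \<not> lm_dvd (LM (g i)) (LM r))"
    unfolding division_def by simp_all
  have "(\<Sum>i<k. q i *s g i) \<in> J"
    by (rule submodule_sum[OF J(2)], rule submodule_scale[OF J(2)]) (use q(1) g in auto)
  moreover have "- 1 \<in> Loc" using emb_Loc[OF Rx_uminus[OF Rx_one]] by (simp add: emb_uminus)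
  ultimately have "f + (- 1) *s (\<Sum>i<k. q i *s g i) \<in> J"
    by (intro submodule_add[OF J(2)] submodule_scale[OF J(2)] f)
  moreover have "f + (- 1) *s (\<Sum>i<k. q i *s g i) = r" using q(2) by (simp add: vec_eq_iff)
  ultimately show "r = 0" using dv q(3) by metis
next
  fix f assume nf: "\<forall>f\<in>J. \<forall>r. normal_form m n gt k g f r \<longrightarrow> r = 0" and f: "f \<in> J" "f \<noteq> 0"
  show "\<exists>i<k. lm_dvd (LM (g i)) (LM f)"
  proof (rule ccontr)
    assume "\<not> ?thesis"
    then have "division m n gt k g f (\<lambda>_. 0) f"
      using f J(1) by (auto simp: division_def lm_ge_None)
    then show False using nf f unfolding normal_form_def by blast
  qed
qed

end

theorem theorem4p5:
  fixes m n k :: nat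
    and gt :: "'s::finite mmon \<Rightarrow> 's mmon \<Rightarrow> bool"
    and J :: "('k::field rx fract ^ 's) set"
    and g :: "nat \<Rightarrow> 'k rx fract ^ 's"
  assumes "mmon_ordering m n gt"
    and "t_local m gt"
    and "J \<subseteq> loc_vec m n gt"
    and "is_submodule (loc m n gt) J"
    and "\<forall>i<k. g i \<in> J"
  shows "(standard_basis m n gt J (g ` {..<k}) \<longleftrightarrow>
            (\<forall>f\<in>J. \<forall>r. normal_form m n gt k g f r \<longrightarrow> r = 0)) \<and>
         (standard_basis m n gt J (g ` {..<k}) \<longleftrightarrow>
            (\<forall>f\<in>J. standard_repr m n gt k g f)) \<and>
         (standard_basis m n gt J (g ` {..<k}) \<longleftrightarrow>
            J = generated (loc m n gt) (g ` {..<k}) \<and>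
            (\<forall>i j. i < j \<and> j < k \<longrightarrow> standard_repr m n gt k g (spoly m n gt (g i) (g j))))"
proof -
  interpret local_ordering m n gt by unfold_locales (fact assms)+
  have J: "J \<subseteq> LocV" "is_submodule Loc J" and g: "\<And>i. i < k \<Longrightarrow> g i \<in> J" using assms by auto
  have gL: "g i \<in> LocV" if "i < k" for i using g[OF that] J(1) by blast
  define dv where "dv \<longleftrightarrow> (\<forall>f\<in>J. f \<noteq> 0 \<longrightarrow> (\<exists>i<k. lm_dvd (LM (g i)) (LM f)))"
  have gJ: "g ` {..<k} \<subseteq> J" using g by auto
  have a: "standard_basis m n gt J (g ` {..<k}) \<longleftrightarrow> dv"
    unfolding standard_basis_iff[OF J(1) finite_imageI[OF finite_lessThan] gJ] dv_def by (simp add: Bex_def)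
  have b: "dv \<longleftrightarrow> (\<forall>f\<in>J. \<forall>r. normal_form m n gt k g f r \<longrightarrow> r = 0)"
    unfolding dv_def by (rule lm_dvd_iff_normal_forms_zero[OF J g])
  have c: "dv \<longleftrightarrow> (\<forall>f\<in>J. standard_repr m n gt k g f)"
    unfolding dv_def
  proof (intro iffI ballI impI)
    show "standard_repr m n gt k g f"
      if "\<forall>f\<in>J. f \<noteq> 0 \<longrightarrow> (\<exists>i<k. lm_dvd (LM (g i)) (LM f))" "f \<in> J" for f
      by (rule lm_dvd_imp_standard_repr[OF J g]) (use that in auto)
    show "\<exists>i<k. lm_dvd (LM (g i)) (LM f)"
      if "\<forall>f\<in>J. standard_repr m n gt k g f" "f \<in> J" "f \<noteq> 0" for f
      by (rule standard_repr_imp_lm_dvd[OF gL]) (use that in auto)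
  qed
  have gen_J: "generated Loc (g ` {..<k}) \<subseteq> J" by (rule generated_least[OF gJ J(2)])
  have J_gen: "J \<subseteq> generated Loc (g ` {..<k})" if all: "\<forall>f\<in>J. standard_repr m n gt k g f"
  proof
    fix f assume "f \<in> J"
    then obtain q where q: "\<forall>i<k. q i \<in> Loc" "f = (\<Sum>i<k. q i *s g i)"
      using all unfolding standard_repr_iff by blast
    have gi: "g i \<in> generated Loc (g ` {..<k})" if "i < k" for i
      by (rule subsetD[OF generated_superset]) (use that in simp)
    show "f \<in> generated Loc (g ` {..<k})"
      unfolding q(2)
      by (rule submodule_sum[OF generated_submodule], rule submodule_scale[OF generated_submodule])
        (use q(1) gi in auto)
  qed
  have cd: "J = generated Loc (g ` {..<k}) \<and>
      (\<forall>i j. i < j \<and> j < k \<longrightarrow> standard_repr m n gt k g (spoly m n gt (g i) (g j)))"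
    if all: "\<forall>f\<in>J. standard_repr m n gt k g f"
  proof (intro conjI allI impI)
    show "J = generated Loc (g ` {..<k})" using J_gen[OF all] gen_J by blast
    fix i j assume "i < j \<and> j < k"
    then have "spoly m n gt (g i) (g j) \<in> J" by (intro spoly_in_submodule[OF J] g) simp_all
    then show "standard_repr m n gt k g (spoly m n gt (g i) (g j))" using all by blast
  qed
  have da: "dv" if "J = generated Loc (g ` {..<k})"
    "\<forall>i j. i < j \<and> j < k \<longrightarrow> standard_repr m n gt k g (spoly m n gt (g i) (g j))"
    unfolding dv_def
  proof (intro ballI impI)
    fix f assume f: "f \<in> J" "f \<noteq> 0"
    show "\<exists>i<k. lm_dvd (LM (g i)) (LM f)"
      by (rule buchberger_criterion[OF gL]) (use that f in auto)
  qed
  show ?thesis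
  proof (intro conjI)
    show "standard_basis m n gt J (g ` {..<k}) \<longleftrightarrow>
        (\<forall>f\<in>J. \<forall>r. normal_form m n gt k g f r \<longrightarrow> r = 0)"
      unfolding a b ..
    show "standard_basis m n gt J (g ` {..<k}) \<longleftrightarrow> (\<forall>f\<in>J. standard_repr m n gt k g f)"
      unfolding a c ..
    show "standard_basis m n gt J (g ` {..<k}) \<longleftrightarrow>
        J = generated (loc m n gt) (g ` {..<k}) \<and>
        (\<forall>i j. i < j \<and> j < k \<longrightarrow> standard_repr m n gt k g (spoly m n gt (g i) (g j)))"
      unfolding a using cd[OF c[THEN iffD1]] da by (intro iffI) simp_all
  qed
qed

end
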